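(* Let $N\ge 3$, $n\ge 2$, let $a_1,\dots,a_n\in\mathbb{R}^N$ be distinct points, and let $\mu\ge 0$ be a weight function on $\mathbb{R}^N$ such that: (1) $\sqrt{\mu}\in H^1_{loc}(\mathbb{R}^N)$ and $\mu^{-1}\in L^1_{loc}(\mathbb{R}^N)$; (2) there exist constants $C_\mu,K_\mu\in\mathbb{R}$ with $K_\mu>2-N$ such that, with $\beta=\frac{N+K_\mu-2}{n}$, $$W(x):=-\sum_{i=1}^n\frac{\beta}{|x-a_i|^2}\left[(x-a_i)\cdot\frac{\nabla\mu(x)}{\mu(x)}-K_\mu\right]\le C_\mu\qquad\text{for a.e. } x\in\mathbb{R}^N;$$ (3) for every $i\in\{1,\dots,n\}$, $$\frac{\mu(x)}{|x-a_i|^{\frac{2}{n}(N+K_\mu-2)+2}}\in L^1_{loc}(\mathbb{R}^N);$$ (4) there exist constants $C$ and $\gamma>-(N+2K_\mu-2)$ such that $$\mu(x)\le\frac{C}{|x|^\gamma}\qquad\text{for } |x|>\max_i|a_i|.$$ Let $$V(x)=\frac{1}{2}\sum_{\substack{i,j=1\\ i\ne j}}^{n}\frac{|a_i-a_j|^2}{|x-a_i|^2|x-a_j|^2},\qquad c_{N,\mu}=\frac{(N+K_\mu-2)^2}{n^2}.$$ Then for every $c>c_{N,\mu}$ the inequality $$c\int_{\mathbb{R}^N}V\varphi^2\,d\mu\le\int_{\mathbb{R}^N}|\nabla\varphi|^2\,d\mu+\int_{\mathbb{R}^N}W\varphi^2\,d\mu$$ does not hold for all $\varphi\in H^1_\mu$;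 that is, there exists $\varphi\in H^1_\mu$ for which it fails.
   Context: Notation: $d\mu=\mu(x)\,dx$, where $dx$ is Lebesgue measure on $\mathbb{R}^N$. $L^2_\mu=L^2(\mathbb{R}^N,\mu(x)dx)$, and $H^1_\mu=H^1(\mathbb{R}^N,\mu(x)dx)$ is the weighted Sobolev space of (real-valued) functions in $L^2_\mu$ whose weak first-order derivatives belong to $L^2_\mu$, with norm $\|\varphi\|_{H^1_\mu}^2=\|\varphi\|_{L^2_\mu}^2+\|\nabla\varphi\|_{L^2_\mu}^2$. The gradient $\nabla\mu$ is the weak gradient of $\mu$ (so $\nabla\mu=2\sqrt{\mu}\,\nabla\sqrt{\mu}$); the condition $\mu^{-1}\in L^1_{loc}$ forces $\mu>0$ a.e. Since $W\le C_\mu$, the integral $\int W\varphi^2\,d\mu$ is well defined in $[-\infty,\infty)$ for $\varphi\in L^2_\mu$. *)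

theory Defs
  imports "HOL-Analysis.Analysis"
begin

text \<open>Iterated directional derivatives: a differentiable function all of whose directional
  derivatives are $C^k$ is $C^{k+1}$.\<close>
primrec Ck :: "nat \<Rightarrow> ('a::real_normed_vector \<Rightarrow> real) \<Rightarrow> bool" where
  "Ck 0 f \<longleftrightarrow> continuous_on UNIV f"
| "Ck (Suc k) f \<longleftrightarrow>
     (\<forall>x. f differentiable (at x)) \<and> (\<forall>v. Ck k (\<lambda>x. frechet_derivative f (at x) v))"

definition test_function :: "('a::real_normed_vector \<Rightarrow> real) \<Rightarrow> bool" where
  "test_function \<psi> \<longleftrightarrow> (\<forall>k. Ck k \<psi>) \<and> compact (closure {x. \<psi> x \<noteq> 0})"

definition locally_integrable ::
    "('a::euclidean_space \<Rightarrow> 'b::{banach, second_countable_topology}) \<Rightarrow> bool" where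
  "locally_integrable f \<longleftrightarrow> (\<forall>K. compact K \<longrightarrow> set_integrable lebesgue K f)"

text \<open>The variant for functions with values in $[0,\infty]$ is needed for reciprocals: in
  \<^typ>\<open>real\<close> one has \<open>inverse 0 = 0\<close>, whereas in \<^typ>\<open>ennreal\<close> one has \<open>inverse 0 = \<infinity>\<close>.\<close>
definition locally_integrable_ennreal :: "('a::euclidean_space \<Rightarrow> ennreal) \<Rightarrow> bool" where
  "locally_integrable_ennreal f \<longleftrightarrow> f \<in> borel_measurable lebesgue \<and>
     (\<forall>K. compact K \<longrightarrow> (\<integral>\<^sup>+x\<in>K. f x \<partial>lebesgue) < \<infinity>)"

definition has_weak_gradient :: "(real^'n \<Rightarrow> real) \<Rightarrow> (real^'n \<Rightarrow> real^'n) \<Rightarrow> bool" where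
  "has_weak_gradient f G \<longleftrightarrow> locally_integrable f \<and> locally_integrable G \<and>
     (\<forall>\<psi> i. test_function \<psi> \<longrightarrow>
        (\<integral>x. f x * frechet_derivative \<psi> (at x) (axis i 1) \<partial>lebesgue)
          = - (\<integral>x. G x $ i * \<psi> x \<partial>lebesgue))"

text \<open>The weak gradient is unique almost everywhere, so the choice only fixes a representative
  (and is arbitrary if no weak gradient exists).\<close>
definition weak_grad :: "(real^'n \<Rightarrow> real) \<Rightarrow> real^'n \<Rightarrow> real^'n" where
  "weak_grad f = (SOME G. has_weak_gradient f G)"

definition H1_loc :: "(real^'n \<Rightarrow> real) set" where
  "H1_loc = {f. locally_integrable (\<lambda>x. (f x)\<^sup>2) \<and>
     (\<exists>G. has_weak_gradient f G \<and> locally_integrable (\<lambda>x. (norm (G x))\<^sup>2))}"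

definition weighted :: "('a::euclidean_space \<Rightarrow> real) \<Rightarrow> 'a measure" where
  "weighted \<mu> = density lebesgue (\<lambda>x. ennreal (\<mu> x))"

definition L2 :: "'a measure \<Rightarrow> ('a \<Rightarrow> 'b::{banach, second_countable_topology}) set" where
  "L2 M = {f \<in> borel_measurable M. integrable M (\<lambda>x. (norm (f x))\<^sup>2)}"

text \<open>Weak derivatives are taken with respect to Lebesgue measure.  The local integrability built
  into \<^const>\<open>has_weak_gradient\<close> is no restriction when $\mu^{-1} \in L^1_{loc}$: by
  Cauchy-Schwarz, $L^2_\mu \subseteq L^1_{loc}$ in that case.\<close>
definition H1 :: "(real^'n \<Rightarrow> real) \<Rightarrow> (real^'n \<Rightarrow> real) set" where
  "H1 \<mu> = {f \<in> L2 (weighted \<mu>). \<exists>G \<in> L2 (weighted \<mu>). has_weak_gradient f G}"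

text \<open>Integral with values in $[-\infty,\infty]$; meaningful if the positive or the negative part
  has finite integral (\<^const>\<open>ennreal\<close> maps negative reals to \<open>0\<close>).\<close>
definition ext_integral :: "'a measure \<Rightarrow> ('a \<Rightarrow> real) \<Rightarrow> ereal" where
  "ext_integral M f =
     enn2ereal (\<integral>\<^sup>+x. ennreal (f x) \<partial>M) - enn2ereal (\<integral>\<^sup>+x. ennreal (- f x) \<partial>M)"

definition potV :: "(nat \<Rightarrow> real^'n) \<Rightarrow> nat \<Rightarrow> real^'n \<Rightarrow> real" where
  "potV a n x = 1/2 * (\<Sum>i\<in>{1..n}. \<Sum>j\<in>{1..n} - {i}.
     (norm (a i - a j))\<^sup>2 / ((norm (x - a i))\<^sup>2 * (norm (x - a j))\<^sup>2))"

definition potW ::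
    "(real^'n \<Rightarrow> real) \<Rightarrow> (nat \<Rightarrow> real^'n) \<Rightarrow> nat \<Rightarrow> real \<Rightarrow> real^'n \<Rightarrow> real" where
  "potW \<mu> a n K x =
     (let \<beta> = (real CARD('n) + K - 2) / real n in
      - (\<Sum>i\<in>{1..n}. \<beta> / (norm (x - a i))\<^sup>2 *
           ((x - a i) \<bullet> (weak_grad \<mu> x /\<^sub>R \<mu> x) - K)))"

end

theory Submission
  imports Defs "HOL-Real_Asymp.Real_Asymp"
begin

text \<open>With $\beta = (N + K_\mu - 2)/n$, the function $\varphi_0 = \prod_i |x - a_i|^{-\beta}$ gives
  equality in the Hardy inequality with constant $\beta^2 = c_{N,\mu}$.  Writing
  $\varphi = \varphi_0 \eta$ and integrating the term with $\nabla\mu$ in $W$ by parts against the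
  field $\varphi^2 \sum_i (x - a_i)/|x - a_i|^2$ yields
  $$\int |\nabla\varphi|^2 d\mu + \int W\varphi^2 d\mu
    = \beta^2 \int V\varphi^2 d\mu + \int \varphi_0^2 |\nabla\eta|^2 d\mu,$$
  because $|\sum_i (x - a_i)/|x - a_i|^2|^2 = n \sum_i |x - a_i|^{-2} - V$.  The cutoffs
  $\eta_k = \prod_i e^{-1/(k|x - a_i|^2)} \cdot e^{-k^2/(k^2 - |x|^2)}$ make $\varphi_0\eta_k$ smooth
  with compact support, so every integration by parts is one against a test function, and
  $\varphi_0^2 |\nabla\eta_k|^2$ is dominated by a multiple of
  $\varphi_0^2 \sum_i |x - a_i|^{-2}$.  This is integrable with respect to $\mu$, by (3) near the
  poles and by (4) at infinity; hence the last term tends to $0$, while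
  $\int V\varphi_0^2\eta_k^2 d\mu$ tends to $e^{-2} \int V\varphi_0^2 d\mu > 0$.\<close>

section \<open>Smooth functions\<close>

text \<open>Integration by parts against the field needs a weak gradient of \<mu> itself, whereas
  the hypothesis concerns sqrt \<mu>. The bridge is the rule grad(f^2) = 2 f grad f for f in H1_loc,
  proved by studying correlations of f with its translates instead of smoothing f. The exponential
  cutoffs serve two ends. Multiplied by any power of the distance to a pole they remain smooth, so
  \<phi>^2 times the singular field is a genuine test function. And t e^(-t) and t^2 e^(-t) are
  bounded for t \<ge> 0, so the cutoff times its logarithmic gradient is controlled, uniformly in k,
  by a multiple of the sum of the 1/|x - a_i|. As n \<beta> = N + K - 2, the condition on \<gamma>
  in (4) says that \<gamma> + 2 n \<beta> + 2 > N, which is what a convergent tail of \<phi>_0^2 sum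
  |x - a_i|^(-2) requires. Since \<open>weak_grad\<close> is an arbitrary choice, the classical
  gradient of the approximants has to be matched with it by almost everywhere uniqueness.\<close>

lemma Ck_SucI:
  assumes "\<And>x. (f has_derivative f' x) (at x)" and "\<And>v. Ck k (\<lambda>x. f' x v)"
  shows "Ck (Suc k) f"
proof -
  have "frechet_derivative f (at x) = f' x" for x
    using assms(1) by (metis frechet_derivative_at)
  then show ?thesis
    using assms by (auto simp: differentiable_def)
qed

lemma Ck_Suc_has_derivative:
  "Ck (Suc k) f \<Longrightarrow> (f has_derivative frechet_derivative f (at x)) (at x)"
  by (simp add: frechet_derivative_works)

lemma Ck_Suc_imp: "Ck (Suc k) f \<Longrightarrow> Ck k f"
proof (induction k arbitrary: f)
  case 0
  then show ?case
    by (auto intro!: continuous_at_imp_continuous_on differentiable_imp_continuous_within)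
next
  case (Suc k)
  then show ?case
    by (metis Ck.simps(2))
qed

lemma Ck_const [simp]: "Ck k (\<lambda>x. c)"
proof (induction k arbitrary: c)
  case (Suc k)
  show ?case
    by (rule Ck_SucI[where f' = "\<lambda>x v. 0"]) (auto intro: Suc)
qed auto

lemma Ck_bounded_linear:
  assumes "bounded_linear f"
  shows "Ck k f"
proof (cases k)
  case 0
  then show ?thesis using assms by (simp add: linear_continuous_on)
next
  case (Suc m)
  show ?thesis unfolding Suc
    by (rule Ck_SucI[where f' = "\<lambda>x. f"]) (auto intro: assms bounded_linear.has_derivative)
qed

lemma Ck_add:
  "Ck k f \<Longrightarrow> Ck k g \<Longrightarrow> Ck k (\<lambda>x. f x + g x)"
proof (induction k arbitrary: f g)
  case 0
  then show ?case by (auto intro: continuous_intros)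
next
  case (Suc k)
  note D = Suc.prems[THEN Ck_Suc_has_derivative]
  show ?case
    by (rule Ck_SucI, rule has_derivative_add[OF D], rule Suc.IH) (use Suc.prems in auto)
qed

lemma Ck_mult:
  "Ck k f \<Longrightarrow> Ck k g \<Longrightarrow> Ck k (\<lambda>x. f x * g x)"
proof (induction k arbitrary: f g)
  case 0
  then show ?case by (auto intro: continuous_intros)
next
  case (Suc k)
  note D = Suc.prems[THEN Ck_Suc_has_derivative]
  show ?case
    by (rule Ck_SucI, rule has_derivative_mult[OF D], intro Ck_add Suc.IH)
       (use Suc.prems Suc.prems[THEN Ck_Suc_imp] in auto)
qed

lemma Ck_cmult: "Ck k f \<Longrightarrow> Ck k (\<lambda>x. c * f x)"
  by (rule Ck_mult) auto

lemma Ck_diff: "Ck k f \<Longrightarrow> Ck k g \<Longrightarrow> Ck k (\<lambda>x. f x - g x)"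
  using Ck_add[OF _ Ck_cmult[of k g "-1"], of f] by simp

lemma Ck_sum: "(\<And>i. i \<in> A \<Longrightarrow> Ck k (f i)) \<Longrightarrow> Ck k (\<lambda>x. \<Sum>i\<in>A. f i x)"
  by (induction A rule: infinite_finite_induct) (auto intro: Ck_add)

lemma Ck_prod: "(\<And>i. i \<in> A \<Longrightarrow> Ck k (f i)) \<Longrightarrow> Ck k (\<lambda>x. \<Prod>i\<in>A. f i x)"
  by (induction A rule: infinite_finite_induct) (auto intro: Ck_mult)

text \<open>The derivative along \<open>v\<close> is the derivative of \<open>f\<close> along
  \<open>s *\<^sub>R v\<close> composed with the same affine map, so the induction hypothesis
  applies to it. Needed for translates (\<open>s = 1\<close>) and reflections
  (\<open>s = -1\<close>) of bump functions.\<close>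

lemma Ck_affine: "Ck k f \<Longrightarrow> Ck k (\<lambda>x. f (s *\<^sub>R x + y))"
proof (induction k arbitrary: f)
  case 0
  then show ?case
    by (auto intro!: continuous_on_compose2[of UNIV f UNIV "\<lambda>x. s *\<^sub>R x + y"] continuous_intros)
next
  case (Suc k)
  have D: "((\<lambda>x. f (s *\<^sub>R x + y)) has_derivative
      (\<lambda>v. frechet_derivative f (at (s *\<^sub>R x + y)) (s *\<^sub>R v))) (at x)" for x
    by (rule has_derivative_compose[OF _ Ck_Suc_has_derivative[OF Suc.prems]])
       (auto intro!: derivative_eq_intros)
  show ?case
    by (rule Ck_SucI[OF D], rule Suc.IH[of "\<lambda>x. frechet_derivative f (at x) (s *\<^sub>R v)" for v])
       (use Suc.prems in auto)
qed

lemma Ck_dist_sq: "Ck k (\<lambda>x::'a::euclidean_space. (norm (x - a))\<^sup>2)"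
proof -
  have "(norm (x - a))\<^sup>2 = (\<Sum>b\<in>Basis. (x \<bullet> b - a \<bullet> b) * (x \<bullet> b - a \<bullet> b))" for x
    unfolding power2_norm_eq_inner by (subst euclidean_inner) (simp add: inner_diff_left)
  moreover have "Ck k (\<lambda>x. x \<bullet> b - a \<bullet> b)" for b :: 'a
    by (rule Ck_diff[OF Ck_bounded_linear[OF bounded_linear_inner_left] Ck_const])
  ultimately show ?thesis
    by (auto intro!: Ck_sum Ck_mult)
qed

section \<open>Flat functions as smooth cutoffs\<close>

text \<open>The derivative of \<open>flat p \<epsilon>\<close> is a combination of \<open>flat (p + 1) \<epsilon>\<close> and \<open>flat (p + 2) \<epsilon>\<close>, so
  this family provides smooth cutoffs at a pole (argument \<open>(norm (x - a))\<^sup>2\<close>) as well as bump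
  functions, and dividing by the argument stays within the family.\<close>
definition flat :: "real \<Rightarrow> real \<Rightarrow> real \<Rightarrow> real" where
  "flat p \<epsilon> t = (if t > 0 then t powr (-p) * exp (- \<epsilon> / t) else 0)"

lemma flat_nonneg [simp]: "0 \<le> flat p \<epsilon> t"
  by (simp add: flat_def)

lemma flat_divide: "flat p \<epsilon> t / t = flat (p + 1) \<epsilon> t"
  using powr_add[of t "-p" "-1"] by (auto simp: flat_def powr_minus_divide)

lemma flat_tendsto_0:
  assumes "\<epsilon> > 0"
  shows "(flat p \<epsilon> \<longlongrightarrow> 0) (at 0)"
proof -
  have "((\<lambda>t. t powr (-p) * exp (- \<epsilon> / t)) \<longlongrightarrow> 0) (at_right 0)"
    using assms by real_asymp
  then have "(flat p \<epsilon> \<longlongrightarrow> 0) (at_right 0)"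
    by (rule Lim_transform_eventually) (auto simp: flat_def eventually_at_filter)
  moreover have "(flat p \<epsilon> \<longlongrightarrow> 0) (at_left 0)"
    by (rule Lim_transform_eventually[OF tendsto_const]) (auto simp: flat_def eventually_at_filter)
  ultimately show ?thesis
    by (simp add: filterlim_split_at)
qed

lemma flat_has_real_derivative:
  assumes "\<epsilon> > 0"
  shows "(flat p \<epsilon> has_real_derivative - p * flat (p + 1) \<epsilon> t + \<epsilon> * flat (p + 2) \<epsilon> t) (at t)"
proof (cases t "0::real" rule: linorder_cases)
  case greater
  have "((\<lambda>t. t powr (-p) * exp (- \<epsilon> / t)) has_real_derivative
      - p * flat (p + 1) \<epsilon> t + \<epsilon> * flat (p + 2) \<epsilon> t) (at t)"
    using greater
    by (auto intro!: derivative_eq_intros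
        simp: flat_def powr_diff powr_minus powr_add power2_eq_square field_simps)
  then show ?thesis
    by (rule has_field_derivative_transform_within[where d = t]) (use greater in \<open>auto simp: flat_def dist_real_def\<close>)
next
  case less
  have "((\<lambda>t. 0) has_real_derivative - p * flat (p + 1) \<epsilon> t + \<epsilon> * flat (p + 2) \<epsilon> t) (at t)"
    using less by (auto simp: flat_def)
  then show ?thesis
    by (rule has_field_derivative_transform_within[where d = "-t"]) (use less in \<open>auto simp: flat_def dist_real_def\<close>)
next
  \<comment> \<open>At 0 the difference quotient \<open>flat p \<epsilon> h / h\<close> is
    \<open>flat (p + 1) \<epsilon> h\<close>, another member of the family, which tends to
    0.\<close>
  case equal
  have "((\<lambda>h. (flat p \<epsilon> (0 + h) - flat p \<epsilon> 0) / h) \<longlongrightarrow> 0) (at 0)"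
    by (rule Lim_transform_eventually[OF flat_tendsto_0[OF assms, of "p + 1"]])
       (simp add: flat_divide[symmetric], simp add: flat_def)
  then show ?thesis
    using equal by (simp add: DERIV_def flat_def)
qed

lemma flat_eq_0_iff: "flat p \<epsilon> t = 0 \<longleftrightarrow> t \<le> 0"
  by (auto simp: flat_def)

lemma flat_mult: "flat p \<epsilon> t * flat q \<delta> t = flat (p + q) (\<epsilon> + \<delta>) t"
  using powr_add[of t "-p" "-q"] by (auto simp: flat_def exp_add[symmetric] diff_divide_distrib)

lemma flat_0_le_1: "\<epsilon> \<ge> 0 \<Longrightarrow> flat 0 \<epsilon> t \<le> 1"
  by (auto simp: flat_def)

lemma flat_has_derivative:
  assumes "\<epsilon> > 0" "(g has_derivative g') (at x)"
  shows "((\<lambda>x. flat p \<epsilon> (g x)) has_derivative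
    (\<lambda>v. (- p * flat (p + 1) \<epsilon> (g x) + \<epsilon> * flat (p + 2) \<epsilon> (g x)) * g' v)) (at x)"
  using has_derivative_compose[OF assms(2)
      flat_has_real_derivative[OF assms(1), unfolded has_field_derivative_def]] .

text \<open>The exponent \<open>p\<close> is kept general in the induction because differentiation
  raises it by one and by two.\<close>

lemma Ck_flat:
  assumes "\<epsilon> > 0" "\<And>k. Ck k g"
  shows "Ck k (\<lambda>x. flat p \<epsilon> (g x))"
proof (induction k arbitrary: p)
  case 0
  have "continuous_on UNIV (flat p \<epsilon>)"
    using DERIV_isCont[OF flat_has_real_derivative[OF assms(1)]] continuous_at_imp_continuous_on by blast
  moreover have "continuous_on UNIV g"
    using assms(2)[of 0] by simp
  ultimately show ?case
    using continuous_on_compose2[of UNIV "flat p \<epsilon>" UNIV g] by auto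
next
  case (Suc k)
  have D: "(g has_derivative frechet_derivative g (at x)) (at x)" for x
    using assms(2) Ck_Suc_has_derivative by blast
  have "Ck k (\<lambda>x. frechet_derivative g (at x) v)" for v
    using assms(2)[of "Suc k"] by simp
  then show ?case
    by (intro Ck_SucI[OF flat_has_derivative[OF assms(1) D]] Ck_mult Ck_add Ck_cmult Suc)
qed

section \<open>Weak gradients\<close>

text \<open>Integrability on compact sets gives measurability of the truncations to balls;
  \<open>f\<close> is their pointwise limit.\<close>

lemma locally_integrable_measurable:
  fixes f :: "'a::euclidean_space \<Rightarrow> 'b::{banach, second_countable_topology}"
  assumes "locally_integrable f"
  shows "f \<in> borel_measurable lebesgue"
proof (rule borel_measurable_LIMSEQ_metric)
  show "(\<lambda>x. indicat_real (cball 0 (real n)) x *\<^sub>R f x) \<in> borel_measurable lebesgue" for n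
    using assms unfolding locally_integrable_def set_integrable_def
    by (intro borel_measurable_integrable) auto
  fix x :: 'a
  obtain N where N: "norm x \<le> real N"
    using real_arch_simple by blast
  have "eventually (\<lambda>n. f x = indicat_real (cball 0 (real n)) x *\<^sub>R f x) sequentially"
    using eventually_ge_at_top[of N]
  proof eventually_elim
    case (elim n)
    then have "norm x \<le> real n" using N by linarith
    then show ?case by simp
  qed
  then show "(\<lambda>n. indicat_real (cball 0 (real n)) x *\<^sub>R f x) \<longlonglongrightarrow> f x"
    by (rule Lim_transform_eventually[OF tendsto_const])
qed

lemma integrable_cball_of_locally_integrable:
  "locally_integrable f \<Longrightarrow> integrable lebesgue (\<lambda>x. indicat_real (cball 0 R) x *\<^sub>R f x)"
  unfolding locally_integrable_def set_integrable_def by auto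

lemma locally_integrableI_cball:
  fixes f :: "'a::euclidean_space \<Rightarrow> 'b::{banach, second_countable_topology}"
  assumes "\<And>R. integrable lebesgue (\<lambda>x. indicat_real (cball 0 R) x *\<^sub>R f x)"
  shows "locally_integrable f"
  unfolding locally_integrable_def
proof (intro allI impI)
  fix K :: "'a set"
  assume K: "compact K"
  then obtain R where R: "K \<subseteq> cball 0 R"
    by (metis compact_imp_bounded bounded_subset_ballD ball_subset_cball subset_trans)
  have "set_integrable lebesgue (cball 0 R) f"
    using assms by (simp add: set_integrable_def)
  then show "set_integrable lebesgue K f"
  proof (rule set_integrable_subset)
    show "K \<in> sets lebesgue"
      using borel_compact[OF K] by simp
  qed (rule R)
qed

lemma bounded_of_support:
  fixes g :: "'a::euclidean_space \<Rightarrow> 'b::real_normed_vector"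
  assumes "continuous_on UNIV g" "\<And>x. norm x > R \<Longrightarrow> g x = 0"
  obtains M where "M \<ge> 0" "\<And>x. norm (g x) \<le> M * indicator (cball 0 R) x"
proof -
  have "compact (g ` cball 0 R)"
    using assms(1) by (intro compact_continuous_image continuous_on_subset[OF assms(1)]) auto
  then have "bounded (g ` cball 0 R)"
    by (rule compact_imp_bounded)
  then obtain M where "\<forall>y\<in>g ` cball 0 R. norm y \<le> M"
    unfolding bounded_iff by blast
  then have M: "norm (g x) \<le> M" if "x \<in> cball 0 R" for x
    using that by blast
  show ?thesis
  proof (rule that[of "max M 0"])
    show "0 \<le> max M 0"
      by simp
    show "norm (g x) \<le> max M 0 * indicator (cball 0 R) x" for x
    proof (cases "norm x \<le> R")
      case True
      then show ?thesis using M[of x] by simp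
    next
      case False
      then show ?thesis using assms(2)[of x] by simp
    qed
  qed
qed

text \<open>Ensures that the pairings in a weak formulation are true integrals, not the default
  value 0 of a non-integrable function, so that they may be added and split.\<close>

lemma integrable_continuous_mult_locally_integrable:
  fixes f :: "'a::euclidean_space \<Rightarrow> 'b::{banach, second_countable_topology}" and g :: "'a \<Rightarrow> real"
  assumes f: "locally_integrable f"
    and g: "continuous_on UNIV g" "\<And>x. norm x > R \<Longrightarrow> g x = 0"
  shows "integrable lebesgue (\<lambda>x. g x *\<^sub>R f x)"
proof -
  obtain M where M: "M \<ge> 0" "\<And>x. norm (g x) \<le> M * indicator (cball 0 R) x"
    using bounded_of_support[OF g] by auto
  note [measurable] = locally_integrable_measurable[OF f]
  have [measurable]: "g \<in> borel_measurable lebesgue"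
    using g(1) by (simp add: borel_measurable_continuous_onI measurable_completion)
  show ?thesis
  proof (rule Bochner_Integration.integrable_bound)
    show "integrable lebesgue (\<lambda>x. M *\<^sub>R (indicat_real (cball 0 R) x *\<^sub>R f x))"
      by (intro integrable_scaleR_right integrable_cball_of_locally_integrable f)
    show "AE x in lebesgue. norm (g x *\<^sub>R f x) \<le> norm (M *\<^sub>R (indicat_real (cball 0 R) x *\<^sub>R f x))"
      using M by (intro always_eventually allI)
        (auto simp: mult.assoc[symmetric] intro!: mult_right_mono simp del: mult_eq_0_iff)
  qed measurable
qed

lemma locally_integrable_continuous:
  fixes f :: "'a::euclidean_space \<Rightarrow> 'b::{banach, second_countable_topology}"
  assumes "continuous_on UNIV f"
  shows "locally_integrable f"
  unfolding locally_integrable_def set_integrable_def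
proof (intro allI impI)
  fix K :: "'a set"
  assume "compact K"
  then have "integrable lborel (\<lambda>x. indicator K x *\<^sub>R f x)"
    by (intro borel_integrable_compact continuous_on_subset[OF assms]) auto
  then show "integrable lebesgue (\<lambda>x. indicat_real K x *\<^sub>R f x)"
    by (simp add: integrable_completion)
qed

section \<open>Test functions and integration by parts\<close>

lemma test_functionI:
  fixes \<psi> :: "'a::euclidean_space \<Rightarrow> real"
  assumes "\<And>k. Ck k \<psi>" "\<And>x. norm x > R \<Longrightarrow> \<psi> x = 0"
  shows "test_function \<psi>"
proof -
  have "{x. \<psi> x \<noteq> 0} \<subseteq> cball 0 R"
    using assms(2) by force
  then have "bounded {x. \<psi> x \<noteq> 0}"
    using bounded_cball bounded_subset by blast
  then show ?thesis
    using assms(1) by (simp add: test_function_def compact_closure)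
qed

lemma test_function_Ck: "test_function \<psi> \<Longrightarrow> Ck k \<psi>"
  by (simp add: test_function_def)

lemma test_function_support:
  fixes \<psi> :: "'a::euclidean_space \<Rightarrow> real"
  assumes "test_function \<psi>"
  obtains R where "R > 0" "\<And>x. norm x > R \<Longrightarrow> \<psi> x = 0"
proof -
  have "bounded {x. \<psi> x \<noteq> 0}"
    using assms compact_imp_bounded bounded_subset closure_subset
    unfolding test_function_def by metis
  then obtain R where R: "\<forall>x\<in>{x. \<psi> x \<noteq> 0}. norm x \<le> R"
    unfolding bounded_iff by blast
  show ?thesis
  proof (rule that[of "max R 1"])
    show "\<psi> x = 0" if "norm x > max R 1" for x
      using R that by (metis (mono_tags) max_less_iff_conj mem_Collect_eq not_le)
  qed simp
qed

lemma Ck_imp_continuous: "Ck k f \<Longrightarrow> continuous_on UNIV f"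
proof (induction k)
  case (Suc k)
  then show ?case using Ck_Suc_imp by blast
qed simp

lemma frechet_derivative_eq_0_outside:
  fixes f :: "'a::euclidean_space \<Rightarrow> real"
  assumes "\<And>x. norm x > R \<Longrightarrow> f x = 0" "norm x > R"
  shows "frechet_derivative f (at x) v = 0"
proof -
  have "((\<lambda>x. 0) has_derivative (\<lambda>v. 0)) (at x)" by simp
  then have "(f has_derivative (\<lambda>v. 0)) (at x)"
  proof (rule has_derivative_transform_within_open)
    show "open {x. norm x > R}"
      by (intro open_Collect_less continuous_intros)
  qed (use assms in auto)
  then show ?thesis
    using frechet_derivative_at by metis
qed

text \<open>By translation invariance every difference quotient of \<open>f\<close> has integral 0.
  The mean value theorem dominates the quotients, so the integral of their limit is 0 as
  well.\<close>

lemma integral_frechet_derivative_eq_0: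
  fixes f :: "'a::euclidean_space \<Rightarrow> real"
  assumes f: "Ck (Suc 0) f" and supp: "\<And>x. norm x > R \<Longrightarrow> f x = 0"
  shows "(\<integral>x. frechet_derivative f (at x) v \<partial>lebesgue) = 0"
proof -
  let ?D = "\<lambda>x. frechet_derivative f (at x) v"
  have cont: "continuous_on UNIV f" "continuous_on UNIV ?D"
    using Ck_imp_continuous[OF f] f by auto
  have [measurable]: "f \<in> borel_measurable borel" "?D \<in> borel_measurable borel"
    using cont by (auto intro: borel_measurable_continuous_onI)
  obtain M where M: "M \<ge> 0" "\<And>x. norm (?D x) \<le> M * indicator (cball 0 R) x"
    by (rule bounded_of_support[OF cont(2), of R])
      (simp_all add: frechet_derivative_eq_0_outside[where R = R] supp)
  have MVT: "\<exists>s. 0 < s \<and> s < 1 \<and> f (x + h *\<^sub>R v) - f x = h * ?D (x + (s * h) *\<^sub>R v)"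
    if "h > 0" for x h
  proof -
    have "\<exists>s>0. s < 1 \<and> f (x + (1 * h) *\<^sub>R v) - f (x + (0 * h) *\<^sub>R v)
        = (1 - 0) * (h * ?D (x + (s * h) *\<^sub>R v))"
    proof (rule MVT2)
      fix s :: real
      have "((\<lambda>s. f (x + (s * h) *\<^sub>R v)) has_derivative
          (\<lambda>t. frechet_derivative f (at (x + (s * h) *\<^sub>R v)) ((t * h) *\<^sub>R v))) (at s)"
        by (rule has_derivative_compose[OF _ Ck_Suc_has_derivative[OF f]])
           (auto intro!: derivative_eq_intros)
      moreover have "linear (frechet_derivative f (at y))" for y
        using Ck_Suc_has_derivative[OF f] has_derivative_linear by blast
      ultimately show "((\<lambda>s. f (x + (s * h) *\<^sub>R v)) has_real_derivative
          h * ?D (x + (s * h) *\<^sub>R v)) (at s)"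
        by (intro has_derivative_imp_has_field_derivative) (auto simp: linear_cmul mult.assoc)
    qed auto
    then show ?thesis by auto
  qed
  define h where "h = (\<lambda>n::nat. 1 / real (Suc n))"
  have h: "h n > 0" "h n \<le> 1" for n
    by (auto simp: h_def)
  have h0: "h \<longlonglongrightarrow> 0"
    unfolding h_def by (rule LIMSEQ_inverse_real_of_nat[unfolded inverse_eq_divide])
  define Q where "Q = (\<lambda>n x. (f (x + h n *\<^sub>R v) - f x) / h n)"
  have int_f: "integrable lborel f"
  proof -
    have "integrable lborel (\<lambda>x. indicator (cball 0 R) x *\<^sub>R f x)"
      by (intro borel_integrable_compact continuous_on_subset[OF cont(1)]) auto
    also have "(\<lambda>x. indicator (cball 0 R) x *\<^sub>R f x) = f"
      using supp by (force simp: indicator_def)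
    finally show ?thesis .
  qed
  have shift: "integrable lborel (\<lambda>x. f (x + w)) \<and> (\<integral>x. f (x + w) \<partial>lborel) = (\<integral>x. f x \<partial>lborel)" for w
  proof -
    have "(\<lambda>x. x + w) = (+) w"
      by (auto simp: add.commute)
    then have "distr lborel borel (\<lambda>x. x + w) = lborel"
      using lborel_distr_plus[of w] by simp
    then show ?thesis
      using int_f integrable_distr_eq[of "\<lambda>x. x + w" lborel borel f]
        integral_distr[of "\<lambda>x. x + w" lborel borel f] by simp
  qed
  have "(\<lambda>n. \<integral>x. Q n x \<partial>lborel) \<longlonglongrightarrow> (\<integral>x. ?D x \<partial>lborel)"
  proof (rule integral_dominated_convergence)
    \<comment> \<open>The step sizes \<open>h n\<close> are at most 1, so all quotients are
      supported in the ball of radius \<open>R + norm v\<close>.\<close>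
    show "integrable lborel (\<lambda>x::'a. M * indicator (cball 0 (R + norm v)) x)"
      by (auto intro!: integrable_mult_right integrable_real_indicator emeasure_lborel_cball_finite)
    show "AE x in lborel. (\<lambda>n. Q n x) \<longlonglongrightarrow> ?D x"
    proof (intro always_eventually allI)
      fix x
      have "((\<lambda>s. f (x + s *\<^sub>R v)) has_derivative
          (\<lambda>t. frechet_derivative f (at (x + 0 *\<^sub>R v)) (t *\<^sub>R v))) (at 0)"
        by (rule has_derivative_compose[OF _ Ck_Suc_has_derivative[OF f]])
           (auto intro!: derivative_eq_intros)
      moreover have "linear (frechet_derivative f (at x))"
        using Ck_Suc_has_derivative[OF f] has_derivative_linear by blast
      ultimately have "((\<lambda>s. f (x + s *\<^sub>R v)) has_real_derivative ?D x) (at 0)"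
        by (intro has_derivative_imp_has_field_derivative) (auto simp: linear_cmul)
      then have "((\<lambda>s. (f (x + s *\<^sub>R v) - f x) / s) \<longlongrightarrow> ?D x) (at 0)"
        by (simp add: DERIV_def)
      then show "(\<lambda>n. Q n x) \<longlonglongrightarrow> ?D x"
        unfolding Q_def
        by (rule filterlim_compose) (use h h0 in \<open>auto simp: filterlim_at intro!: always_eventually less_imp_neq[THEN not_sym]\<close>)
    qed
    show "AE x in lborel. norm (Q n x) \<le> M * indicator (cball 0 (R + norm v)) x" for n
    proof (intro always_eventually allI)
      fix x
      obtain s where s: "0 < s" "s < 1" "f (x + h n *\<^sub>R v) - f x = h n * ?D (x + (s * h n) *\<^sub>R v)"
        using MVT[OF h(1)] by blast
      then have "Q n x = ?D (x + (s * h n) *\<^sub>R v)"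
        using h(1)[of n] by (simp add: Q_def)
      then have "norm (Q n x) \<le> M * indicator (cball 0 R) (x + (s * h n) *\<^sub>R v)"
        using M by simp
      also have "\<dots> \<le> M * indicator (cball 0 (R + norm v)) x"
      proof (rule mult_left_mono)
        have "norm x \<le> norm (x + (s * h n) *\<^sub>R v) + norm ((s * h n) *\<^sub>R v)"
          using norm_triangle_ineq4[of "x + (s * h n) *\<^sub>R v" "(s * h n) *\<^sub>R v"] by simp
        moreover have "norm ((s * h n) *\<^sub>R v) \<le> norm v"
          using s h[of n] by (simp add: mult_left_le_one_le mult_le_one)
        ultimately show "indicator (cball 0 R) (x + (s * h n) *\<^sub>R v)
            \<le> (indicator (cball 0 (R + norm v)) x :: real)"
          by (auto simp: indicator_def)
      qed (use M in auto)
      finally show "norm (Q n x) \<le> M * indicator (cball 0 (R + norm v)) x" .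
    qed
  qed (auto simp: Q_def)
  moreover have "(\<integral>x. Q n x \<partial>lborel) = 0" for n
    using shift[of "h n *\<^sub>R v"] int_f by (simp add: Q_def)
  ultimately have "(\<integral>x. ?D x \<partial>lborel) = 0"
    by (simp add: LIMSEQ_const_iff)
  then show ?thesis
    by (simp add: integral_completion)
qed

text \<open>The product of \<open>f\<close> with a test function is C^1 with compact support, so its
  partial derivatives have integral 0; the product rule splits this into the two sides of the weak
  formulation.\<close>

lemma has_weak_gradient_classical:
  fixes f :: "real^'n \<Rightarrow> real"
  assumes f: "Ck (Suc 0) f" and G: "\<And>x v. frechet_derivative f (at x) v = G x \<bullet> v"
  shows "has_weak_gradient f G"
  unfolding has_weak_gradient_def
proof (intro conjI allI impI)
  have comp: "G x $ i = frechet_derivative f (at x) (axis i 1)" for x i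
    by (simp add: G inner_axis)
  have cG: "continuous_on UNIV (\<lambda>x. G x $ i)" for i
    unfolding comp using f by auto
  have cf: "continuous_on UNIV f"
    using f Ck_imp_continuous by blast
  show "locally_integrable f" "locally_integrable G"
    using cf cG continuous_on_vec_lambda[of UNIV "\<lambda>i x. G x $ i"]
    by (auto intro!: locally_integrable_continuous)
  fix \<psi> :: "real^'n \<Rightarrow> real" and i :: 'n
  assume psi: "test_function \<psi>"
  obtain R where R: "\<And>x. norm x > R \<Longrightarrow> \<psi> x = 0"
    using test_function_support[OF psi] by blast
  have psi1: "Ck (Suc 0) \<psi>"
    using psi by (rule test_function_Ck)
  have cpsi: "continuous_on UNIV \<psi>" "continuous_on UNIV (\<lambda>x. frechet_derivative \<psi> (at x) (axis i 1))"
    using Ck_imp_continuous[OF psi1] psi1 by auto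
  have D: "frechet_derivative (\<lambda>x. f x * \<psi> x) (at x) (axis i 1)
      = f x * frechet_derivative \<psi> (at x) (axis i 1) + G x $ i * \<psi> x" for x
    using fun_cong[OF frechet_derivative_at[OF has_derivative_mult[OF
          Ck_Suc_has_derivative[OF f] Ck_Suc_has_derivative[OF psi1]], of x], of "axis i 1"]
    by (simp only: comp)
  have "integrable lebesgue (\<lambda>x. frechet_derivative \<psi> (at x) (axis i 1) *\<^sub>R f x)"
    by (rule integrable_continuous_mult_locally_integrable[OF _ cpsi(2)
          frechet_derivative_eq_0_outside[OF R]])
       (use cf locally_integrable_continuous in auto)
  moreover have "integrable lebesgue (\<lambda>x. \<psi> x *\<^sub>R (G x $ i))"
    by (rule integrable_continuous_mult_locally_integrable[OF _ cpsi(1) R])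
       (use cG locally_integrable_continuous in auto)
  moreover have "(\<integral>x. frechet_derivative (\<lambda>x. f x * \<psi> x) (at x) (axis i 1) \<partial>lebesgue) = 0"
    by (rule integral_frechet_derivative_eq_0[where R = R, OF Ck_mult[OF f psi1]]) (use R in auto)
  ultimately show "(\<integral>x. f x * frechet_derivative \<psi> (at x) (axis i 1) \<partial>lebesgue)
      = - (\<integral>x. G x $ i * \<psi> x \<partial>lebesgue)"
    unfolding D by (simp add: mult.commute)
qed

section \<open>The fundamental lemma of the calculus of variations\<close>

lemma integral_box_eq_0:
  fixes D :: "'a::euclidean_space \<Rightarrow> real"
  assumes D: "locally_integrable D"
    and test: "\<And>\<psi>. test_function \<psi> \<Longrightarrow> (\<integral>x. D x * \<psi> x \<partial>lebesgue) = 0"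
  shows "(\<integral>x. D x * indicator (box l u) x \<partial>lebesgue) = 0"
proof -
  \<comment> \<open>For t > 0, \<open>flat 0 \<epsilon> t\<close> is exp(-\<epsilon>/t). The product
    over the distances to the faces is therefore smooth, lies in [0, 1], vanishes off the open box
    and tends to 1 inside it as \<epsilon> tends to 0.\<close>
  define w where "w = (\<lambda>(n::nat) x. \<Prod>b\<in>Basis. flat 0 (1 / real (Suc n)) (x \<bullet> b - l \<bullet> b)
      * flat 0 (1 / real (Suc n)) (u \<bullet> b - x \<bullet> b))"
  have w0: "w n x = 0" if x: "x \<notin> box l u" for n x
  proof -
    obtain b where "b \<in> Basis" "x \<bullet> b \<le> l \<bullet> b \<or> u \<bullet> b \<le> x \<bullet> b"
      using x by (force simp: mem_box)
    then show ?thesis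
      unfolding w_def by (intro prod_zero) (auto simp: flat_eq_0_iff intro!: bexI[of _ b])
  qed
  have w1: "0 \<le> w n x" "w n x \<le> 1" for n x
    unfolding w_def by (auto intro!: prod_nonneg prod_le_1 mult_le_one flat_0_le_1)
  have Ckw: "Ck k (w n)" for k n
    unfolding w_def
    by (intro Ck_prod Ck_mult Ck_flat Ck_diff[OF Ck_bounded_linear[OF bounded_linear_inner_left] Ck_const]
        Ck_diff[OF Ck_const Ck_bounded_linear[OF bounded_linear_inner_left]]) auto
  have "bounded (box l u)"
    by (rule bounded_box)
  then obtain R where R: "box l u \<subseteq> cball 0 R"
    by (metis bounded_subset_ballD ball_subset_cball subset_trans)
  have wtest: "test_function (w n)" for n
    by (rule test_functionI[where R = R, OF Ckw]) (use w0 R in force)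
  have wlim: "(\<lambda>n. w n x) \<longlonglongrightarrow> indicator (box l u) x" for x
  proof (cases "x \<in> box l u")
    case True
    then have pos: "x \<bullet> b - l \<bullet> b > 0" "u \<bullet> b - x \<bullet> b > 0" if "b \<in> Basis" for b
      using that by (auto simp: mem_box)
    have lim: "(\<lambda>n. flat 0 (1 / real (Suc n)) t) \<longlonglongrightarrow> 1" if "t > 0" for t
    proof -
      have "(\<lambda>n. exp (- (1 / real (Suc n)) / t)) \<longlonglongrightarrow> exp (- 0 / t)"
        using that by (intro tendsto_intros LIMSEQ_inverse_real_of_nat[unfolded inverse_eq_divide]) auto
      then show ?thesis using that by (simp add: flat_def)
    qed
    have "(\<lambda>n. w n x) \<longlonglongrightarrow> (\<Prod>b\<in>(Basis :: 'a set). 1 * 1)"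
      unfolding w_def by (intro tendsto_prod tendsto_mult lim pos)
    then show ?thesis using True by simp
  next
    case False
    then show ?thesis by (simp add: w0)
  qed
  note [measurable] = locally_integrable_measurable[OF D]
  have [measurable]: "w n \<in> borel_measurable lebesgue" for n
    using Ckw[of 0 n] by (simp add: borel_measurable_continuous_onI measurable_completion)
  have "(\<lambda>n. \<integral>x. D x * w n x \<partial>lebesgue) \<longlonglongrightarrow> (\<integral>x. D x * indicator (box l u) x \<partial>lebesgue)"
  proof (rule integral_dominated_convergence)
    show "integrable lebesgue (\<lambda>x. norm (indicat_real (cball 0 R) x *\<^sub>R D x))"
      by (intro integrable_norm integrable_cball_of_locally_integrable D)
    show "AE x in lebesgue. (\<lambda>n. D x * w n x) \<longlonglongrightarrow> D x * indicator (box l u) x"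
      by (intro always_eventually allI tendsto_intros wlim)
    show "AE x in lebesgue. norm (D x * w n x) \<le> norm (indicat_real (cball 0 R) x *\<^sub>R D x)" for n
    proof (intro always_eventually allI)
      fix x
      show "norm (D x * w n x) \<le> norm (indicat_real (cball 0 R) x *\<^sub>R D x)"
        using w0[of x n] w1[of n x] R by (cases "x \<in> box l u") (auto simp: abs_mult mult_left_le)
    qed
  qed (intro borel_measurable_times borel_measurable_indicator; auto)+
  then show ?thesis
    by (simp add: test[OF wtest] LIMSEQ_const_iff)
qed

text \<open>The positive and the negative part of the function, as densities on a bounded box,
  define two measures that agree on all boxes. Boxes form an intersection-stable generator, so the
  measures are equal, and evaluating them where the function is positive gives 0.\<close>

lemma fundamental_lemma_le:
  fixes D :: "'a::euclidean_space \<Rightarrow> real"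
  assumes D: "locally_integrable D"
    and test: "\<And>\<psi>. test_function \<psi> \<Longrightarrow> (\<integral>x. D x * \<psi> x \<partial>lebesgue) = 0"
  shows "AE x in lebesgue. D x \<le> 0"
proof -
  \<comment> \<open>The generator argument takes place on Borel sets, hence the Borel
    representative.\<close>
  obtain D' where D'[measurable]: "D' \<in> borel_measurable lborel" and DD: "AE x in lborel. D x = D' x"
    using completion_ex_borel_measurable_real[OF locally_integrable_measurable[OF D]] by blast
  define B where "B = (\<lambda>n::nat. box (- (real n *\<^sub>R One)) (real n *\<^sub>R One :: 'a))"
  have [measurable]: "B n \<in> sets borel" for n
    by (simp add: B_def)
  have int_box: "integrable lborel (\<lambda>x. D' x * indicator (box l u) x)
      \<and> (\<integral>x. D' x * indicator (box l u) x \<partial>lborel) = 0" for l u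
  proof -
    have AE: "AE x in lebesgue. D x * indicator (box l u) x = D' x * indicator (box l u) x"
      using AE_completion[OF DD] by auto
    have [measurable]: "D \<in> borel_measurable lebesgue" "D' \<in> borel_measurable lebesgue"
      using locally_integrable_measurable[OF D] measurable_completion[OF D'] by auto
    have "set_integrable lebesgue (cbox l u) D"
      using D by (simp add: locally_integrable_def)
    then have "set_integrable lebesgue (box l u) D"
      by (rule set_integrable_subset) (auto simp: box_subset_cbox)
    then have "integrable lebesgue (\<lambda>x. D x * indicator (box l u) x)"
      by (simp add: set_integrable_def mult.commute)
    moreover have "integrable lebesgue (\<lambda>x. D x * indicator (box l u) x)
        \<longleftrightarrow> integrable lebesgue (\<lambda>x. D' x * indicator (box l u) x)"
      by (intro integrable_cong_AE[OF _ _ AE] borel_measurable_times borel_measurable_indicator) auto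
    moreover have "(\<integral>x. D x * indicator (box l u) x \<partial>lebesgue)
        = (\<integral>x. D' x * indicator (box l u) x \<partial>lebesgue)"
      by (intro integral_cong_AE[OF _ _ AE] borel_measurable_times borel_measurable_indicator) auto
    ultimately show ?thesis
      using integral_box_eq_0[OF D test, of l u]
      by (simp add: integrable_completion integral_completion)
  qed
  have nn_eq: "(\<integral>\<^sup>+x. ennreal (D' x) * indicator (box l u) x \<partial>lborel)
      = (\<integral>\<^sup>+x. ennreal (- D' x) * indicator (box l u) x \<partial>lborel)
      \<and> (\<integral>\<^sup>+x. ennreal (D' x) * indicator (box l u) x \<partial>lborel) \<noteq> \<infinity>" for l u
  proof -
    let ?h = "\<lambda>x. D' x * indicator (box l u) x"
    have h: "integrable lborel ?h" "(\<integral>x. ?h x \<partial>lborel) = 0"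
      using int_box[of l u] by auto
    have fin: "(\<integral>\<^sup>+x. ennreal (?h x) \<partial>lborel) \<noteq> \<infinity>" "(\<integral>\<^sup>+x. ennreal (- ?h x) \<partial>lborel) \<noteq> \<infinity>"
      using h(1) by (auto simp: real_integrable_def)
    have "enn2real (\<integral>\<^sup>+x. ennreal (?h x) \<partial>lborel) = enn2real (\<integral>\<^sup>+x. ennreal (- ?h x) \<partial>lborel)"
      using real_lebesgue_integral_def[OF h(1)] h(2) by simp
    moreover have "a = b" if "enn2real a = enn2real b" "a \<noteq> \<infinity>" "b \<noteq> \<infinity>" for a b
      using that by (metis ennreal_enn2real infinity_ennreal_def less_top)
    ultimately have "(\<integral>\<^sup>+x. ennreal (?h x) \<partial>lborel) = (\<integral>\<^sup>+x. ennreal (- ?h x) \<partial>lborel)"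
      using fin by blast
    moreover have "ennreal (?h x) = ennreal (D' x) * indicator (box l u) x"
      "ennreal (- ?h x) = ennreal (- D' x) * indicator (box l u) x" for x
      by (auto simp: indicator_def)
    ultimately show ?thesis
      using fin by simp
  qed
  have "AE x in lborel. D' x * indicator (B n) x \<le> 0" for n
  proof -
    define M1 where "M1 = density lborel (\<lambda>x. ennreal (D' x) * indicator (B n) x)"
    define M2 where "M2 = density lborel (\<lambda>x. ennreal (- D' x) * indicator (B n) x)"
    have em1: "emeasure M1 A = (\<integral>\<^sup>+x. ennreal (D' x) * indicator (B n \<inter> A) x \<partial>lborel)"
      and em2: "emeasure M2 A = (\<integral>\<^sup>+x. ennreal (- D' x) * indicator (B n \<inter> A) x \<partial>lborel)"
      if [measurable]: "A \<in> sets borel" for A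
      by (simp_all add: M1_def M2_def emeasure_density indicator_inter_arith mult.assoc)
    have inter: "\<exists>l' u'. B n \<inter> box l u = box l' u'" for l u
      unfolding B_def box_Int_box by blast
    have "M1 = M2"
    proof (rule measure_eqI_generator_eq[where E = "range (\<lambda>(l, u). box l u)" and \<Omega> = UNIV and A = B])
      show "Int_stable (range (\<lambda>(l, u). box l u :: 'a set))"
        by (auto simp: Int_stable_def box_Int_box)
      show "emeasure M1 X = emeasure M2 X" if "X \<in> range (\<lambda>(l, u). box l u)" for X
      proof -
        from that obtain p where "X = (\<lambda>(l, u). box l u) p"
          by blast
        then have X: "X = box (fst p) (snd p)"
          by (simp add: split_beta)
        obtain l' u' where "B n \<inter> X = box l' u'" using inter X by blast
        then show ?thesis using nn_eq[of l' u'] by (simp add: em1 em2 X)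
      qed
      show "emeasure M1 (B i) \<noteq> \<infinity>" for i
      proof -
        obtain l' u' where "B n \<inter> B i = box l' u'"
          using inter unfolding B_def by blast
        then show ?thesis using nn_eq[of l' u', THEN conjunct2] by (simp add: em1)
      qed
      show "(\<Union>i. B i) = UNIV"
        unfolding B_def by (rule UN_box_eq_UNIV)
      show "range B \<subseteq> range (\<lambda>(l, u). box l u)"
      proof (rule image_subsetI)
        show "B i \<in> range (\<lambda>(l, u). box l u)" for i
          by (rule range_eqI[of _ _ "(- (real i *\<^sub>R One), real i *\<^sub>R One)"]) (simp add: B_def)
      qed
      show "sets M1 = sigma_sets UNIV (range (\<lambda>(l, u). box l u))"
        "sets M2 = sigma_sets UNIV (range (\<lambda>(l, u). box l u))"
        by (simp_all add: M1_def M2_def borel_eq_box[where 'a = 'a])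
    qed simp
    \<comment> \<open>On \<open>P\<close> the density of \<open>M2\<close> is 0, so
      \<open>M1\<close> gives \<open>P\<close> measure 0 too, although its density is positive on
      the part of \<open>P\<close> inside \<open>B n\<close>.\<close>
    define P where "P = {x. D' x > 0}"
    have P[measurable]: "P \<in> sets borel"
      unfolding P_def using D' by measurable
    have "emeasure M2 P = 0"
      by (auto simp: em2 P_def nn_integral_0_iff_AE ennreal_neg indicator_def)
    then have "(\<integral>\<^sup>+x. ennreal (D' x) * indicator (B n \<inter> P) x \<partial>lborel) = 0"
      using \<open>M1 = M2\<close> by (simp add: em1[symmetric])
    then have "AE x in lborel. ennreal (D' x) * indicator (B n \<inter> P) x = 0"
      by (subst (asm) nn_integral_0_iff_AE) auto
    then show ?thesis
      by eventually_elim (auto simp: P_def indicator_def ennreal_eq_0_iff split: if_splits)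
  qed
  then have "AE x in lborel. \<forall>n. D' x * indicator (B n) x \<le> 0"
    by (simp add: AE_all_countable)
  then have "AE x in lborel. D x \<le> 0"
    using DD
  proof eventually_elim
    case (elim x)
    have "x \<in> (\<Union>n. B n)"
      unfolding B_def by (simp add: UN_box_eq_UNIV)
    then obtain n where "x \<in> B n" by blast
    then show ?case
      using elim(1)[rule_format, of n] elim(2) by simp
  qed
  then show ?thesis by (rule AE_completion)
qed

lemma fundamental_lemma:
  fixes D :: "'a::euclidean_space \<Rightarrow> real"
  assumes D: "locally_integrable D"
    and test: "\<And>\<psi>. test_function \<psi> \<Longrightarrow> (\<integral>x. D x * \<psi> x \<partial>lebesgue) = 0"
  shows "AE x in lebesgue. D x = 0"
proof -
  have "AE x in lebesgue. - D x \<le> 0"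
    using D test by (intro fundamental_lemma_le) (auto simp: locally_integrable_def set_integrable_def)
  moreover have "AE x in lebesgue. D x \<le> 0"
    by (rule fundamental_lemma_le[OF D test])
  ultimately show ?thesis
    by eventually_elim auto
qed

text \<open>Lets a computed gradient replace the chosen representative \<open>weak_grad\<close>
  under an integral. The components of the difference are annihilated by all test functions, so the
  fundamental lemma applies to each.\<close>

lemma has_weak_gradient_unique:
  fixes G H :: "real^'n \<Rightarrow> real^'n"
  assumes "has_weak_gradient f G" "has_weak_gradient f H"
  shows "AE x in lebesgue. G x = H x"
proof -
  have "AE x in lebesgue. G x $ i - H x $ i = 0" for i :: 'n
  proof (rule fundamental_lemma)
    have *: "locally_integrable (\<lambda>x. F x $ i)" if "locally_integrable F" for F :: "real^'n \<Rightarrow> real^'n"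
      using that integrable_bounded_linear[OF bounded_linear_vec_nth[of i]]
      by (fastforce simp: locally_integrable_def set_integrable_def)
    have G: "locally_integrable (\<lambda>x. G x $ i)" and H: "locally_integrable (\<lambda>x. H x $ i)"
      using assms * by (auto simp: has_weak_gradient_def)
    then show "locally_integrable (\<lambda>x. G x $ i - H x $ i)"
      by (simp add: locally_integrable_def set_integral_diff(1))
    fix \<psi> :: "real^'n \<Rightarrow> real"
    assume psi: "test_function \<psi>"
    obtain R where R: "\<And>x. norm x > R \<Longrightarrow> \<psi> x = 0"
      using test_function_support[OF psi] by blast
    have c: "continuous_on UNIV \<psi>"
      using test_function_Ck[OF psi] Ck_imp_continuous by blast
    have "integrable lebesgue (\<lambda>x. \<psi> x *\<^sub>R (G x $ i))" "integrable lebesgue (\<lambda>x. \<psi> x *\<^sub>R (H x $ i))"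
      by (rule integrable_continuous_mult_locally_integrable[OF G c R]
          integrable_continuous_mult_locally_integrable[OF H c R]; assumption)+
    moreover have "(\<integral>x. f x * frechet_derivative \<psi> (at x) (axis i 1) \<partial>lebesgue)
        = - (\<integral>x. F x $ i * \<psi> x \<partial>lebesgue)" if "has_weak_gradient f F" for F
      using that psi unfolding has_weak_gradient_def by blast
    from this[OF assms(1)] this[OF assms(2)]
    have "(\<integral>x. G x $ i * \<psi> x \<partial>lebesgue) = (\<integral>x. H x $ i * \<psi> x \<partial>lebesgue)"
      by linarith
    ultimately show "(\<integral>x. (G x $ i - H x $ i) * \<psi> x \<partial>lebesgue) = 0"
      by (simp add: right_diff_distrib mult.commute)
  qed
  then have "AE x in lebesgue. \<forall>i. G x $ i - H x $ i = 0"
    using AE_finite_allI[OF finite[of "UNIV :: 'n set"],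
        where Q = "\<lambda>i x. G x $ i - H x $ i = 0" and M = lebesgue] by simp
  then show ?thesis
    by eventually_elim (simp add: vec_eq_iff)
qed

lemma has_weak_gradient_weak_grad: "has_weak_gradient f G \<Longrightarrow> has_weak_gradient f (weak_grad f)"
  unfolding weak_grad_def by (rule someI[of "has_weak_gradient f"])

section \<open>Translations in $L^1$ and $L^2$\<close>

lemma lborel_reflect_translate:
  fixes f :: "'a::euclidean_space \<Rightarrow> 'b::{banach, second_countable_topology}"
  assumes "integrable lborel f"
  shows "integrable lborel (\<lambda>x. f (w - x))" "(\<integral>x. f (w - x) \<partial>lborel) = (\<integral>x. f x \<partial>lborel)"
proof -
  have d: "distr lborel borel (\<lambda>x. w - x) = (lborel :: 'a measure)"
    by (subst (2) lborel_affine[of "-1" w]) (auto simp: density_1)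
  have [measurable]: "f \<in> borel_measurable borel"
    using borel_measurable_integrable[OF assms] by simp
  show "integrable lborel (\<lambda>x. f (w - x))"
    using integrable_distr_eq[of "\<lambda>x. w - x" lborel borel f] assms by (simp add: d)
  show "(\<integral>x. f (w - x) \<partial>lborel) = (\<integral>x. f x \<partial>lborel)"
    using integral_distr[of "\<lambda>x. w - x" lborel borel f] by (simp add: d)
qed

text \<open>A translation is the composition of two reflections.\<close>

lemma lborel_translate:
  fixes f :: "'a::euclidean_space \<Rightarrow> 'b::{banach, second_countable_topology}"
  assumes "integrable lborel f"
  shows "integrable lborel (\<lambda>x. f (x - w))" "(\<integral>x. f (x - w) \<partial>lborel) = (\<integral>x. f x \<partial>lborel)"
  using lborel_reflect_translate[OF lborel_reflect_translate(1)[OF assms, of 0], of w]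
    lborel_reflect_translate(2)[OF assms, of 0]
  by simp_all

text \<open>For an open set \<open>U\<close> the positive part \<open>p\<close> of \<open>indicator U x - indicator U (x - Z n)\<close> tends to
  \<open>0\<close> pointwise, and its negative part has the same integral by translation invariance; outer
  regularity reduces the general case to this one.\<close>
lemma L1_translation_indicator:
  fixes A :: "'a::euclidean_space set"
  assumes [measurable]: "A \<in> sets borel" and fin: "emeasure lborel A < \<infinity>" and Z: "Z \<longlonglongrightarrow> 0"
  shows "(\<lambda>n. \<integral>x. \<bar>indicat_real A (x - Z n) - indicat_real A x\<bar> \<partial>lborel) \<longlonglongrightarrow> 0"
proof (rule LIMSEQ_I)
  fix r :: real assume r: "r > 0"
  obtain U where U: "open U" "A \<subseteq> U" and em: "emeasure lborel (U - A) < ennreal (r / 4)"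
    using outer_regular_lborel[of A "r / 4"] r by auto
  have [measurable]: "U \<in> sets borel"
    using U(1) by auto
  have finUA: "emeasure lborel (U - A) < \<infinity>"
    using em by (rule less_trans) simp
  have finU: "emeasure lborel U < \<infinity>"
  proof -
    have "emeasure lborel U = emeasure lborel A + emeasure lborel (U - A)"
      using U(2) by (subst plus_emeasure) (auto intro!: arg_cong[where f = "emeasure lborel"])
    then show ?thesis
      using fin finUA by simp
  qed
  let ?U = "\<lambda>n x. indicat_real U (x - Z n)" and ?D = "\<lambda>n x. indicat_real (U - A) (x - Z n)"
  have iU: "integrable lborel (indicat_real U)" and iD: "integrable lborel (indicat_real (U - A))"
    using finU finUA by auto
  note iU' = lborel_translate[OF iU] and iD' = lborel_translate[OF iD]
  define p where "p = (\<lambda>n x. max 0 (indicat_real U x - ?U n x))"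
  have ip: "integrable lborel (p n)" for n
    unfolding p_def by (intro integrable_max Bochner_Integration.integrable_diff iU iU'(1)) simp
  have "(\<lambda>n. \<integral>x. p n x \<partial>lborel) \<longlonglongrightarrow> (\<integral>x. 0 \<partial>(lborel :: 'a measure))"
  proof (rule integral_dominated_convergence[OF _ _ iU])
    show "AE x in lborel. (\<lambda>n. p n x) \<longlonglongrightarrow> 0"
    proof (intro always_eventually allI)
      fix x
      show "(\<lambda>n. p n x) \<longlonglongrightarrow> 0"
      proof (cases "x \<in> U")
        case True
        have "(\<lambda>n. x - Z n) \<longlonglongrightarrow> x - 0"
          by (intro tendsto_intros Z)
        then have "eventually (\<lambda>n. x - Z n \<in> U) sequentially"
          using U(1) True topological_tendstoD by fastforce
        then have "eventually (\<lambda>n. 0 = p n x) sequentially"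
          by eventually_elim (simp add: p_def indicator_def)
        then show ?thesis
          by (rule Lim_transform_eventually[OF tendsto_const])
      next
        case False
        then show ?thesis by (simp add: p_def)
      qed
    qed
    show "AE x in lborel. norm (p n x) \<le> indicat_real U x" for n
      by (auto simp: p_def indicator_def)
  qed (use ip in auto)
  then have "eventually (\<lambda>n. \<bar>\<integral>x. p n x \<partial>lborel\<bar> < r / 4) sequentially"
    using r order_tendstoD(2)[OF tendsto_rabs, of _ 0 sequentially "r / 4"] by simp
  then obtain N where N: "\<And>n. n \<ge> N \<Longrightarrow> \<bar>\<integral>x. p n x \<partial>lborel\<bar> < r / 4"
    unfolding eventually_sequentially by blast
  have mUA: "(\<integral>x. indicat_real (U - A) x \<partial>lborel) < r / 4"
  proof -
    have "ennreal (measure lborel (U - A)) < ennreal (r / 4)"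
      using em finUA by (simp add: emeasure_eq_ennreal_measure less_top[symmetric])
    then show ?thesis
      using r by (simp add: ennreal_less_iff)
  qed
  have "norm ((\<integral>x. \<bar>indicat_real A (x - Z n) - indicat_real A x\<bar> \<partial>lborel) - 0) < r" if "n \<ge> N" for n
  proof -
    \<comment> \<open>Replacing \<open>A\<close> by \<open>U\<close> costs the indicator of
      \<open>U - A\<close> at both points. For \<open>U\<close>, put t =
      \<open>?U n x - indicat_real U x\<close>; then |t| = t + 2 max(0, -t), where max(0, -t) is
      \<open>p n x\<close> and t has integral 0. What remains is twice a sum of two terms below
      r/4.\<close>
    let ?b = "\<lambda>x. (2 * p n x + (?U n x - indicat_real U x)) + (?D n x + indicat_real (U - A) x)"
    have "(\<integral>x. \<bar>indicat_real A (x - Z n) - indicat_real A x\<bar> \<partial>lborel) \<le> (\<integral>x. ?b x \<partial>lborel)"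
    proof (rule integral_mono)
      show "integrable lborel ?b"
        by (intro Bochner_Integration.integrable_add Bochner_Integration.integrable_diff
            integrable_mult_right ip iU iU'(1) iD iD'(1))
      have "integrable lborel (indicat_real A)"
        using fin by auto
      from this lborel_translate(1)[OF this, of "Z n"]
      show "integrable lborel (\<lambda>x. \<bar>indicat_real A (x - Z n) - indicat_real A x\<bar>)"
        by auto
    qed (use U(2) in \<open>auto simp: indicator_def p_def\<close>)
    also have "\<dots> = 2 * (\<integral>x. p n x \<partial>lborel) + 2 * (\<integral>x. indicat_real (U - A) x \<partial>lborel)"
      using ip iU iU'(1)[of "Z n"] iD iD'(1)[of "Z n"] by (simp add: iU'(2) iD'(2))
    also have "\<dots> < r"
      using N[OF that] mUA by linarith
    finally show ?thesis by simp
  qed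
  then show "\<exists>N. \<forall>n\<ge>N. norm ((\<integral>x. \<bar>indicat_real A (x - Z n) - indicat_real A x\<bar> \<partial>lborel) - 0) < r"
    by blast
qed

lemma L1_translation:
  fixes f :: "'a::euclidean_space \<Rightarrow> real"
  assumes "integrable lborel f" and Z: "Z \<longlonglongrightarrow> 0"
  shows "(\<lambda>n. \<integral>x. \<bar>f (x - Z n) - f x\<bar> \<partial>lborel) \<longlonglongrightarrow> 0"
  using assms(1)
proof (induction rule: integrable_induct)
  case (base A c)
  have "(\<lambda>n. (\<integral>x. \<bar>indicat_real A (x - Z n) - indicat_real A x\<bar> \<partial>lborel) * \<bar>c\<bar>) \<longlonglongrightarrow> 0 * \<bar>c\<bar>"
    using base by (intro tendsto_mult_right L1_translation_indicator Z) auto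
  moreover have "\<bar>indicat_real A y *\<^sub>R c - indicat_real A x *\<^sub>R c\<bar>
      = \<bar>indicat_real A y - indicat_real A x\<bar> * \<bar>c\<bar>" for x y
    by (simp add: abs_mult[symmetric] left_diff_distrib)
  ultimately show ?case by simp
next
  case (add f g)
  note i = add.hyps add.hyps[THEN lborel_translate(1)]
  show ?case
  proof (rule Lim_null_comparison)
    show "(\<lambda>n. (\<integral>x. \<bar>f (x - Z n) - f x\<bar> \<partial>lborel) + (\<integral>x. \<bar>g (x - Z n) - g x\<bar> \<partial>lborel)) \<longlonglongrightarrow> 0"
      using tendsto_add[OF add.IH] by simp
    show "eventually (\<lambda>n. norm (\<integral>x. \<bar>f (x - Z n) + g (x - Z n) - (f x + g x)\<bar> \<partial>lborel)
        \<le> (\<integral>x. \<bar>f (x - Z n) - f x\<bar> \<partial>lborel) + (\<integral>x. \<bar>g (x - Z n) - g x\<bar> \<partial>lborel)) sequentially"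
    proof (intro always_eventually allI)
      fix n
      have "(\<integral>x. \<bar>f (x - Z n) + g (x - Z n) - (f x + g x)\<bar> \<partial>lborel)
          \<le> (\<integral>x. \<bar>f (x - Z n) - f x\<bar> + \<bar>g (x - Z n) - g x\<bar> \<partial>lborel)"
        by (rule integral_mono) (use i in \<open>auto intro!: integrable_abs Bochner_Integration.integrable_add
            Bochner_Integration.integrable_diff\<close>)
      also have "\<dots> = (\<integral>x. \<bar>f (x - Z n) - f x\<bar> \<partial>lborel) + (\<integral>x. \<bar>g (x - Z n) - g x\<bar> \<partial>lborel)"
        using i by (intro Bochner_Integration.integral_add) auto
      finally show "norm (\<integral>x. \<bar>f (x - Z n) + g (x - Z n) - (f x + g x)\<bar> \<partial>lborel)
        \<le> (\<integral>x. \<bar>f (x - Z n) - f x\<bar> \<partial>lborel) + (\<integral>x. \<bar>g (x - Z n) - g x\<bar> \<partial>lborel)"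
        by simp
    qed
  qed
next
  case (lim f s)
  have conv: "(\<lambda>i. \<integral>x. \<bar>s i x - f x\<bar> \<partial>lborel) \<longlonglongrightarrow> (\<integral>x. 0 \<partial>(lborel :: 'a measure))"
  proof (rule integral_dominated_convergence)
    \<comment> \<open>The approximants satisfy |s i x| \<le> 2 |f x|, which gives the factor
      3.\<close>
    show "integrable lborel (\<lambda>x. 3 * \<bar>f x\<bar>)"
      using lim.hyps(4) by auto
    show "AE x in lborel. (\<lambda>i. \<bar>s i x - f x\<bar>) \<longlonglongrightarrow> 0"
      using lim.hyps(2) by (auto intro!: tendsto_rabs_zero LIM_zero always_eventually)
    show "AE x in lborel. norm \<bar>s i x - f x\<bar> \<le> 3 * \<bar>f x\<bar>" for i
    proof (intro always_eventually allI)
      fix x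
      show "norm \<bar>s i x - f x\<bar> \<le> 3 * \<bar>f x\<bar>"
        using lim.hyps(3)[of x i] by simp
    qed
  qed (use lim.hyps(1,4) in auto)
  show ?case
  proof (rule LIMSEQ_I)
    fix r :: real assume r: "r > 0"
    obtain i where i: "(\<integral>x. \<bar>s i x - f x\<bar> \<partial>lborel) < r / 4"
      using order_tendstoD(2)[OF conv, of "r / 4"] r by (auto simp: eventually_sequentially)
    obtain N where N: "\<And>n. n \<ge> N \<Longrightarrow> (\<integral>x. \<bar>s i (x - Z n) - s i x\<bar> \<partial>lborel) < r / 4"
      using order_tendstoD(2)[OF lim.IH[of i], of "r / 4"] r by (auto simp: eventually_sequentially)
    have "norm ((\<integral>x. \<bar>f (x - Z n) - f x\<bar> \<partial>lborel) - 0) < r" if "n \<ge> N" for n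
    proof -
      have d: "integrable lborel (\<lambda>x. \<bar>s i x - f x\<bar>)"
        using lim.hyps(1,4) by auto
      note d' = lborel_translate[OF d, of "Z n"]
      note i1 = lim.hyps(1)[of i] lborel_translate(1)[OF lim.hyps(1)[of i], of "Z n"]
      note i2 = lim.hyps(4) lborel_translate(1)[OF lim.hyps(4), of "Z n"]
      \<comment> \<open>The approximant \<open>s i\<close> is inserted at both points; the two
        approximation errors have the same integral by translation invariance.\<close>
      have "(\<integral>x. \<bar>f (x - Z n) - f x\<bar> \<partial>lborel)
          \<le> (\<integral>x. (\<bar>s i (x - Z n) - f (x - Z n)\<bar> + \<bar>s i x - f x\<bar>) + \<bar>s i (x - Z n) - s i x\<bar> \<partial>lborel)"
        by (rule integral_mono) (use d d'(1) i1 i2 in auto)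
      also have "\<dots> = 2 * (\<integral>x. \<bar>s i x - f x\<bar> \<partial>lborel) + (\<integral>x. \<bar>s i (x - Z n) - s i x\<bar> \<partial>lborel)"
        using d d' i1 by simp
      also have "\<dots> < r"
        using i N[OF that] r by linarith
      finally show ?thesis by simp
    qed
    then show "\<exists>N. \<forall>n\<ge>N. norm ((\<integral>x. \<bar>f (x - Z n) - f x\<bar> \<partial>lborel) - 0) < r"
      by blast
  qed
qed

text \<open>Reduces the continuity of translations in $L^2$ to that in $L^1$.\<close>
lemma square_diff_le_signed_squares:
  fixes a b :: real
  shows "(a - b)\<^sup>2 \<le> 2 * \<bar>a * \<bar>a\<bar> - b * \<bar>b\<bar>\<bar>"
proof -
  have le_double: "t \<le> 2 * t" if "t \<ge> 0" for t :: real
    using that by simp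
  have pos: "(a - b)\<^sup>2 \<le> 2 * \<bar>a * a - b * b\<bar>" if "a \<ge> 0" "b \<ge> 0" for a b :: real
  proof -
    have "(a - b)\<^sup>2 = \<bar>a - b\<bar> * \<bar>a - b\<bar>"
      by (simp add: power2_eq_square)
    also have "\<dots> \<le> \<bar>a - b\<bar> * (a + b)"
      using that by (intro mult_left_mono) auto
    also have "\<dots> = \<bar>a * a - b * b\<bar>"
    proof -
      have "a * a - b * b = (a - b) * (a + b)"
        by (simp add: algebra_simps)
      then show ?thesis
        using that by (simp add: abs_mult)
    qed
    finally show ?thesis
      using le_double[OF abs_ge_zero] by (rule order_trans)
  qed
  have mixed: "(a - b)\<^sup>2 \<le> 2 * (a * a + b * b)" for a b :: real
  proof -
    have "2 * (a * a + b * b) - (a - b)\<^sup>2 = (a + b)\<^sup>2"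
      by (simp add: power2_eq_square algebra_simps)
    then show ?thesis
      using zero_le_power2[of "a + b"] by linarith
  qed
  consider "a \<ge> 0" "b \<ge> 0" | "a < 0" "b < 0" | "a \<ge> 0" "b < 0" | "a < 0" "b \<ge> 0"
    by linarith
  then show ?thesis
  proof cases
    case 2
    have "(- a - - b)\<^sup>2 = (a - b)\<^sup>2" "\<bar>- a * - a - - b * - b\<bar> = \<bar>a * \<bar>a\<bar> - b * \<bar>b\<bar>\<bar>"
      using 2 by (simp_all add: power2_eq_square algebra_simps)
    then show ?thesis using pos[of "-a" "-b"] 2 by simp
  next
    case 1
    then show ?thesis using pos[of a b] by simp
  next
    case 3
    then have "\<bar>a * \<bar>a\<bar> - b * \<bar>b\<bar>\<bar> = a * a + b * b" by simp
    then show ?thesis using mixed[of a b] by simp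
  next
    case 4
    then have "\<bar>a * \<bar>a\<bar> - b * \<bar>b\<bar>\<bar> = a * a + b * b" by simp
    then show ?thesis using mixed[of a b] by simp
  qed
qed

text \<open>The square of a difference is bounded by the difference of signed squares, so continuity
  of translations in L^1, applied to the signed square of \<open>g\<close>, gives continuity in L^2.
  Pairing with \<open>f\<close> then preserves the limit by Young's inequality.\<close>

lemma L2_translation:
  fixes f g :: "'a::euclidean_space \<Rightarrow> real"
  assumes [measurable]: "f \<in> borel_measurable borel" "g \<in> borel_measurable borel"
    and f2: "integrable lborel (\<lambda>x. (f x)\<^sup>2)" and g2: "integrable lborel (\<lambda>x. (g x)\<^sup>2)"
    and Z: "Z \<longlonglongrightarrow> 0"
  shows "integrable lborel (\<lambda>x. f x * g (x - z))"
    and "(\<lambda>n. \<integral>x. f x * g (x - Z n) \<partial>lborel) \<longlonglongrightarrow> (\<integral>x. f x * g x \<partial>lborel)"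
proof -
  have prod: "integrable lborel (\<lambda>x. u x * v x)"
    if [measurable]: "u \<in> borel_measurable borel" "v \<in> borel_measurable borel"
      and i: "integrable lborel (\<lambda>x. (u x)\<^sup>2)" "integrable lborel (\<lambda>x. (v x)\<^sup>2)" for u v :: "'a \<Rightarrow> real"
  proof (rule Bochner_Integration.integrable_bound)
    show "integrable lborel (\<lambda>x. (u x)\<^sup>2 + (v x)\<^sup>2)"
      using i by auto
    have "\<bar>u x * v x\<bar> \<le> (u x)\<^sup>2 + (v x)\<^sup>2" for x
    proof -
      have "0 \<le> \<bar>u x\<bar> * \<bar>v x\<bar>"
        by simp
      moreover have "2 * (\<bar>u x\<bar> * \<bar>v x\<bar>) \<le> (u x)\<^sup>2 + (v x)\<^sup>2"
        using sum_squares_bound[of "\<bar>u x\<bar>" "\<bar>v x\<bar>"] by simp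
      ultimately show ?thesis
        by (simp add: abs_mult del: mult_nonneg_nonneg)
    qed
    then show "AE x in lborel. norm (u x * v x) \<le> norm ((u x)\<^sup>2 + (v x)\<^sup>2)"
      by simp
  qed auto
  have fg: "integrable lborel (\<lambda>x. f x * g (x - z))" for z
    by (rule prod) (use f2 lborel_translate(1)[OF g2] in auto)
  then show "integrable lborel (\<lambda>x. f x * g (x - z))" .
  \<comment> \<open>The sign is essential: the plain squares of \<open>g (x - z)\<close> and
    \<open>g x\<close> may agree while the values are opposite.\<close>
  define s where "s = (\<lambda>t::real. t * \<bar>t\<bar>)"
  have [measurable]: "s \<in> borel_measurable borel"
    unfolding s_def by measurable
  have sg: "integrable lborel (\<lambda>x. s (g x))"
    by (rule Bochner_Integration.integrable_bound[OF g2]) (auto simp: s_def power2_eq_square abs_mult)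
  have D2: "integrable lborel (\<lambda>x. (g (x - z) - g x)\<^sup>2)"
    and D2le: "(\<integral>x. (g (x - z) - g x)\<^sup>2 \<partial>lborel) \<le> 2 * (\<integral>x. \<bar>s (g (x - z)) - s (g x)\<bar> \<partial>lborel)" for z
  proof -
    have i: "integrable lborel (\<lambda>x. 2 * \<bar>s (g (x - z)) - s (g x)\<bar>)"
      using sg lborel_translate(1)[OF sg, of z] by auto
    show D2: "integrable lborel (\<lambda>x. (g (x - z) - g x)\<^sup>2)"
      by (rule Bochner_Integration.integrable_bound[OF i])
         (auto simp: s_def square_diff_le_signed_squares)
    have "(\<integral>x. (g (x - z) - g x)\<^sup>2 \<partial>lborel) \<le> (\<integral>x. 2 * \<bar>s (g (x - z)) - s (g x)\<bar> \<partial>lborel)"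
      by (rule integral_mono[OF D2 i]) (simp add: s_def square_diff_le_signed_squares)
    then show "(\<integral>x. (g (x - z) - g x)\<^sup>2 \<partial>lborel) \<le> 2 * (\<integral>x. \<bar>s (g (x - z)) - s (g x)\<bar> \<partial>lborel)"
      by simp
  qed
  have "(\<lambda>n. 2 * (\<integral>x. \<bar>s (g (x - Z n)) - s (g x)\<bar> \<partial>lborel)) \<longlonglongrightarrow> 2 * 0"
    by (intro tendsto_mult_left L1_translation[OF sg Z])
  then have lim: "(\<lambda>n. 2 * (\<integral>x. \<bar>s (g (x - Z n)) - s (g x)\<bar> \<partial>lborel)) \<longlonglongrightarrow> 0"
    by simp
  have D0: "(\<lambda>n. \<integral>x. (g (x - Z n) - g x)\<^sup>2 \<partial>lborel) \<longlonglongrightarrow> 0"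
    by (rule tendsto_sandwich[OF _ _ tendsto_const lim])
       (intro always_eventually allI D2le integral_nonneg_AE zero_le_power2)+
  show "(\<lambda>n. \<integral>x. f x * g (x - Z n) \<partial>lborel) \<longlonglongrightarrow> (\<integral>x. f x * g x \<partial>lborel)"
  proof (rule LIMSEQ_I)
    fix r :: real assume r: "r > 0"
    define I where "I = (\<integral>x. (f x)\<^sup>2 \<partial>lborel)"
    have I: "I \<ge> 0" by (simp add: I_def)
    \<comment> \<open>The weight in Young's inequality makes the term with the square of
      \<open>f\<close> at most r/2; the other term is below r/2 for large n. The summand 1 covers
      \<open>I = 0\<close>.\<close>
    define \<eta> where "\<eta> = r / (I + 1)"
    have \<eta>: "\<eta> > 0" "\<eta> * I \<le> r"
      using r I by (auto simp: \<eta>_def field_simps)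
    obtain N where N: "\<And>n. n \<ge> N \<Longrightarrow> (\<integral>x. (g (x - Z n) - g x)\<^sup>2 \<partial>lborel) < r * \<eta>"
      using order_tendstoD(2)[OF D0, of "r * \<eta>"] r \<eta>(1) by (auto simp: eventually_sequentially)
    have young: "\<bar>a * b\<bar> \<le> \<eta> / 2 * a\<^sup>2 + 1 / (2 * \<eta>) * b\<^sup>2" for a b
    proof -
      have "0 \<le> (\<eta> * \<bar>a\<bar> - \<bar>b\<bar>)\<^sup>2 / (2 * \<eta>)"
        using \<eta>(1) by simp
      then show ?thesis
        using \<eta>(1) by (simp add: power2_diff abs_mult field_simps power2_eq_square[of \<eta>])
    qed
    have "norm ((\<integral>x. f x * g (x - Z n) \<partial>lborel) - (\<integral>x. f x * g x \<partial>lborel)) < r" if "n \<ge> N" for n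
    proof -
      let ?D = "\<lambda>x. g (x - Z n) - g x"
      have fD: "integrable lborel (\<lambda>x. f x * ?D x)"
        using fg[of "Z n"] fg[of 0] by (simp add: right_diff_distrib)
      have "(\<integral>x. f x * g (x - Z n) \<partial>lborel) - (\<integral>x. f x * g x \<partial>lborel) = (\<integral>x. f x * ?D x \<partial>lborel)"
        using fg[of "Z n"] fg[of 0] by (simp add: right_diff_distrib)
      also have "norm \<dots> \<le> (\<integral>x. \<bar>f x * ?D x\<bar> \<partial>lborel)"
        using integral_abs_bound by auto
      also have "\<dots> \<le> (\<integral>x. \<eta> / 2 * (f x)\<^sup>2 + 1 / (2 * \<eta>) * (?D x)\<^sup>2 \<partial>lborel)"
      proof (rule integral_mono)
        show "\<bar>f x * ?D x\<bar> \<le> \<eta> / 2 * (f x)\<^sup>2 + 1 / (2 * \<eta>) * (?D x)\<^sup>2" for x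
          by (rule young)
      qed (use f2 D2 fD in auto)
      also have "\<dots> = \<eta> / 2 * I + 1 / (2 * \<eta>) * (\<integral>x. (?D x)\<^sup>2 \<partial>lborel)"
        using f2 D2[of "Z n"] by (simp add: I_def)
      also have "\<dots> < r / 2 + 1 / (2 * \<eta>) * (r * \<eta>)"
        using N[OF that] \<eta> by (intro add_le_less_mono mult_strict_left_mono) auto
      also have "\<dots> = r"
        using \<eta>(1) by (simp add: field_simps)
      finally show ?thesis .
    qed
    then show "\<exists>N. \<forall>n\<ge>N. norm ((\<integral>x. f x * g (x - Z n) \<partial>lborel) - (\<integral>x. f x * g x \<partial>lborel)) < r"
      by blast
  qed
qed


section \<open>Correlations and convolutions\<close>

lemma convolution_Fubini:
  fixes A B k :: "'a::euclidean_space \<Rightarrow> real"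
  assumes A: "integrable lborel A" and B: "integrable lborel B"
    and k: "k \<in> borel_measurable borel" "\<And>x. \<bar>k x\<bar> \<le> M"
  shows "integrable (lborel \<Otimes>\<^sub>M lborel) (\<lambda>(x, y). A x * (k (x - y) * B y))"
    and "integrable (lborel \<Otimes>\<^sub>M lborel) (\<lambda>(x, z). A x * (k z * B (x - z)))"
proof -
  have [measurable]: "A \<in> borel_measurable borel" "B \<in> borel_measurable borel" "k \<in> borel_measurable borel"
    using A B k by auto
  have M: "M \<ge> 0"
    using k(2)[of 0] by linarith
  have AB: "integrable (lborel \<Otimes>\<^sub>M lborel) (\<lambda>(x, y). A x * B y)"
  proof (rule lborel_pair.Fubini_integrable)
    show "integrable lborel (\<lambda>x. \<integral>y. norm (case (x, y) of (x, y) \<Rightarrow> A x * B y) \<partial>lborel)"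
      using A B by (simp add: abs_mult)
  qed (use A B in auto)
  show "integrable (lborel \<Otimes>\<^sub>M lborel) (\<lambda>(x, y). A x * (k (x - y) * B y))"
  proof (rule Bochner_Integration.integrable_bound[OF integrable_mult_right[OF AB, of M]])
    show "AE p in lborel \<Otimes>\<^sub>M lborel. norm (case p of (x, y) \<Rightarrow> A x * (k (x - y) * B y))
        \<le> norm (M * (case p of (x, y) \<Rightarrow> A x * B y))"
    proof (intro always_eventually allI)
      fix p :: "'a \<times> 'a"
      have "\<bar>k (fst p - snd p)\<bar> * (\<bar>A (fst p)\<bar> * \<bar>B (snd p)\<bar>) \<le> M * (\<bar>A (fst p)\<bar> * \<bar>B (snd p)\<bar>)"
        by (intro mult_right_mono k) auto
      then show "norm (case p of (x, y) \<Rightarrow> A x * (k (x - y) * B y))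
          \<le> norm (M * (case p of (x, y) \<Rightarrow> A x * B y))"
        using M by (simp add: split_beta abs_mult mult_ac)
    qed
  qed auto
  have int_z: "integrable lborel (\<lambda>z. \<bar>A x\<bar> * (M * \<bar>B (x - z)\<bar>))" for x
    using lborel_reflect_translate(1)[OF B, of x] by auto
  have le: "\<bar>A x * (k z * B (x - z))\<bar> \<le> \<bar>A x\<bar> * (M * \<bar>B (x - z)\<bar>)" for x z
    using k(2) by (auto simp: abs_mult intro!: mult_left_mono mult_right_mono)
  have int_z': "integrable lborel (\<lambda>z. A x * (k z * B (x - z)))" for x
    by (rule Bochner_Integration.integrable_bound[OF int_z[of x]]) (use le M in \<open>auto simp: abs_mult\<close>)
  show "integrable (lborel \<Otimes>\<^sub>M lborel) (\<lambda>(x, z). A x * (k z * B (x - z)))"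
  proof (rule lborel_pair.Fubini_integrable)
    show "integrable lborel (\<lambda>x. \<integral>z. norm (case (x, z) of (x, z) \<Rightarrow> A x * (k z * B (x - z))) \<partial>lborel)"
    proof (rule Bochner_Integration.integrable_bound)
      show "integrable lborel (\<lambda>x. \<bar>A x\<bar> * (M * (\<integral>y. \<bar>B y\<bar> \<partial>lborel)))"
        using A by auto
      have "(\<integral>z. \<bar>A x * (k z * B (x - z))\<bar> \<partial>lborel) \<le> \<bar>A x\<bar> * (M * (\<integral>y. \<bar>B y\<bar> \<partial>lborel))" for x
      proof -
        have "(\<integral>z. \<bar>A x * (k z * B (x - z))\<bar> \<partial>lborel) \<le> (\<integral>z. \<bar>A x\<bar> * (M * \<bar>B (x - z)\<bar>) \<partial>lborel)"
          by (rule integral_mono) (use int_z int_z' le in auto)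
        also have "\<dots> = \<bar>A x\<bar> * (M * (\<integral>y. \<bar>B y\<bar> \<partial>lborel))"
          using lborel_reflect_translate(2)[OF integrable_abs[OF B], of x] by simp
        finally show ?thesis .
      qed
      then show "AE x in lborel. norm (\<integral>z. norm (case (x, z) of (x, z) \<Rightarrow> A x * (k z * B (x - z))) \<partial>lborel)
          \<le> norm (\<bar>A x\<bar> * (M * (\<integral>y. \<bar>B y\<bar> \<partial>lborel)))"
        using M by (intro always_eventually allI) (simp add: abs_of_nonneg)
    qed measurable
  qed (use int_z' in auto)
qed

text \<open>All expressions are the double integral of A(x) k(x - y) B(y), taken in different orders
  and with z = x - y. A kernel tested against the correlation of \<open>A\<close> and
  \<open>B\<close> can thus be read as a convolution with either of them, and a derivative can be
  passed to the kernel.\<close>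

lemma correlation_eq_convolution:
  fixes A B k :: "'a::euclidean_space \<Rightarrow> real"
  assumes A: "integrable lborel A" and B: "integrable lborel B"
    and k: "k \<in> borel_measurable borel" "\<And>x. \<bar>k x\<bar> \<le> M"
  shows "integrable lborel (\<lambda>z. k z * (\<integral>x. A x * B (x - z) \<partial>lborel))"
    and "(\<integral>z. k z * (\<integral>x. A x * B (x - z) \<partial>lborel) \<partial>lborel)
      = (\<integral>y. B y * (\<integral>x. A x * k (x - y) \<partial>lborel) \<partial>lborel)"
    and "(\<integral>z. k z * (\<integral>x. A x * B (x - z) \<partial>lborel) \<partial>lborel)
      = (\<integral>x. A x * (\<integral>y. k (x - y) * B y \<partial>lborel) \<partial>lborel)"
    and "integrable lborel (\<lambda>y. B y * (\<integral>x. A x * k (x - y) \<partial>lborel))"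
proof -
  note F = convolution_Fubini[OF assms]
  have e1: "k z * (\<integral>x. A x * B (x - z) \<partial>lborel) = (\<integral>x. A x * (k z * B (x - z)) \<partial>lborel)" for z
    by (simp add: integral_mult_right_zero[symmetric] mult.left_commute del: integral_mult_right_zero)
  have e2: "B y * (\<integral>x. A x * k (x - y) \<partial>lborel) = (\<integral>x. A x * (k (x - y) * B y) \<partial>lborel)" for y
    by (simp add: integral_mult_right_zero[symmetric] mult_ac del: integral_mult_right_zero)
  show "integrable lborel (\<lambda>z. k z * (\<integral>x. A x * B (x - z) \<partial>lborel))"
    unfolding e1 by (rule lborel_pair.integrable_snd[OF F(2)])
  show "integrable lborel (\<lambda>y. B y * (\<integral>x. A x * k (x - y) \<partial>lborel))"
    unfolding e2 by (rule lborel_pair.integrable_snd[OF F(1)])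
  have e3: "(\<integral>z. A x * (k z * B (x - z)) \<partial>lborel) = A x * (\<integral>y. k (x - y) * B y \<partial>lborel)" for x
  proof -
    have "integrable lborel (\<lambda>z. k z * B (x - z))"
    proof (rule Bochner_Integration.integrable_bound)
      show "integrable lborel (\<lambda>z. M * B (x - z))"
        using lborel_reflect_translate(1)[OF B, of x] by auto
      show "AE z in lborel. norm (k z * B (x - z)) \<le> norm (M * B (x - z))"
        using k(2) by (intro always_eventually allI)
          (auto simp: abs_mult intro!: mult_right_mono order_trans[OF k(2)])
      show "(\<lambda>z. k z * B (x - z)) \<in> borel_measurable lborel"
        using k(1) borel_measurable_integrable[OF B] by simp
    qed
    from lborel_reflect_translate(2)[OF this, of x] show ?thesis by simp
  qed
  have "(\<integral>z. k z * (\<integral>x. A x * B (x - z) \<partial>lborel) \<partial>lborel)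
      = (\<integral>x. (\<integral>z. A x * (k z * B (x - z)) \<partial>lborel) \<partial>lborel)"
    unfolding e1 by (rule lborel_pair.Fubini_integral[OF F(2)])
  also have "\<dots> = (\<integral>x. A x * (\<integral>y. k (x - y) * B y \<partial>lborel) \<partial>lborel)"
    unfolding e3 ..
  finally show eq: "(\<integral>z. k z * (\<integral>x. A x * B (x - z) \<partial>lborel) \<partial>lborel)
      = (\<integral>x. A x * (\<integral>y. k (x - y) * B y \<partial>lborel) \<partial>lborel)" .
  also have "\<dots> = (\<integral>x. (\<integral>y. A x * (k (x - y) * B y) \<partial>lborel) \<partial>lborel)"
    by simp
  also have "\<dots> = (\<integral>y. B y * (\<integral>x. A x * k (x - y) \<partial>lborel) \<partial>lborel)"
    unfolding e2 by (rule lborel_pair.Fubini_integral[OF F(1), symmetric])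
  finally show "(\<integral>z. k z * (\<integral>x. A x * B (x - z) \<partial>lborel) \<partial>lborel)
      = (\<integral>y. B y * (\<integral>x. A x * k (x - y) \<partial>lborel) \<partial>lborel)" .
qed

section \<open>The weak gradient of a square\<close>

text \<open>The function \<open>T z = \<integral> f(x) f(x - z) \<partial>\<psi>(x) + (g(x) f(x - z) + f(x) g(x - z)) \<psi>(x) dx\<close>
  vanishes at \<open>0\<close> because it is continuous and integrates to \<open>0\<close> against every test function \<open>\<rho>\<close>
  supported near \<open>0\<close>: by Fubini, \<open>\<integral> \<rho> T\<close> is the pairing of the weak derivative of \<open>f \<otimes> f\<close> along the
  diagonal with the test function \<open>\<psi>(x) \<rho>(x - y)\<close>.\<close>
lemma weak_derivative_square_L2:
  fixes f g \<psi> :: "'a::euclidean_space \<Rightarrow> real" and v :: 'a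
  assumes f: "integrable lborel f" "integrable lborel (\<lambda>x. (f x)\<^sup>2)"
    and g: "integrable lborel g" "integrable lborel (\<lambda>x. (g x)\<^sup>2)"
    and weak: "\<And>\<eta>. test_function \<eta> \<Longrightarrow> (\<And>x. norm x > R + 2 \<Longrightarrow> \<eta> x = 0) \<Longrightarrow>
      (\<integral>x. f x * frechet_derivative \<eta> (at x) v \<partial>lborel) = - (\<integral>x. g x * \<eta> x \<partial>lborel)"
    and psi: "test_function \<psi>" "\<And>x. norm x > R \<Longrightarrow> \<psi> x = 0"
  shows "(\<integral>x. (f x)\<^sup>2 * frechet_derivative \<psi> (at x) v \<partial>lborel)
    = - (\<integral>x. 2 * f x * g x * \<psi> x \<partial>lborel)"
proof -
  define \<psi>' where "\<psi>' = (\<lambda>x. frechet_derivative \<psi> (at x) v)"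
  have [measurable]: "f \<in> borel_measurable borel" "g \<in> borel_measurable borel"
    using f g by auto
  have CkD: "Ck (Suc 0) h \<Longrightarrow> continuous_on UNIV (\<lambda>x. frechet_derivative h (at x) v)" for h :: "'a \<Rightarrow> real"
    by simp
  have cont: "continuous_on UNIV \<psi>" "continuous_on UNIV \<psi>'"
    using test_function_Ck[OF psi(1)] Ck_imp_continuous CkD unfolding \<psi>'_def by blast+
  have mpsi[measurable]: "\<psi> \<in> borel_measurable borel" "\<psi>' \<in> borel_measurable borel"
    using cont by (auto intro: borel_measurable_continuous_onI)
  obtain M1 where M1: "M1 \<ge> 0" "\<And>x. norm (\<psi> x) \<le> M1 * indicator (cball 0 R) x"
    by (rule bounded_of_support[OF cont(1), of R]) (use psi(2) in blast, rule that)
  have psi'0: "\<psi>' x = 0" if "norm x > R" for x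
    unfolding \<psi>'_def by (rule frechet_derivative_eq_0_outside[OF psi(2) that])
  obtain M2 where M2: "M2 \<ge> 0" "\<And>x. norm (\<psi>' x) \<le> M2 * indicator (cball 0 R) x"
    by (rule bounded_of_support[OF cont(2), of R]) (use psi'0 in blast, rule that)
  have b1: "\<bar>\<psi> x\<bar> \<le> M1" and b2: "\<bar>\<psi>' x\<bar> \<le> M2" for x
    using M1(1) M1(2)[of x] M2(1) M2(2)[of x] by (cases "x \<in> cball 0 R"; simp)+
  have bmul: "integrable lborel (\<lambda>x. h x * u x)"
    if "integrable lborel h" "u \<in> borel_measurable borel" "\<And>x. \<bar>u x\<bar> \<le> M" for h u :: "'a \<Rightarrow> real" and M
  proof (rule Bochner_Integration.integrable_bound[OF integrable_mult_right[OF that(1), of M]])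
    have "M \<ge> 0"
      using that(3)[of 0] by linarith
    moreover have "\<bar>u x\<bar> * \<bar>h x\<bar> \<le> M * \<bar>h x\<bar>" for x
      by (intro mult_right_mono that(3)) auto
    ultimately show "AE x in lborel. norm (h x * u x) \<le> norm (M * h x)"
      by (intro always_eventually allI) (simp add: abs_mult mult.commute)
  qed (use that in auto)
  have bmul2: "integrable lborel (\<lambda>x. (h x * u x)\<^sup>2)"
    if "integrable lborel (\<lambda>x. (h x)\<^sup>2)" "u \<in> borel_measurable borel" "\<And>x. \<bar>u x\<bar> \<le> M"
    for h u :: "'a \<Rightarrow> real" and M
  proof -
    have "\<bar>(u x)\<^sup>2\<bar> \<le> M\<^sup>2" for x
      using that(3)[of x] by (simp add: abs_le_square_iff[symmetric])
    then show ?thesis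
      using bmul[OF that(1), of "\<lambda>x. (u x)\<^sup>2" "M\<^sup>2"] that(2) by (simp add: power_mult_distrib)
  qed
  note i1 = bmul[OF f(1) mpsi(2) b2] bmul2[OF f(2) mpsi(2) b2]
    and i2 = bmul[OF g(1) mpsi(1) b1] bmul2[OF g(2) mpsi(1) b1]
    and i3 = bmul[OF f(1) mpsi(1) b1] bmul2[OF f(2) mpsi(1) b1]
  define T1 where "T1 = (\<lambda>z. \<integral>x. f x * \<psi>' x * f (x - z) \<partial>lborel)"
  define T2 where "T2 = (\<lambda>z. \<integral>x. g x * \<psi> x * f (x - z) \<partial>lborel)"
  define T3 where "T3 = (\<lambda>z. \<integral>x. f x * \<psi> x * g (x - z) \<partial>lborel)"
  define T where "T = (\<lambda>z. T1 z + T2 z + T3 z)"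
  \<comment> \<open>Each term correlates two L^2 functions, since multiplication by the bounded
    \<psi> or \<psi>' preserves L^2.\<close>
  have T_cont: "(\<lambda>n. T (Z n)) \<longlonglongrightarrow> T 0" if "Z \<longlonglongrightarrow> 0" for Z
    unfolding T_def T1_def T2_def T3_def diff_zero
    by (intro tendsto_add L2_translation(2) i1 i2 i3 f g that borel_measurable_times) measurable
  have key: "integrable lborel (\<lambda>z. \<rho> z * T z) \<and> (\<integral>z. \<rho> z * T z \<partial>lborel) = 0"
    if rho: "test_function \<rho>" "\<And>x. norm x > 1 \<Longrightarrow> \<rho> x = 0" for \<rho>
  proof -
    define \<rho>' where "\<rho>' = (\<lambda>x. frechet_derivative \<rho> (at x) v)"
    have rCk: "Ck k \<rho>" for k
      using rho(1) by (rule test_function_Ck)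
    have cr: "continuous_on UNIV \<rho>" "continuous_on UNIV \<rho>'"
      using rCk Ck_imp_continuous CkD unfolding \<rho>'_def by blast+
    have mrho[measurable]: "\<rho> \<in> borel_measurable borel" "\<rho>' \<in> borel_measurable borel"
      using cr by (auto intro: borel_measurable_continuous_onI)
    obtain N1 where N1: "N1 \<ge> 0" "\<And>x. norm (\<rho> x) \<le> N1 * indicator (cball 0 1) x"
      by (rule bounded_of_support[OF cr(1), of 1]) (use rho(2) in blast, rule that)
    have rho'0: "\<rho>' x = 0" if "norm x > 1" for x
      unfolding \<rho>'_def by (rule frechet_derivative_eq_0_outside[OF rho(2) that])
    obtain N2 where N2: "N2 \<ge> 0" "\<And>x. norm (\<rho>' x) \<le> N2 * indicator (cball 0 1) x"
      by (rule bounded_of_support[OF cr(2), of 1]) (use rho'0 in blast, rule that)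
    have n1: "\<bar>\<rho> x\<bar> \<le> N1" and n2: "\<bar>\<rho>' x\<bar> \<le> N2" for x
      using N1(1) N1(2)[of x] N2(1) N2(2)[of x] by (cases "x \<in> cball 0 1"; simp)+
    have Drho: "((\<lambda>x. \<rho> (s *\<^sub>R x + w)) has_derivative
        (\<lambda>u. frechet_derivative \<rho> (at (s *\<^sub>R x + w)) (s *\<^sub>R u))) (at x)" for s w x
      by (rule has_derivative_compose[OF _ Ck_Suc_has_derivative[OF rCk]])
         (auto intro!: derivative_eq_intros)
    have lin: "linear (frechet_derivative \<rho> (at x))" for x
      using Ck_Suc_has_derivative[OF rCk] has_derivative_linear by blast
    \<comment> \<open>For |x| \<le> R the function y \<mapsto> \<rho>(x - y) is supported in the
      ball of radius R + 1, so \<open>weak\<close> applies. The sign from the reflection cancels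
      that from integration by parts.\<close>
    have conv: "(\<integral>y. \<rho> (x - y) * g y \<partial>lborel) = (\<integral>y. \<rho>' (x - y) * f y \<partial>lborel)" if x: "norm x \<le> R" for x
    proof -
      have zero: "\<rho> ((-1) *\<^sub>R y + x) = 0" if "norm y > R + 2" for y
      proof (rule rho(2))
        show "norm ((-1) *\<^sub>R y + x) > 1"
          using that x norm_triangle_ineq2[of y x] by (simp add: norm_minus_commute)
      qed
      have "test_function (\<lambda>y. \<rho> ((-1) *\<^sub>R y + x))"
        by (rule test_functionI[OF Ck_affine[OF rCk] zero])
      from weak[OF this zero]
      have "(\<integral>y. f y * frechet_derivative \<rho> (at ((-1) *\<^sub>R y + x)) ((-1) *\<^sub>R v) \<partial>lborel)
          = - (\<integral>y. g y * \<rho> ((-1) *\<^sub>R y + x) \<partial>lborel)"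
        by (simp only: frechet_derivative_at[OF Drho, symmetric])
      moreover have "frechet_derivative \<rho> (at ((-1) *\<^sub>R y + x)) ((-1) *\<^sub>R v) = - \<rho>' (x - y)" for y
        by (subst linear_cmul[OF lin]) (simp add: \<rho>'_def)
      ultimately show ?thesis
        by (simp add: mult.commute)
    qed
    \<comment> \<open>This is the weak formulation for x \<mapsto> \<psi>(x) \<rho>(x - y) with
      \<open>y\<close> fixed.\<close>
    have inner: "(\<integral>x. f x * \<psi>' x * \<rho> (x - y) \<partial>lborel) + (\<integral>x. g x * \<psi> x * \<rho> (x - y) \<partial>lborel)
        + (\<integral>x. f x * \<psi> x * \<rho>' (x - y) \<partial>lborel) = 0" for y
    proof -
      have zero: "\<psi> x * \<rho> (1 *\<^sub>R x + (- y)) = 0" if "norm x > R + 2" for x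
        using psi(2) that by simp
      have "test_function (\<lambda>x. \<psi> x * \<rho> (1 *\<^sub>R x + (- y)))"
        by (rule test_functionI[OF Ck_mult[OF test_function_Ck[OF psi(1)] Ck_affine[OF rCk]] zero])
      have D: "frechet_derivative (\<lambda>x. \<psi> x * \<rho> (1 *\<^sub>R x + (- y))) (at x) v
          = \<psi> x * \<rho>' (x - y) + \<psi>' x * \<rho> (x - y)" for x
        using fun_cong[OF frechet_derivative_at[OF has_derivative_mult[OF
              Ck_Suc_has_derivative[OF test_function_Ck[OF psi(1)]] Drho]], of x 1 "-y" v]
        by (simp add: \<rho>'_def \<psi>'_def)
      from weak[OF \<open>test_function (\<lambda>x. \<psi> x * \<rho> (1 *\<^sub>R x + (- y)))\<close> zero]
      have "(\<integral>x. f x * (\<psi> x * \<rho>' (x - y) + \<psi>' x * \<rho> (x - y)) \<partial>lborel)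
          = - (\<integral>x. g x * (\<psi> x * \<rho> (x - y)) \<partial>lborel)"
        unfolding D by simp
      moreover have "integrable lborel (\<lambda>x. f x * \<psi>' x * \<rho> (x - y))"
        by (rule bmul[OF i1(1) _ n1]) measurable
      moreover have "integrable lborel (\<lambda>x. f x * \<psi> x * \<rho>' (x - y))"
        by (rule bmul[OF i3(1) _ n2]) measurable
      ultimately show ?thesis
        by (simp add: distrib_left mult.assoc)
    qed
    note c1 = correlation_eq_convolution[OF i1(1) f(1) mrho(1) n1]
      and c2 = correlation_eq_convolution[OF i2(1) f(1) mrho(1) n1]
      and c3 = correlation_eq_convolution[OF i3(1) g(1) mrho(1) n1]
      and c4 = correlation_eq_convolution[OF i3(1) f(1) mrho(2) n2]
    \<comment> \<open>The factor \<open>\<psi> x\<close> confines the outer integral to |x| \<le> R,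
      where \<open>conv\<close> trades \<open>g\<close> for \<open>f\<close> with the derivative on
      \<rho>. All three parts of \<integral> \<rho> T then become integrals over y of
      \<open>f y\<close> times the three summands of \<open>inner\<close>.\<close>
    have "(\<integral>x. f x * \<psi> x * (\<integral>y. \<rho> (x - y) * g y \<partial>lborel) \<partial>lborel)
        = (\<integral>x. f x * \<psi> x * (\<integral>y. \<rho>' (x - y) * f y \<partial>lborel) \<partial>lborel)"
    proof (rule Bochner_Integration.integral_cong)
      show "f x * \<psi> x * (\<integral>y. \<rho> (x - y) * g y \<partial>lborel) = f x * \<psi> x * (\<integral>y. \<rho>' (x - y) * f y \<partial>lborel)" for x
        using conv[of x] psi(2)[of x] by (cases "norm x \<le> R") auto
    qed simp
    then have T3: "(\<integral>z. \<rho> z * T3 z \<partial>lborel) = (\<integral>y. f y * (\<integral>x. f x * \<psi> x * \<rho>' (x - y) \<partial>lborel) \<partial>lborel)"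
      unfolding T3_def using c3(3) c4(2,3) by simp
    have int: "integrable lborel (\<lambda>z. \<rho> z * T1 z)" "integrable lborel (\<lambda>z. \<rho> z * T2 z)"
      "integrable lborel (\<lambda>z. \<rho> z * T3 z)"
      unfolding T1_def T2_def T3_def using c1(1) c2(1) c3(1) by simp_all
    have "(\<integral>z. \<rho> z * T z \<partial>lborel)
        = (\<integral>z. \<rho> z * T1 z \<partial>lborel) + (\<integral>z. \<rho> z * T2 z \<partial>lborel) + (\<integral>z. \<rho> z * T3 z \<partial>lborel)"
      using int by (simp add: T_def distrib_left)
    also have "\<dots> = (\<integral>y. f y * (\<integral>x. f x * \<psi>' x * \<rho> (x - y) \<partial>lborel)
        + f y * (\<integral>x. g x * \<psi> x * \<rho> (x - y) \<partial>lborel)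
        + f y * (\<integral>x. f x * \<psi> x * \<rho>' (x - y) \<partial>lborel) \<partial>lborel)"
      unfolding T3 unfolding T1_def T2_def c1(2) c2(2) using c1(4) c2(4) c4(4) by simp
    also have "\<dots> = (\<integral>y. f y * 0 \<partial>lborel)"
      unfolding distrib_left[symmetric] inner ..
    finally show ?thesis
      using int by (simp add: T_def distrib_left)
  qed
  have "T 0 = 0"
  proof (rule ccontr)
    assume "T 0 \<noteq> 0"
    have "isCont T 0"
      using T_cont by (intro continuous_at_sequentiallyI) auto
    then have "((\<lambda>z. T z * T 0) \<longlongrightarrow> T 0 * T 0) (at 0)"
      by (intro tendsto_intros) (simp add: isCont_def)
    moreover have pos0: "T 0 * T 0 > 0"
      using \<open>T 0 \<noteq> 0\<close> by (auto simp: zero_less_mult_iff)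
    ultimately have "eventually (\<lambda>z. T z * T 0 > 0) (at 0)"
      by (rule order_tendstoD(1))
    then obtain d where d: "d > 0" "\<And>z. z \<noteq> 0 \<Longrightarrow> norm z < d \<Longrightarrow> T z * T 0 > 0"
      by (auto simp: eventually_at)
    define e where "e = min d 1"
    have e: "e > 0" "e \<le> 1" "\<And>z. norm z < e \<Longrightarrow> T z * T 0 > 0"
    proof -
      show "T z * T 0 > 0" if "norm z < e" for z
        using d(2)[of z] pos0 that by (cases "z = 0") (auto simp: e_def)
    qed (use d(1) in \<open>auto simp: e_def\<close>)
    \<comment> \<open>A bump positive exactly on the ball on which \<open>T\<close> is known to have
      the sign of \<open>T 0\<close>; then \<open>\<rho> z * T z * T 0\<close> is nonnegative, has
      integral 0 and is positive on a nonempty open ball.\<close>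
    define \<rho> where "\<rho> = (\<lambda>z::'a. flat 0 1 (e\<^sup>2 - (norm (z - 0))\<^sup>2))"
    have rho0: "\<rho> z = 0 \<longleftrightarrow> norm z \<ge> e" for z
      using e(1) by (simp add: \<rho>_def flat_eq_0_iff abs_le_square_iff[symmetric])
    have rnn: "\<rho> z \<ge> 0" for z
      by (simp add: \<rho>_def)
    have "test_function \<rho>"
    proof (rule test_functionI)
      show "Ck k \<rho>" for k
        unfolding \<rho>_def by (intro Ck_flat Ck_diff Ck_const Ck_dist_sq) simp
      show "\<rho> x = 0" if "norm x > 1" for x
        using that e(2) rho0 by auto
    qed
    then have K: "integrable lborel (\<lambda>z. \<rho> z * T z)" "(\<integral>z. \<rho> z * T z \<partial>lborel) = 0"
      using key[of \<rho>] e(2) rho0 by auto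
    have i: "integrable lborel (\<lambda>z. \<rho> z * T z * T 0)"
      using K(1) by simp
    have nn: "0 \<le> \<rho> z * T z * T 0" for z
    proof (cases "norm z < e")
      case True
      then show ?thesis
        using e(3)[OF True] rnn[of z] by (simp add: mult.assoc)
    next
      case False
      then show ?thesis using rho0[of z] by simp
    qed
    have "(\<integral>z. \<rho> z * T z * T 0 \<partial>lborel) = 0"
      using K(2) by simp
    then have "AE z in lborel. \<rho> z * T z * T 0 = 0"
      using integral_nonneg_eq_0_iff_AE[OF i] nn by simp
    then have "AE z in lborel. z \<notin> ball (0::'a) e"
    proof eventually_elim
      case (elim z)
      show ?case
      proof
        assume "z \<in> ball 0 e"
        then show False
          using elim e(3)[of z] rho0[of z] by (auto simp: mult.assoc)
      qed
    qed
    then have "AE z in lebesgue. z \<notin> ball (0::'a) e"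
      by (rule AE_completion)
    then have "negligible (ball (0::'a) e)"
      by (simp add: negligible_iff_null_sets AE_iff_null_sets)
    then show False
      using open_not_negligible[of "ball (0::'a) e"] e(1) by simp
  qed
  have j: "integrable lborel (\<lambda>x. f x * \<psi>' x * f x)" "integrable lborel (\<lambda>x. f x * \<psi> x * g x)"
    using L2_translation(1)[OF _ _ i1(2) f(2), where z = 0 and Z = "\<lambda>n. 0"]
      L2_translation(1)[OF _ _ i3(2) g(2), where z = 0 and Z = "\<lambda>n. 0"] by simp_all
  have eqs: "g x * \<psi> x * f x = f x * \<psi> x * g x" "(f x)\<^sup>2 * frechet_derivative \<psi> (at x) v = f x * \<psi>' x * f x"
    "2 * f x * g x * \<psi> x = 2 * (f x * \<psi> x * g x)" for x
    by (simp_all add: power2_eq_square \<psi>'_def)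
  \<comment> \<open>At shift 0 the terms \<open>T2\<close> and \<open>T3\<close> coincide, whence
    the factor 2 of the chain rule.\<close>
  have "(\<integral>x. f x * \<psi>' x * f x \<partial>lborel) + 2 * (\<integral>x. f x * \<psi> x * g x \<partial>lborel) = 0"
    using \<open>T 0 = 0\<close> unfolding T_def T1_def T2_def T3_def diff_zero eqs(1) by simp
  then show ?thesis
    unfolding eqs by simp
qed


text \<open>Localises the preceding identity: cut off to a ball, \<open>f\<close> and each component
  of \<open>G\<close> lie in L^1 and L^2. The product f G is locally integrable because 2 |f| |G|
  \<le> f^2 + |G|^2.\<close>

lemma has_weak_gradient_square:
  fixes f :: "real^'n \<Rightarrow> real" and G :: "real^'n \<Rightarrow> real^'n"
  assumes fG: "has_weak_gradient f G"
    and f2: "locally_integrable (\<lambda>x. (f x)\<^sup>2)" and G2: "locally_integrable (\<lambda>x. (norm (G x))\<^sup>2)"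
  shows "has_weak_gradient (\<lambda>x. (f x)\<^sup>2) (\<lambda>x. (2 * f x) *\<^sub>R G x)"
  unfolding has_weak_gradient_def
proof (intro conjI allI impI)
  have lf: "locally_integrable f" and lG: "locally_integrable G"
    using fG by (auto simp: has_weak_gradient_def)
  have mf[measurable]: "f \<in> borel_measurable lebesgue" and mG[measurable]: "G \<in> borel_measurable lebesgue"
    using lf lG locally_integrable_measurable by auto
  show "locally_integrable (\<lambda>x. (f x)\<^sup>2)" by (rule f2)
  show "locally_integrable (\<lambda>x. (2 * f x) *\<^sub>R G x)"
  proof (rule locally_integrableI_cball)
    fix R
    show "integrable lebesgue (\<lambda>x. indicat_real (cball 0 R) x *\<^sub>R ((2 * f x) *\<^sub>R G x))"
    proof (rule Bochner_Integration.integrable_bound)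
      show "integrable lebesgue (\<lambda>x. indicat_real (cball 0 R) x *\<^sub>R (f x)\<^sup>2
          + indicat_real (cball 0 R) x *\<^sub>R (norm (G x))\<^sup>2)"
        by (intro Bochner_Integration.integrable_add integrable_cball_of_locally_integrable f2 G2)
      have "2 * \<bar>f x\<bar> * norm (G x) \<le> (f x)\<^sup>2 + (norm (G x))\<^sup>2" for x
        using sum_squares_bound[of "\<bar>f x\<bar>" "norm (G x)"] by simp
      then show "AE x in lebesgue. norm (indicat_real (cball 0 R) x *\<^sub>R ((2 * f x) *\<^sub>R G x))
          \<le> norm (indicat_real (cball 0 R) x *\<^sub>R (f x)\<^sup>2 + indicat_real (cball 0 R) x *\<^sub>R (norm (G x))\<^sup>2)"
        by (intro always_eventually allI) (auto simp: indicator_def abs_mult)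
    qed (intro borel_measurable_scaleR borel_measurable_times borel_measurable_const
        borel_measurable_indicator mf mG; simp)
  qed
  fix \<psi> :: "real^'n \<Rightarrow> real" and i :: 'n
  assume psi: "test_function \<psi>"
  obtain R where R: "\<And>x. norm x > R \<Longrightarrow> \<psi> x = 0"
    using test_function_support[OF psi] by blast
  obtain f' where f'[measurable]: "f' \<in> borel_measurable lborel" and ff: "AE x in lborel. f x = f' x"
    using completion_ex_borel_measurable_real[OF locally_integrable_measurable[OF lf]] by blast
  have mGi: "(\<lambda>x. G x $ i) \<in> borel_measurable lebesgue"
    by (rule measurable_compose[OF mG])
       (intro borel_measurable_continuous_onI continuous_intros)
  then obtain g' where g'[measurable]: "g' \<in> borel_measurable lborel"
    and gg: "AE x in lborel. G x $ i = g' x"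
    using completion_ex_borel_measurable_real[OF mGi] by blast
  note ffL = AE_completion[OF ff] and ggL = AE_completion[OF gg]
  have [measurable]: "f' \<in> borel_measurable lebesgue" "g' \<in> borel_measurable lebesgue"
    by (rule measurable_completion[OF f'] measurable_completion[OF g'])+
  \<comment> \<open>The margin 2 beyond the support of \<psi> keeps the weak formulation intact for
    every test function used in the correlation argument.\<close>
  define B where "B = cball (0 :: real^'n) (R + 2)"
  define f0 where "f0 = (\<lambda>x. indicat_real B x * f' x)"
  define g0 where "g0 = (\<lambda>x. indicat_real B x * g' x)"
  have [measurable]: "B \<in> sets borel"
    by (simp add: B_def)
  have mfg0[measurable]: "f0 \<in> borel_measurable lborel" "g0 \<in> borel_measurable lborel"
    unfolding f0_def g0_def by measurable
  have [measurable]: "f0 \<in> borel_measurable lebesgue" "g0 \<in> borel_measurable lebesgue"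
    by (auto intro: measurable_completion)
  have transfer: "integrable lborel u"
    if "u \<in> borel_measurable lborel" "integrable lebesgue w" "AE x in lebesgue. \<bar>u x\<bar> \<le> norm (w x)"
    for u :: "real^'n \<Rightarrow> real" and w :: "real^'n \<Rightarrow> 'b::{banach, second_countable_topology}"
    using Bochner_Integration.integrable_bound[OF that(2), of u] that(1,3)
    by (simp add: integrable_completion measurable_completion)
  have if0: "integrable lborel f0"
    by (rule transfer[OF mfg0(1) integrable_cball_of_locally_integrable[OF lf, of "R + 2"]])
       (use ffL in \<open>auto simp: f0_def B_def abs_mult\<close>)
  have if02: "integrable lborel (\<lambda>x. (f0 x)\<^sup>2)"
    by (rule transfer[OF borel_measurable_power[OF mfg0(1)] integrable_cball_of_locally_integrable[OF f2, of "R + 2"]])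
       (use ffL in \<open>auto simp: f0_def B_def power_mult_distrib indicator_def\<close>)
  have ig0: "integrable lborel g0"
  proof (rule transfer[OF mfg0(2) integrable_cball_of_locally_integrable[OF lG, of "R + 2"]])
    show "AE x in lebesgue. \<bar>g0 x\<bar> \<le> norm (indicat_real (cball 0 (R + 2)) x *\<^sub>R G x)"
      using ggL
    proof eventually_elim
      case (elim x)
      then show ?case
        using component_le_norm_cart[of "G x" i] by (simp add: g0_def B_def indicator_def abs_mult)
    qed
  qed
  have ig02: "integrable lborel (\<lambda>x. (g0 x)\<^sup>2)"
  proof (rule transfer[OF borel_measurable_power[OF mfg0(2)] integrable_cball_of_locally_integrable[OF G2, of "R + 2"]])
    show "AE x in lebesgue. \<bar>(g0 x)\<^sup>2\<bar> \<le> norm (indicat_real (cball 0 (R + 2)) x *\<^sub>R (norm (G x))\<^sup>2)"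
      using ggL
    proof eventually_elim
      case (elim x)
      have "(G x $ i)\<^sup>2 \<le> (norm (G x))\<^sup>2"
        using component_le_norm_cart[of "G x" i] by (simp add: abs_le_square_iff[symmetric])
      then show ?case
        using elim by (simp add: g0_def B_def indicator_def)
    qed
  qed
  \<comment> \<open>Passes from the given functions on \<open>lebesgue\<close> to truncated Borel
    representatives on \<open>lborel\<close>; agreement on \<open>B\<close> suffices because
    \<open>w\<close> vanishes outside.\<close>
  have eq: "(\<integral>x. u x * w x \<partial>lebesgue) = (\<integral>x. u0 x * w x \<partial>lborel)"
    if [measurable]: "u \<in> borel_measurable lebesgue" "u0 \<in> borel_measurable lborel"
      and w: "continuous_on UNIV w" "\<And>x. norm x > R + 2 \<Longrightarrow> w x = 0"
      and ae: "AE x in lebesgue. x \<in> B \<longrightarrow> u x = u0 x"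
    for u u0 w :: "real^'n \<Rightarrow> real"
  proof -
    have [measurable]: "w \<in> borel_measurable borel"
      using w(1) by (rule borel_measurable_continuous_onI)
    have m: "(\<lambda>x. u0 x * w x) \<in> borel_measurable lborel"
      by measurable
    have "(\<lambda>x. u x * w x) \<in> borel_measurable lebesgue"
      by (intro borel_measurable_times that measurable_completion) simp
    moreover have "AE x in lebesgue. u x * w x = u0 x * w x"
      using ae by eventually_elim (use w(2) in \<open>force simp: B_def\<close>)
    ultimately have "(\<integral>x. u x * w x \<partial>lebesgue) = (\<integral>x. u0 x * w x \<partial>lebesgue)"
      using measurable_completion[OF m] by (intro integral_cong_AE)
    then show ?thesis
      by (simp add: integral_completion[OF m])
  qed
  have aef: "AE x in lebesgue. x \<in> B \<longrightarrow> f x = f0 x"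
    using ffL by eventually_elim (simp add: f0_def)
  have aeg: "AE x in lebesgue. x \<in> B \<longrightarrow> G x $ i = g0 x"
    using ggL by eventually_elim (simp add: g0_def)
  have aef2: "AE x in lebesgue. x \<in> B \<longrightarrow> (f x)\<^sup>2 = (f0 x)\<^sup>2"
    using aef by eventually_elim simp
  have aefg: "AE x in lebesgue. x \<in> B \<longrightarrow> ((2 * f x) *\<^sub>R G x) $ i = 2 * f0 x * g0 x"
    using aef aeg by eventually_elim simp
  have cont: "continuous_on UNIV \<eta>" "continuous_on UNIV (\<lambda>x. frechet_derivative \<eta> (at x) (axis i 1))"
    if "test_function \<eta>" for \<eta> :: "real^'n \<Rightarrow> real"
    using test_function_Ck[OF that, of "Suc 0"] Ck_imp_continuous[OF test_function_Ck[OF that, of "Suc 0"]] by auto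
  have mm: "(\<lambda>x. (f x)\<^sup>2) \<in> borel_measurable lebesgue" "(\<lambda>x. (f0 x)\<^sup>2) \<in> borel_measurable lborel"
    "(\<lambda>x. ((2 * f x) *\<^sub>R G x) $ i) \<in> borel_measurable lebesgue"
    "(\<lambda>x. 2 * f0 x * g0 x) \<in> borel_measurable lborel"
    using mf mGi by simp_all
  have "(\<integral>x. (f0 x)\<^sup>2 * frechet_derivative \<psi> (at x) (axis i 1) \<partial>lborel)
      = - (\<integral>x. 2 * f0 x * g0 x * \<psi> x \<partial>lborel)"
  proof (rule weak_derivative_square_L2[OF if0 if02 ig0 ig02 _ psi R])
    fix \<eta> :: "real^'n \<Rightarrow> real"
    assume eta: "test_function \<eta>" "\<And>x. norm x > R + 2 \<Longrightarrow> \<eta> x = 0"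
    have "(\<integral>x. f x * frechet_derivative \<eta> (at x) (axis i 1) \<partial>lebesgue) = - (\<integral>x. G x $ i * \<eta> x \<partial>lebesgue)"
      using fG eta(1) unfolding has_weak_gradient_def by blast
    then show "(\<integral>x. f0 x * frechet_derivative \<eta> (at x) (axis i 1) \<partial>lborel) = - (\<integral>x. g0 x * \<eta> x \<partial>lborel)"
      using eq[OF _ _ cont(2)[OF eta(1)] frechet_derivative_eq_0_outside[OF eta(2)] aef]
        eq[OF mGi _ cont(1)[OF eta(1)] eta(2) aeg]
      by simp
  qed
  moreover have R': "\<psi> x = 0" if "norm x > R + 2" for x
    using R that by simp
  ultimately show "(\<integral>x. (f x)\<^sup>2 * frechet_derivative \<psi> (at x) (axis i 1) \<partial>lebesgue)
      = - (\<integral>x. ((2 * f x) *\<^sub>R G x) $ i * \<psi> x \<partial>lebesgue)"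
    using eq[OF mm(1,2) cont(2)[OF psi] frechet_derivative_eq_0_outside[OF R'] aef2]
      eq[OF mm(3,4) cont(1)[OF psi] R' aefg] by simp
qed

section \<open>The approximate ground states\<close>

text \<open>In this form the derivative of a product is the product times the sum of the logarithmic
  derivatives. The formula persists where \<open>g x \<le> 0\<close>: the factor
  \<open>flat p \<epsilon> (g x)\<close> is 0 there, and so is the derivative.\<close>

lemma flat_has_log_derivative:
  assumes "\<epsilon> > 0" "(g has_derivative g') (at x)"
  shows "((\<lambda>x. flat p \<epsilon> (g x)) has_derivative
    (\<lambda>v. flat p \<epsilon> (g x) * ((- p / g x + \<epsilon> / (g x)\<^sup>2) * g' v))) (at x)"
proof -
  have "flat (p + 1) \<epsilon> t = flat p \<epsilon> t / t" "flat (p + 2) \<epsilon> t = flat p \<epsilon> t / t\<^sup>2" for t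
  proof -
    show 1: "flat (p + 1) \<epsilon> t = flat p \<epsilon> t / t"
      by (rule flat_divide[symmetric])
    have "p + 1 + 1 = p + 2"
      by simp
    then have "flat (p + 2) \<epsilon> t = flat (p + 1) \<epsilon> t / t"
      using flat_divide[of "p + 1" \<epsilon> t] by metis
    then show "flat (p + 2) \<epsilon> t = flat p \<epsilon> t / t\<^sup>2"
      by (simp add: 1 power2_eq_square)
  qed
  then have "(\<lambda>v. (- p * flat (p + 1) \<epsilon> (g x) + \<epsilon> * flat (p + 2) \<epsilon> (g x)) * g' v)
      = (\<lambda>v. flat p \<epsilon> (g x) * ((- p / g x + \<epsilon> / (g x)\<^sup>2) * g' v))"
    by (simp add: algebra_simps)
  then show ?thesis
    using flat_has_derivative[OF assms, of p] by simp
qed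

lemma has_log_derivative_mult:
  fixes f g :: "'a::real_normed_vector \<Rightarrow> real"
  assumes "(f has_derivative (\<lambda>v. f x * L v)) (at x)" "(g has_derivative (\<lambda>v. g x * M v)) (at x)"
  shows "((\<lambda>x. f x * g x) has_derivative (\<lambda>v. (f x * g x) * (L v + M v))) (at x)"
  using has_derivative_mult[OF assms] by (simp add: algebra_simps)

lemma has_log_derivative_prod:
  fixes f :: "'i \<Rightarrow> 'a::real_normed_vector \<Rightarrow> real"
  assumes "\<And>i. i \<in> A \<Longrightarrow> (f i has_derivative (\<lambda>v. f i x * L i v)) (at x)"
  shows "((\<lambda>x. \<Prod>i\<in>A. f i x) has_derivative (\<lambda>v. (\<Prod>i\<in>A. f i x) * (\<Sum>i\<in>A. L i v))) (at x)"
  using assms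
  by (induction A rule: infinite_finite_induct) (auto intro!: has_log_derivative_mult)

lemma dist_sq_has_derivative:
  fixes a :: "'a::real_inner"
  shows "((\<lambda>x. (norm (x - a))\<^sup>2) has_derivative (\<lambda>v. 2 * ((x - a) \<bullet> v))) (at x)"
  unfolding power2_norm_eq_inner by (auto intro!: derivative_eq_intros simp: inner_commute)

context
  fixes a :: "nat \<Rightarrow> real^'n" and n :: nat
begin

definition pole_sum :: "real^'n \<Rightarrow> real" where
  "pole_sum x = (\<Sum>i\<in>{1..n}. 1 / (norm (x - a i))\<^sup>2)"

text \<open>Away from the poles, \<open>- \<beta>\<close> times this field is the gradient of log
  \<phi>_0.\<close>

definition pole_field :: "real^'n \<Rightarrow> real^'n" where
  "pole_field x = (\<Sum>i\<in>{1..n}. (x - a i) /\<^sub>R (norm (x - a i))\<^sup>2)"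

text \<open>The logarithmic gradient of the cutoff
  $\prod_i e^{-\epsilon/|x - a_i|^2} \cdot e^{-R^2/(R^2 - |x|^2)}$ where this is nonzero; elsewhere its
  value is irrelevant, since it only occurs multiplied by \<open>approx_ground_state\<close>.\<close>
definition cutoff_field :: "real \<Rightarrow> real \<Rightarrow> real^'n \<Rightarrow> real^'n" where
  "cutoff_field \<epsilon> R x = (\<Sum>i\<in>{1..n}. (2 * \<epsilon> / ((norm (x - a i))\<^sup>2)\<^sup>2) *\<^sub>R (x - a i))
    - (2 * R\<^sup>2 / (R\<^sup>2 - (norm x)\<^sup>2)\<^sup>2) *\<^sub>R x"

text \<open>The exponent is halved because the argument is the squared distance: for positive
  distance the i-th factor is |x - a_i|^(-\<beta>) exp(-\<epsilon>/|x - a_i|^2). The last factor is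
  the cutoff at radius \<open>R\<close>.\<close>

definition approx_ground_state :: "real \<Rightarrow> real \<Rightarrow> real \<Rightarrow> real^'n \<Rightarrow> real" where
  "approx_ground_state \<beta> \<epsilon> R x =
    (\<Prod>i\<in>{1..n}. flat (\<beta> / 2) \<epsilon> ((norm (x - a i))\<^sup>2)) * flat 0 (R\<^sup>2) (R\<^sup>2 - (norm x)\<^sup>2)"

text \<open>The source of the potential V: by polarization, 2 (x - a_i) \<bullet> (x - a_j) = |x -
  a_i|^2 + |x - a_j|^2 - |a_i - a_j|^2. Dividing by the squared distances and summing over all
  pairs, the first two terms give the pole sum and the last one gives V; the diagonal contributes
  nothing to V.\<close>

lemma norm_pole_field_sq:
  assumes "x \<notin> a ` {1..n}"
  shows "(norm (pole_field x))\<^sup>2 = real n * pole_sum x - potV a n x"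
proof -
  let ?q = "\<lambda>i. (norm (x - a i))\<^sup>2"
  have q: "?q i \<noteq> 0" if "i \<in> {1..n}" for i
    using assms that by auto
  have pair: "((x - a i) /\<^sub>R ?q i) \<bullet> ((x - a j) /\<^sub>R ?q j)
      = (1 / ?q i + 1 / ?q j) / 2 - (norm (a i - a j))\<^sup>2 / (?q i * ?q j) / 2"
    if "i \<in> {1..n}" "j \<in> {1..n}" for i j
  proof -
    have "(norm (a i - a j))\<^sup>2 = ?q i + ?q j - 2 * ((x - a i) \<bullet> (x - a j))"
      by (simp add: power2_norm_eq_inner algebra_simps inner_commute)
    then have *: "(x - a i) \<bullet> (x - a j) = (?q i + ?q j - (norm (a i - a j))\<^sup>2) / 2"
      by simp
    have e: "((x - a i) /\<^sub>R ?q i) \<bullet> ((x - a j) /\<^sub>R ?q j) = ((x - a i) \<bullet> (x - a j)) / (?q i * ?q j)"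
      by (simp add: divide_inverse mult_ac)
    show ?thesis
      unfolding e * using q[OF that(1)] q[OF that(2)] by (simp add: field_simps)
  qed
  have "(norm (pole_field x))\<^sup>2 = (\<Sum>i\<in>{1..n}. \<Sum>j\<in>{1..n}. ((x - a i) /\<^sub>R ?q i) \<bullet> ((x - a j) /\<^sub>R ?q j))"
    unfolding power2_norm_eq_inner pole_field_def by (simp only: inner_sum_left inner_sum_right) (rule sum.swap)
  also have "\<dots> = (\<Sum>i\<in>{1..n}. \<Sum>j\<in>{1..n}.
      (1 / ?q i + 1 / ?q j) / 2 - (norm (a i - a j))\<^sup>2 / (?q i * ?q j) / 2)"
    by (intro sum.cong refl pair)
  also have "\<dots> = (\<Sum>i\<in>{1..n}. \<Sum>j\<in>{1..n}. (1 / ?q i + 1 / ?q j) / 2)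
      - (\<Sum>i\<in>{1..n}. \<Sum>j\<in>{1..n}. (norm (a i - a j))\<^sup>2 / (?q i * ?q j)) / 2"
    by (simp only: sum_subtractf sum_divide_distrib)
  also have "(\<Sum>i\<in>{1..n}. \<Sum>j\<in>{1..n}. (1 / ?q i + 1 / ?q j) / 2) = real n * pole_sum x"
  proof -
    have "(\<Sum>i\<in>{1..n}. \<Sum>j\<in>{1..n}. (1 / ?q i + 1 / ?q j) / 2)
        = ((\<Sum>i\<in>{1..n}. \<Sum>j\<in>{1..n}. 1 / ?q i) + (\<Sum>i\<in>{1..n}. \<Sum>j\<in>{1..n}. 1 / ?q j)) / 2"
      by (simp only: sum.distrib sum_divide_distrib[symmetric])
    also have "(\<Sum>i\<in>{1..n}. \<Sum>j\<in>{1..n}. 1 / ?q i) = real n * pole_sum x"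
      by (simp add: pole_sum_def sum_distrib_left)
    also have "(\<Sum>i\<in>{1..n}. \<Sum>j\<in>{1..n}. 1 / ?q j) = real n * pole_sum x"
      by (simp add: pole_sum_def)
    finally show ?thesis
      by simp
  qed
  also have "(\<Sum>i\<in>{1..n}. \<Sum>j\<in>{1..n}. (norm (a i - a j))\<^sup>2 / (?q i * ?q j)) / 2 = potV a n x"
  proof -
    have "(\<Sum>j\<in>{1..n}. (norm (a i - a j))\<^sup>2 / (?q i * ?q j))
        = (\<Sum>j\<in>{1..n} - {i}. (norm (a i - a j))\<^sup>2 / (?q i * ?q j))" if "i \<in> {1..n}" for i
      using that by (subst sum.remove[of _ i]) auto
    then show ?thesis
      by (simp add: potV_def)
  qed
  finally show ?thesis .
qed

lemma potV_nonneg: "0 \<le> potV a n x"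
  unfolding potV_def by (intro mult_nonneg_nonneg sum_nonneg) auto

lemma pole_sum_nonneg: "0 \<le> pole_sum x"
  unfolding pole_sum_def by (intro sum_nonneg) auto

text \<open>The difference of the two sides is a squared norm. Hence integrability of the pole sum
  term covers the V term as well.\<close>

lemma potV_le: 
  assumes "x \<notin> a ` {1..n}"
  shows "potV a n x \<le> real n * pole_sum x"
  using norm_pole_field_sq[OF assms] zero_le_power2[of "norm (pole_field x)"] by linarith

lemma measurable_potW:
  assumes "has_weak_gradient \<mu> (weak_grad \<mu>)"
  shows "potW \<mu> a n K \<in> borel_measurable lebesgue"
proof -
  have m: "\<mu> \<in> borel_measurable lebesgue" "weak_grad \<mu> \<in> borel_measurable lebesgue"
    using assms locally_integrable_measurable by (auto simp: has_weak_gradient_def)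
  have "(\<lambda>x. c / (norm (x - a i))\<^sup>2) \<in> borel_measurable lborel" for i c
    by measurable
  moreover have "(\<lambda>x :: real^'n. x) \<in> borel_measurable lborel"
    by measurable
  ultimately show ?thesis
    unfolding potW_def[abs_def] Let_def
    by (intro borel_measurable_times borel_measurable_uminus borel_measurable_sum
        borel_measurable_diff borel_measurable_inner borel_measurable_scaleR
        borel_measurable_inverse borel_measurable_const m measurable_completion)
qed

lemma AE_not_pole: "AE x in lebesgue. x \<notin> a ` {1..n}"
proof -
  have "negligible (a ` {1..n})"
    by (rule negligible_finite) simp
  then show ?thesis
    by (simp add: negligible_iff_null_sets AE_not_in)
qed

section \<open>Derivatives of the approximate ground states\<close>

context
  fixes \<beta> \<epsilon> R :: real
  assumes eps: "\<epsilon> > 0" and R: "R > 0"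
begin

lemma approx_has_derivative:
  "(approx_ground_state \<beta> \<epsilon> R has_derivative (\<lambda>v. approx_ground_state \<beta> \<epsilon> R x * ((cutoff_field \<epsilon> R x - \<beta> *\<^sub>R pole_field x) \<bullet> v))) (at x)"
proof -
  have "((\<lambda>x. flat (\<beta> / 2) \<epsilon> ((norm (x - a i))\<^sup>2)) has_derivative
      (\<lambda>v. flat (\<beta> / 2) \<epsilon> ((norm (x - a i))\<^sup>2) * ((- (\<beta> / 2) / (norm (x - a i))\<^sup>2
        + \<epsilon> / ((norm (x - a i))\<^sup>2)\<^sup>2) * (2 * ((x - a i) \<bullet> v))))) (at x)" for i
    by (rule flat_has_log_derivative[OF eps dist_sq_has_derivative])
  moreover have "((\<lambda>x. R\<^sup>2 - (norm x)\<^sup>2) has_derivative (\<lambda>v. - (2 * (x \<bullet> v)))) (at x)"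
    using has_derivative_diff[OF has_derivative_const[of "R\<^sup>2"] dist_sq_has_derivative[of 0]] by simp
  then have "((\<lambda>x. flat 0 (R\<^sup>2) (R\<^sup>2 - (norm x)\<^sup>2)) has_derivative
      (\<lambda>v. flat 0 (R\<^sup>2) (R\<^sup>2 - (norm x)\<^sup>2) * ((- 0 / (R\<^sup>2 - (norm x)\<^sup>2)
        + R\<^sup>2 / (R\<^sup>2 - (norm x)\<^sup>2)\<^sup>2) * (- (2 * (x \<bullet> v)))))) (at x)"
    by (rule flat_has_log_derivative[rotated]) (use R in simp)
  ultimately have "(approx_ground_state \<beta> \<epsilon> R has_derivative (\<lambda>v. approx_ground_state \<beta> \<epsilon> R x * ((\<Sum>i\<in>{1..n}. (- (\<beta> / 2) / (norm (x - a i))\<^sup>2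
        + \<epsilon> / ((norm (x - a i))\<^sup>2)\<^sup>2) * (2 * ((x - a i) \<bullet> v)))
        + (- 0 / (R\<^sup>2 - (norm x)\<^sup>2) + R\<^sup>2 / (R\<^sup>2 - (norm x)\<^sup>2)\<^sup>2) * (- (2 * (x \<bullet> v)))))) (at x)"
    unfolding approx_ground_state_def
    by (intro has_log_derivative_mult has_log_derivative_prod)
  moreover have "(\<Sum>i\<in>{1..n}. (- (\<beta> / 2) / (norm (x - a i))\<^sup>2
        + \<epsilon> / ((norm (x - a i))\<^sup>2)\<^sup>2) * (2 * ((x - a i) \<bullet> v)))
        + (- 0 / (R\<^sup>2 - (norm x)\<^sup>2) + R\<^sup>2 / (R\<^sup>2 - (norm x)\<^sup>2)\<^sup>2) * (- (2 * (x \<bullet> v)))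
      = (cutoff_field \<epsilon> R x - \<beta> *\<^sub>R pole_field x) \<bullet> v" for v
  proof -
    have "(- (\<beta> / 2) / (norm (x - a i))\<^sup>2 + \<epsilon> / ((norm (x - a i))\<^sup>2)\<^sup>2) * (2 * ((x - a i) \<bullet> v))
        = (2 * \<epsilon> / ((norm (x - a i))\<^sup>2)\<^sup>2) * ((x - a i) \<bullet> v)
          - \<beta> * (((x - a i) \<bullet> v) / (norm (x - a i))\<^sup>2)" for i
      by (simp add: field_simps)
    moreover have "cutoff_field \<epsilon> R x \<bullet> v = (\<Sum>i\<in>{1..n}. (2 * \<epsilon> / ((norm (x - a i))\<^sup>2)\<^sup>2) * ((x - a i) \<bullet> v))
        - (2 * R\<^sup>2 / (R\<^sup>2 - (norm x)\<^sup>2)\<^sup>2) * (x \<bullet> v)"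
      unfolding cutoff_field_def inner_diff_left[of "sum _ _"] inner_sum_left inner_scaleR_left ..
    moreover have "pole_field x \<bullet> v = (\<Sum>i\<in>{1..n}. ((x - a i) \<bullet> v) / (norm (x - a i))\<^sup>2)"
      unfolding pole_field_def inner_sum_left inner_scaleR_left divide_inverse mult.commute[of _ "inverse _"] ..
    ultimately show ?thesis
      unfolding inner_diff_left[of "cutoff_field \<epsilon> R x"] inner_scaleR_left
      by (simp only: sum_subtractf sum_distrib_left[symmetric]) simp
  qed
  ultimately show ?thesis
    by simp
qed

lemma Ck_approx: "Ck k (approx_ground_state \<beta> \<epsilon> R)"
  unfolding approx_ground_state_def
  by (intro Ck_mult Ck_prod Ck_flat Ck_diff Ck_const Ck_dist_sq Ck_dist_sq[of _ 0, simplified] eps) (use R in simp)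

lemma approx_eq_0: "norm x > R \<Longrightarrow> approx_ground_state \<beta> \<epsilon> R x = 0"
  using R by (simp add: approx_ground_state_def flat_eq_0_iff abs_le_square_iff[symmetric])

text \<open>Division by a squared distance merely raises the exponent of one flat factor, so the
  quotient is smooth across the pole.\<close>

lemma approx_sq_div:
  assumes i: "i \<in> {1..n}"
  shows "(approx_ground_state \<beta> \<epsilon> R x)\<^sup>2 / (norm (x - a i))\<^sup>2
    = (\<Prod>j\<in>{1..n}. flat (\<beta> + of_bool (j = i)) (2 * \<epsilon>) ((norm (x - a j))\<^sup>2))
      * flat 0 (2 * R\<^sup>2) (R\<^sup>2 - (norm x)\<^sup>2)"
proof -
  let ?F = "\<lambda>j. flat \<beta> (2 * \<epsilon>) ((norm (x - a j))\<^sup>2)"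
  have "(approx_ground_state \<beta> \<epsilon> R x)\<^sup>2 = (\<Prod>j\<in>{1..n}. ?F j) * flat 0 (2 * R\<^sup>2) (R\<^sup>2 - (norm x)\<^sup>2)"
    unfolding approx_ground_state_def power_mult_distrib prod_power_distrib
    by (simp add: power2_eq_square[of "flat _ _ _"] flat_mult)
  also have "(\<Prod>j\<in>{1..n}. ?F j) = ?F i * (\<Prod>j\<in>{1..n} - {i}. ?F j)"
    using i by (simp add: prod.remove)
  finally have "(approx_ground_state \<beta> \<epsilon> R x)\<^sup>2 / (norm (x - a i))\<^sup>2 = (?F i / (norm (x - a i))\<^sup>2) * (\<Prod>j\<in>{1..n} - {i}. ?F j)
      * flat 0 (2 * R\<^sup>2) (R\<^sup>2 - (norm x)\<^sup>2)"
    by simp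
  also have "(?F i / (norm (x - a i))\<^sup>2) * (\<Prod>j\<in>{1..n} - {i}. ?F j)
      = (\<Prod>j\<in>{1..n}. flat (\<beta> + of_bool (j = i)) (2 * \<epsilon>) ((norm (x - a j))\<^sup>2))"
    using i by (subst prod.remove[of _ i]) (auto simp: flat_divide intro!: prod.cong)
  finally show ?thesis .
qed

lemma Ck_approx_sq_div:
  assumes "i \<in> {1..n}"
  shows "Ck k (\<lambda>x. (approx_ground_state \<beta> \<epsilon> R x)\<^sup>2 / (norm (x - a i))\<^sup>2)"
  unfolding approx_sq_div[OF assms]
  by (intro Ck_mult Ck_prod Ck_flat Ck_diff Ck_const Ck_dist_sq Ck_dist_sq[of _ 0, simplified]) (use eps R in auto)

lemma Ck_approx_field: "Ck k (\<lambda>x. (approx_ground_state \<beta> \<epsilon> R x)\<^sup>2 * (pole_field x $ j))"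
proof -
  have "(approx_ground_state \<beta> \<epsilon> R x)\<^sup>2 * (pole_field x $ j)
      = (\<Sum>i\<in>{1..n}. (x $ j - a i $ j) * ((approx_ground_state \<beta> \<epsilon> R x)\<^sup>2 / (norm (x - a i))\<^sup>2))" for x
    by (simp add: pole_field_def sum_distrib_left divide_inverse mult_ac)
  then show ?thesis
    by (simp only:) (intro Ck_sum Ck_mult Ck_diff[OF Ck_bounded_linear[OF bounded_linear_vec_nth] Ck_const]
        Ck_approx_sq_div)
qed

text \<open>The weak gradient of \<mu> is tested one coordinate at a time, so each component of the
  field has to be a test function.\<close>

lemma test_approx_field: "test_function (\<lambda>x. (approx_ground_state \<beta> \<epsilon> R x)\<^sup>2 * (pole_field x $ j))"
  by (rule test_functionI[where R = R, OF Ck_approx_field]) (simp add: approx_eq_0)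

text \<open>The first term comes from the gradient of \<phi>^2 and the second from div((x - a)/|x -
  a|^2) = (N - 2)/|x - a|^2.\<close>

lemma divergence_approx_field:
  assumes x: "x \<notin> a ` {1..n}"
  shows "(\<Sum>j\<in>UNIV. frechet_derivative (\<lambda>x. (approx_ground_state \<beta> \<epsilon> R x)\<^sup>2 * (pole_field x $ j)) (at x) (axis j 1))
    = (approx_ground_state \<beta> \<epsilon> R x)\<^sup>2 * (2 * ((cutoff_field \<epsilon> R x - \<beta> *\<^sub>R pole_field x) \<bullet> pole_field x)
        + (real CARD('n) - 2) * pole_sum x)"
proof -
  let ?Z = "cutoff_field \<epsilon> R x - \<beta> *\<^sub>R pole_field x"
  let ?q = "\<lambda>i. (norm (x - a i))\<^sup>2"
  have q: "?q i \<noteq> 0" if "i \<in> {1..n}" for i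
    using x that by auto
  have U: "((\<lambda>x. pole_field x $ j) has_derivative
      (\<lambda>v. \<Sum>i\<in>{1..n}. v $ j / ?q i - (x - a i) $ j * (2 * ((x - a i) \<bullet> v)) / (?q i)\<^sup>2)) (at x)" for j
  proof -
    have "((\<lambda>x. (x $ j - a i $ j) / (norm (x - a i))\<^sup>2) has_derivative
        (\<lambda>v. v $ j / ?q i - (x - a i) $ j * (2 * ((x - a i) \<bullet> v)) / (?q i)\<^sup>2)) (at x)"
      if "i \<in> {1..n}" for i
    proof -
      have "((\<lambda>x. x $ j - a i $ j) has_derivative (\<lambda>v. v $ j - 0)) (at x)"
        by (intro has_derivative_diff has_derivative_const
            bounded_linear.has_derivative[OF bounded_linear_vec_nth] has_derivative_ident)
      from has_derivative_divide[OF this dist_sq_has_derivative q[OF that]]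
      show ?thesis
        by (rule has_derivative_eq_rhs) (use q[OF that] in \<open>auto simp: field_simps power2_eq_square\<close>)
    qed
    then have "((\<lambda>x. \<Sum>i\<in>{1..n}. (x $ j - a i $ j) / (norm (x - a i))\<^sup>2) has_derivative
        (\<lambda>v. \<Sum>i\<in>{1..n}. v $ j / ?q i - (x - a i) $ j * (2 * ((x - a i) \<bullet> v)) / (?q i)\<^sup>2)) (at x)"
      by (intro has_derivative_sum)
    then show ?thesis
      by (simp add: pole_field_def divide_inverse mult.commute)
  qed
  have sq: "((\<lambda>x. (approx_ground_state \<beta> \<epsilon> R x)\<^sup>2) has_derivative (\<lambda>v. (approx_ground_state \<beta> \<epsilon> R x)\<^sup>2 * (2 * (?Z \<bullet> v)))) (at x)"
    using has_log_derivative_mult[OF approx_has_derivative approx_has_derivative]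
    by (simp add: power2_eq_square)
  have "frechet_derivative (\<lambda>x. (approx_ground_state \<beta> \<epsilon> R x)\<^sup>2 * (pole_field x $ j)) (at x) (axis j 1)
      = (approx_ground_state \<beta> \<epsilon> R x)\<^sup>2 * (2 * (?Z $ j * pole_field x $ j)
        + (\<Sum>i\<in>{1..n}. 1 / ?q i - 2 * ((x - a i) $ j)\<^sup>2 / (?q i)\<^sup>2))" for j
  proof -
    have "frechet_derivative (\<lambda>x. (approx_ground_state \<beta> \<epsilon> R x)\<^sup>2 * (pole_field x $ j)) (at x) (axis j 1)
        = (approx_ground_state \<beta> \<epsilon> R x)\<^sup>2 * (\<Sum>i\<in>{1..n}. axis j 1 $ j / ?q i - (x - a i) $ j * (2 * ((x - a i) \<bullet> axis j 1)) / (?q i)\<^sup>2)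
          + (approx_ground_state \<beta> \<epsilon> R x)\<^sup>2 * (2 * (?Z \<bullet> axis j 1)) * (pole_field x $ j)"
      by (rule fun_cong[OF frechet_derivative_at[OF has_derivative_mult[OF sq U[of j]]], symmetric])
    then show ?thesis
      by (simp add: inner_axis algebra_simps power2_eq_square)
  qed
  then have "(\<Sum>j\<in>UNIV. frechet_derivative (\<lambda>x. (approx_ground_state \<beta> \<epsilon> R x)\<^sup>2 * (pole_field x $ j)) (at x) (axis j 1))
      = (approx_ground_state \<beta> \<epsilon> R x)\<^sup>2 * (2 * (\<Sum>j\<in>UNIV. ?Z $ j * pole_field x $ j)
        + (\<Sum>j\<in>UNIV. \<Sum>i\<in>{1..n}. 1 / ?q i - 2 * ((x - a i) $ j)\<^sup>2 / (?q i)\<^sup>2))"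
    by (simp only: sum_distrib_left[symmetric] sum.distrib)
  also have "(\<Sum>j\<in>UNIV. \<Sum>i\<in>{1..n}. 1 / ?q i - 2 * ((x - a i) $ j)\<^sup>2 / (?q i)\<^sup>2)
      = (\<Sum>i\<in>{1..n}. \<Sum>j\<in>UNIV. 1 / ?q i - 2 * ((x - a i) $ j)\<^sup>2 / (?q i)\<^sup>2)"
    by (rule sum.swap)
  also have "\<dots> = (\<Sum>i\<in>{1..n}. (real CARD('n) - 2) * (1 / ?q i))"
  proof (rule sum.cong)
    fix i assume i: "i \<in> {1..n}"
    have "(\<Sum>j\<in>UNIV. ((x - a i) $ j)\<^sup>2) = ?q i"
      unfolding power2_norm_eq_inner inner_vec_def by (simp add: power2_eq_square)
    then have "(\<Sum>j\<in>UNIV. 1 / ?q i - 2 * ((x - a i) $ j)\<^sup>2 / (?q i)\<^sup>2)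
        = real CARD('n) * (1 / ?q i) - 2 * ?q i / (?q i)\<^sup>2"
      by (simp only: sum_subtractf sum_divide_distrib[symmetric] sum_distrib_left[symmetric]) simp
    then show "(\<Sum>j\<in>UNIV. 1 / ?q i - 2 * ((x - a i) $ j)\<^sup>2 / (?q i)\<^sup>2) = (real CARD('n) - 2) * (1 / ?q i)"
      using q[OF i] by (simp add: power2_eq_square field_simps)
  qed simp
  also have "\<dots> = (real CARD('n) - 2) * pole_sum x"
    by (simp add: pole_sum_def sum_distrib_left)
  also have "(\<Sum>j\<in>UNIV. ?Z $ j * pole_field x $ j) = ?Z \<bullet> pole_field x"
    by (simp add: inner_vec_def)
  finally show ?thesis .
qed

definition grad_approx :: "real^'n \<Rightarrow> real^'n" where
  "grad_approx x = approx_ground_state \<beta> \<epsilon> R x *\<^sub>R (cutoff_field \<epsilon> R x - \<beta> *\<^sub>R pole_field x)"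

lemma frechet_derivative_approx: "frechet_derivative (approx_ground_state \<beta> \<epsilon> R) (at x) v = grad_approx x \<bullet> v"
  using fun_cong[OF frechet_derivative_at[OF approx_has_derivative], of x v]
  by (simp add: grad_approx_def)

lemma continuous_grad_approx: "continuous_on UNIV grad_approx"
proof -
  have "continuous_on UNIV (\<lambda>x. frechet_derivative (approx_ground_state \<beta> \<epsilon> R) (at x) (axis j 1))" for j
    using Ck_approx[of "Suc 0"] by simp
  then have "continuous_on UNIV (\<lambda>x. \<chi> j. grad_approx x $ j)"
    by (intro continuous_on_vec_lambda) (simp add: frechet_derivative_approx inner_axis)
  then show ?thesis by simp
qed

lemma has_weak_gradient_approx: "has_weak_gradient (approx_ground_state \<beta> \<epsilon> R) grad_approx"
  by (rule has_weak_gradient_classical[OF Ck_approx frechet_derivative_approx])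

section \<open>The energy identity\<close>

context
  fixes \<mu> :: "real^'n \<Rightarrow> real" and K :: real
  assumes \<mu>: "has_weak_gradient \<mu> (weak_grad \<mu>)" "\<And>x. \<mu> x \<ge> 0" "AE x in lebesgue. \<mu> x > 0"
    and n\<beta>: "real n * \<beta> = real CARD('n) + K - 2" and n: "n > 0"
begin

text \<open>Positivity of \<mu> cancels the quotient in W, leaving \<nabla>\<mu> paired with
  \<phi>^2 times \<open>pole_field\<close>, which the weak formulation can handle.\<close>

lemma potW_eq:
  assumes "\<mu> x > 0"
  shows "\<mu> x * (potW \<mu> a n K x * (approx_ground_state \<beta> \<epsilon> R x)\<^sup>2)
    = \<beta> * K * (\<mu> x * ((approx_ground_state \<beta> \<epsilon> R x)\<^sup>2 * pole_sum x)) - \<beta> * ((approx_ground_state \<beta> \<epsilon> R x)\<^sup>2 * (pole_field x \<bullet> weak_grad \<mu> x))"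
proof -
  have b: "(real CARD('n) + K - 2) / real n = \<beta>"
    using n\<beta> n by (simp add: field_simps)
  have "potW \<mu> a n K x = - (\<Sum>i\<in>{1..n}. \<beta> * (((x - a i) /\<^sub>R (norm (x - a i))\<^sup>2) \<bullet> weak_grad \<mu> x) / \<mu> x
      - \<beta> * K * (1 / (norm (x - a i))\<^sup>2))"
    unfolding potW_def Let_def b
    by (intro arg_cong[where f = uminus] sum.cong refl) (simp add: divide_inverse algebra_simps)
  also have "\<dots> = \<beta> * K * pole_sum x - \<beta> * (pole_field x \<bullet> weak_grad \<mu> x) / \<mu> x"
    unfolding pole_sum_def pole_field_def inner_sum_left sum_subtractf
      sum_distrib_left sum_divide_distrib by simp
  finally have e: "potW \<mu> a n K x = \<beta> * K * pole_sum x - \<beta> * (pole_field x \<bullet> weak_grad \<mu> x) / \<mu> x" .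
  show ?thesis
    unfolding e using assms by (simp add: algebra_simps)
qed

text \<open>Summing the weak formulation of \<nabla>\<mu> over the components of \<phi>^2 U, U =
  \<open>pole_field\<close>, replaces -\<integral> \<phi>^2 U \<bullet> \<nabla>\<mu> by \<integral>
  \<mu> div(\<phi>^2 U). The function \<open>T\<close> is the resulting integrand; its closed form
  holds off the poles, hence almost everywhere.\<close>

lemma approx_energy:
  shows "integrable lebesgue (\<lambda>x. \<mu> x * (approx_ground_state \<beta> \<epsilon> R x)\<^sup>2)"
    and "integrable lebesgue (\<lambda>x. \<mu> x * (norm (grad_approx x))\<^sup>2)"
    and "integrable lebesgue (\<lambda>x. \<mu> x * (potV a n x * (approx_ground_state \<beta> \<epsilon> R x)\<^sup>2))"
    and "integrable lebesgue (\<lambda>x. \<mu> x * (potW \<mu> a n K x * (approx_ground_state \<beta> \<epsilon> R x)\<^sup>2))"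
    and "\<exists>T. integrable lebesgue T
      \<and> (AE x in lebesgue. T x = \<mu> x * ((approx_ground_state \<beta> \<epsilon> R x)\<^sup>2 * (\<beta>\<^sup>2 * potV a n x + (norm (cutoff_field \<epsilon> R x))\<^sup>2)))
      \<and> (\<integral>x. \<mu> x * (norm (grad_approx x))\<^sup>2 \<partial>lebesgue)
          + (\<integral>x. \<mu> x * (potW \<mu> a n K x * (approx_ground_state \<beta> \<epsilon> R x)\<^sup>2) \<partial>lebesgue) = (\<integral>x. T x \<partial>lebesgue)"
proof -
  let ?H = "weak_grad \<mu>"
  have l\<mu>: "locally_integrable \<mu>" and lH: "locally_integrable ?H"
    using \<mu>(1) by (auto simp: has_weak_gradient_def)
  have m\<mu>: "\<mu> \<in> borel_measurable lebesgue" and mH: "?H \<in> borel_measurable lebesgue"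
    using locally_integrable_measurable l\<mu> lH by auto
  have cont: "continuous_on UNIV (approx_ground_state \<beta> \<epsilon> R)"
    using Ck_approx Ck_imp_continuous by blast
  have mult: "integrable lebesgue (\<lambda>x. \<mu> x * g x)"
    if "continuous_on UNIV g" "\<And>x. norm x > R \<Longrightarrow> g x = 0" for g
    using integrable_continuous_mult_locally_integrable[OF l\<mu> that] by (simp add: mult.commute)
  show "integrable lebesgue (\<lambda>x. \<mu> x * (approx_ground_state \<beta> \<epsilon> R x)\<^sup>2)"
    by (rule mult) (auto intro: continuous_intros cont simp: approx_eq_0)
  show A: "integrable lebesgue (\<lambda>x. \<mu> x * (norm (grad_approx x))\<^sup>2)"
    by (rule mult) (intro continuous_intros continuous_grad_approx, simp add: approx_eq_0 grad_approx_def)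
  have S_eq: "(approx_ground_state \<beta> \<epsilon> R x)\<^sup>2 * pole_sum x = (\<Sum>i\<in>{1..n}. (approx_ground_state \<beta> \<epsilon> R x)\<^sup>2 / (norm (x - a i))\<^sup>2)" for x
    by (simp add: pole_sum_def sum_distrib_left)
  have S: "integrable lebesgue (\<lambda>x. \<mu> x * ((approx_ground_state \<beta> \<epsilon> R x)\<^sup>2 * pole_sum x))"
  proof (rule mult)
    show "continuous_on UNIV (\<lambda>x. (approx_ground_state \<beta> \<epsilon> R x)\<^sup>2 * pole_sum x)"
      unfolding S_eq by (intro continuous_on_sum Ck_imp_continuous[of 0] Ck_approx_sq_div)
  qed (simp add: approx_eq_0)
  show V: "integrable lebesgue (\<lambda>x. \<mu> x * (potV a n x * (approx_ground_state \<beta> \<epsilon> R x)\<^sup>2))"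
  proof (rule Bochner_Integration.integrable_bound[OF integrable_mult_right[OF S, of "real n"]])
    have [measurable]: "approx_ground_state \<beta> \<epsilon> R \<in> borel_measurable borel"
      using cont by (rule borel_measurable_continuous_onI)
    have "(\<lambda>x. potV a n x * (approx_ground_state \<beta> \<epsilon> R x)\<^sup>2) \<in> borel_measurable lborel"
      unfolding potV_def by measurable
    then show "(\<lambda>x. \<mu> x * (potV a n x * (approx_ground_state \<beta> \<epsilon> R x)\<^sup>2)) \<in> borel_measurable lebesgue"
      by (intro borel_measurable_times[OF m\<mu>] measurable_completion)
    show "AE x in lebesgue. norm (\<mu> x * (potV a n x * (approx_ground_state \<beta> \<epsilon> R x)\<^sup>2))
        \<le> norm (real n * (\<mu> x * ((approx_ground_state \<beta> \<epsilon> R x)\<^sup>2 * pole_sum x)))"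
      using AE_not_pole
    proof eventually_elim
      case (elim x)
      have "\<mu> x * (approx_ground_state \<beta> \<epsilon> R x)\<^sup>2 * potV a n x \<le> \<mu> x * (approx_ground_state \<beta> \<epsilon> R x)\<^sup>2 * (real n * pole_sum x)"
        by (intro mult_left_mono potV_le[OF elim] mult_nonneg_nonneg \<mu>(2)) auto
      then show ?case
        using \<mu>(2)[of x] pole_sum_nonneg[of x] potV_nonneg[of x]
        by (simp add: abs_mult mult_ac)
    qed
  qed
  have HU: "integrable lebesgue (\<lambda>x. ?H x $ j * ((approx_ground_state \<beta> \<epsilon> R x)\<^sup>2 * (pole_field x $ j)))" for j
  proof -
    have "locally_integrable (\<lambda>x. ?H x $ j)"
      using lH integrable_bounded_linear[OF bounded_linear_vec_nth[of j]]
      by (fastforce simp: locally_integrable_def set_integrable_def)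
    from integrable_continuous_mult_locally_integrable[OF this
        Ck_imp_continuous[OF Ck_approx_field[where k = 0 and j = j]], of R]
    show ?thesis
      by (simp add: mult.commute approx_eq_0)
  qed
  let ?d = "\<lambda>j x. frechet_derivative (\<lambda>x. (approx_ground_state \<beta> \<epsilon> R x)\<^sup>2 * (pole_field x $ j)) (at x) (axis j 1)"
  have D: "integrable lebesgue (\<lambda>x. \<mu> x * ?d j x)" for j
  proof (rule mult)
    show "continuous_on UNIV (?d j)"
      using Ck_approx_field[of "Suc 0" j] by simp
    show "?d j x = 0" if "norm x > R" for x
      by (rule frechet_derivative_eq_0_outside[OF _ that]) (simp add: approx_eq_0)
  qed
  have HU_eq: "(\<Sum>j\<in>UNIV. ?H x $ j * ((approx_ground_state \<beta> \<epsilon> R x)\<^sup>2 * (pole_field x $ j))) = (approx_ground_state \<beta> \<epsilon> R x)\<^sup>2 * (pole_field x \<bullet> ?H x)" for x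
    by (simp add: inner_vec_def sum_distrib_left mult_ac)
  have D_eq: "(\<integral>x. \<mu> x * (\<Sum>j\<in>UNIV. ?d j x) \<partial>lebesgue) = - (\<integral>x. (approx_ground_state \<beta> \<epsilon> R x)\<^sup>2 * (pole_field x \<bullet> ?H x) \<partial>lebesgue)"
  proof -
    have "(\<integral>x. \<mu> x * (\<Sum>j\<in>UNIV. ?d j x) \<partial>lebesgue) = (\<Sum>j\<in>UNIV. \<integral>x. \<mu> x * ?d j x \<partial>lebesgue)"
      using D by (simp add: sum_distrib_left)
    also have "\<dots> = (\<Sum>j\<in>UNIV. - (\<integral>x. ?H x $ j * ((approx_ground_state \<beta> \<epsilon> R x)\<^sup>2 * (pole_field x $ j)) \<partial>lebesgue))"
      using \<mu>(1) test_approx_field unfolding has_weak_gradient_def by (intro sum.cong) blast+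
    also have "\<dots> = - (\<integral>x. (approx_ground_state \<beta> \<epsilon> R x)\<^sup>2 * (pole_field x \<bullet> ?H x) \<partial>lebesgue)"
      unfolding HU_eq[symmetric] using HU by (simp add: sum_negf)
    finally show ?thesis .
  qed
  have DD: "integrable lebesgue (\<lambda>x. \<mu> x * (\<Sum>j\<in>UNIV. ?d j x))"
    unfolding sum_distrib_left by (intro Bochner_Integration.integrable_sum D)
  have HH: "integrable lebesgue (\<lambda>x. (approx_ground_state \<beta> \<epsilon> R x)\<^sup>2 * (pole_field x \<bullet> ?H x))"
    unfolding HU_eq[symmetric] by (intro Bochner_Integration.integrable_sum HU)
  let ?w = "\<lambda>x. \<beta> * K * (\<mu> x * ((approx_ground_state \<beta> \<epsilon> R x)\<^sup>2 * pole_sum x)) - \<beta> * ((approx_ground_state \<beta> \<epsilon> R x)\<^sup>2 * (pole_field x \<bullet> ?H x))"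
  have w: "integrable lebesgue ?w"
    using S HH by simp
  have aew: "AE x in lebesgue. ?w x = \<mu> x * (potW \<mu> a n K x * (approx_ground_state \<beta> \<epsilon> R x)\<^sup>2)"
    using \<mu>(3) by eventually_elim (simp only: potW_eq)
  have "approx_ground_state \<beta> \<epsilon> R \<in> borel_measurable lborel"
    using borel_measurable_continuous_onI[OF cont] by simp
  then have mW: "(\<lambda>x. \<mu> x * (potW \<mu> a n K x * (approx_ground_state \<beta> \<epsilon> R x)\<^sup>2)) \<in> borel_measurable lebesgue"
    by (intro borel_measurable_times borel_measurable_power m\<mu> measurable_potW[OF \<mu>(1)] measurable_completion)
  show "integrable lebesgue (\<lambda>x. \<mu> x * (potW \<mu> a n K x * (approx_ground_state \<beta> \<epsilon> R x)\<^sup>2))"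
    using integrable_cong_AE_imp[OF w mW] aew by (simp add: eq_commute)
  have W_eq: "(\<integral>x. \<mu> x * (potW \<mu> a n K x * (approx_ground_state \<beta> \<epsilon> R x)\<^sup>2) \<partial>lebesgue) = (\<integral>x. ?w x \<partial>lebesgue)"
    using integral_cong_AE[OF borel_measurable_integrable[OF w] mW aew] by simp
  \<comment> \<open>The term of W with \<nabla>\<mu> appears here after integration by parts, as
    \<beta> \<mu> times the divergence.\<close>
  let ?T = "\<lambda>x. \<mu> x * (norm (grad_approx x))\<^sup>2
    + (\<beta> * K * (\<mu> x * ((approx_ground_state \<beta> \<epsilon> R x)\<^sup>2 * pole_sum x)) + \<beta> * (\<mu> x * (\<Sum>j\<in>UNIV. ?d j x)))"
  show "\<exists>T. integrable lebesgue T
      \<and> (AE x in lebesgue. T x = \<mu> x * ((approx_ground_state \<beta> \<epsilon> R x)\<^sup>2 * (\<beta>\<^sup>2 * potV a n x + (norm (cutoff_field \<epsilon> R x))\<^sup>2)))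
      \<and> (\<integral>x. \<mu> x * (norm (grad_approx x))\<^sup>2 \<partial>lebesgue)
          + (\<integral>x. \<mu> x * (potW \<mu> a n K x * (approx_ground_state \<beta> \<epsilon> R x)\<^sup>2) \<partial>lebesgue) = (\<integral>x. T x \<partial>lebesgue)"
  proof (intro exI[of _ ?T] conjI)
    show "integrable lebesgue ?T"
      using A S DD by simp
    show "(\<integral>x. \<mu> x * (norm (grad_approx x))\<^sup>2 \<partial>lebesgue)
          + (\<integral>x. \<mu> x * (potW \<mu> a n K x * (approx_ground_state \<beta> \<epsilon> R x)\<^sup>2) \<partial>lebesgue) = (\<integral>x. ?T x \<partial>lebesgue)"
      unfolding W_eq using A S DD HH D_eq by simp
    show "AE x in lebesgue. ?T x
        = \<mu> x * ((approx_ground_state \<beta> \<epsilon> R x)\<^sup>2 * (\<beta>\<^sup>2 * potV a n x + (norm (cutoff_field \<epsilon> R x))\<^sup>2))"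
      using AE_not_pole
    proof eventually_elim
      case (elim x)
      let ?U = "pole_field x" and ?Y = "cutoff_field \<epsilon> R x"
      have U: "?U \<bullet> ?U = real n * pole_sum x - potV a n x"
        using norm_pole_field_sq[OF elim] by (simp add: power2_norm_eq_inner)
      have g: "(norm (grad_approx x))\<^sup>2 = (approx_ground_state \<beta> \<epsilon> R x)\<^sup>2 * ((?Y - \<beta> *\<^sub>R ?U) \<bullet> (?Y - \<beta> *\<^sub>R ?U))"
        by (simp only: grad_approx_def norm_scaleR power_mult_distrib power2_abs
            power2_norm_eq_inner[of "?Y - \<beta> *\<^sub>R ?U"])
      have ring: "m * (p * A) + (b * k * (m * (p * s)) + b * (m * (p * (2 * B + N * s))))
          = m * p * (A + (b * k * s + b * (2 * B + N * s)))" for m p A b k s B N :: real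
        by (simp add: algebra_simps)
      have "?T x = \<mu> x * (approx_ground_state \<beta> \<epsilon> R x)\<^sup>2 * ((?Y - \<beta> *\<^sub>R ?U) \<bullet> (?Y - \<beta> *\<^sub>R ?U)
          + (\<beta> * K * pole_sum x + \<beta> * (2 * ((?Y - \<beta> *\<^sub>R ?U) \<bullet> ?U) + (real CARD('n) - 2) * pole_sum x)))"
        unfolding divergence_approx_field[OF elim] g by (rule ring)
      \<comment> \<open>With Y = \<open>cutoff_field\<close>, the mixed terms of |Y - \<beta> U|^2
        and 2 \<beta> (Y - \<beta> U) \<bullet> U cancel. Since N + K - 2 = n \<beta>, the pole sum
        then cancels against that in -\<beta>^2 |U|^2, which leaves \<beta>^2 V + |Y|^2.\<close>
      also have "(?Y - \<beta> *\<^sub>R ?U) \<bullet> (?Y - \<beta> *\<^sub>R ?U)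
          + (\<beta> * K * pole_sum x + \<beta> * (2 * ((?Y - \<beta> *\<^sub>R ?U) \<bullet> ?U) + (real CARD('n) - 2) * pole_sum x))
          = ?Y \<bullet> ?Y - \<beta>\<^sup>2 * (?U \<bullet> ?U) + \<beta> * (real CARD('n) + K - 2) * pole_sum x"
        by (simp add: inner_diff_left inner_diff_right inner_commute[of ?U ?Y] power2_eq_square algebra_simps)
      also have "\<dots> = \<beta>\<^sup>2 * potV a n x + (norm ?Y)\<^sup>2"
        unfolding n\<beta>[symmetric] U by (simp add: power2_norm_eq_inner power2_eq_square[of \<beta>] algebra_simps)
      finally show ?case
        by (simp add: mult_ac)
    qed
  qed
qed

end

end

end

section \<open>Integrability of the ground state\<close>

text \<open>Dyadic decomposition: where 2^m \<le> |x| < 2^(m+1) the integrand is at most 2^(-p m),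
  and the ball of radius 2^(m+1) has volume of order 2^(N m). The resulting geometric series has
  ratio 2^(N - p) < 1.\<close>

lemma integrable_norm_powr_tail:
  assumes p: "p > real DIM('a::euclidean_space)"
  shows "integrable lborel (\<lambda>x::'a. indicat_real {x. norm x \<ge> 1} x * norm x powr (- p))"
proof (rule integrableI_bounded)
  show "(\<lambda>x::'a. indicat_real {x. norm x \<ge> 1} x * norm x powr (- p)) \<in> borel_measurable lborel"
    by measurable
  let ?N = "real DIM('a)" and ?v = "unit_ball_vol (real DIM('a))"
  let ?b = "\<lambda>(m::nat) (x::'a). ennreal (2 powr (- p * m)) * indicator (ball 0 (2 ^ Suc m)) x"
  have pt: "ennreal (norm (indicat_real {x. norm x \<ge> 1} x * norm x powr (- p))) \<le> (\<Sum>m. ?b m x)" for x :: 'a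
  proof (cases "norm x \<ge> 1")
    case True
    define m where "m = nat \<lfloor>log 2 (norm x)\<rfloor>"
    have l0: "log 2 (norm x) \<ge> 0"
      using True by (subst zero_le_log_cancel_iff) linarith+
    then have m: "real m \<le> log 2 (norm x)" "log 2 (norm x) < real m + 1"
      unfolding m_def by linarith+
    have "2 powr real m \<le> norm x" "norm x < 2 powr (real m + 1)"
    proof -
      have "norm x > 0"
        using True by linarith
      then show "2 powr real m \<le> norm x" "norm x < 2 powr (real m + 1)"
        using m le_log_iff[of 2 "norm x" "real m"] log_less_iff[of 2 "norm x" "real m + 1"] by simp_all
    qed
    then have "(2 powr real m) powr p \<le> norm x powr p" and x: "x \<in> ball 0 (2 ^ Suc m)"
      using p by (auto intro!: powr_mono2 simp: powr_add powr_realpow)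
    moreover have "2 powr real m > 0"
      by simp
    ultimately have "norm x powr (- p) \<le> 2 powr (- p * m)"
      by (auto simp: powr_minus powr_powr mult.commute intro!: le_imp_inverse_le)
    then have "ennreal (norm (indicat_real {x. norm x \<ge> 1} x * norm x powr (- p))) \<le> ?b m x"
      using True x by (auto intro!: ennreal_leI)
    also have "\<dots> \<le> (\<Sum>m. ?b m x)"
    proof -
      have "f m \<le> suminf f" for f :: "nat \<Rightarrow> ennreal"
        using sum_le_suminf[OF summableI, of "{m}" f] by simp
      then show ?thesis .
    qed
    finally show ?thesis .
  qed simp
  have summable: "summable (\<lambda>m. ?v * 2 powr ?N * (2 powr (?N - p)) ^ m)"
    using p by (intro summable_mult summable_geometric) (auto simp: powr_less_one)
  have "(\<integral>\<^sup>+x. ennreal (norm (indicat_real {x. norm x \<ge> 1} x * norm x powr (- p))) \<partial>(lborel :: 'a measure))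
      \<le> (\<integral>\<^sup>+x. (\<Sum>m. ?b m x) \<partial>lborel)"
    by (rule nn_integral_mono) (rule pt)
  also have "\<dots> = (\<Sum>m. \<integral>\<^sup>+x. ?b m x \<partial>lborel)"
    by (intro nn_integral_suminf borel_measurable_times_ennreal borel_measurable_const
        borel_measurable_indicator) (simp only: sets_lborel borel_open open_ball)
  also have "\<dots> = (\<Sum>m. ennreal (?v * 2 powr ?N * (2 powr (?N - p)) ^ m))"
  proof (rule suminf_cong)
    fix m
    have e: "((2::real) ^ Suc m) ^ DIM('a) = 2 powr (?N * (real m + 1))"
    proof -
      have "2 powr (?N * (real m + 1)) = 2 powr real (Suc m * DIM('a))"
        by (simp add: algebra_simps)
      then show ?thesis
        by (simp only: powr_realpow zero_less_numeral power_mult)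
    qed
    have "(\<integral>\<^sup>+x. ?b m x \<partial>lborel) = ennreal (2 powr (- p * m)) * emeasure lborel (ball (0::'a) (2 ^ Suc m))"
      by (simp add: nn_integral_cmult_indicator)
    also have "\<dots> = ennreal (2 powr (- p * m) * (?v * 2 powr (?N * (real m + 1))))"
    proof -
      have "(0::real) \<le> 2 ^ Suc m"
        by simp
      then have "emeasure lborel (ball (0::'a) (2 ^ Suc m)) = ennreal (?v * 2 powr (?N * (real m + 1)))"
        unfolding e[symmetric] by (rule emeasure_ball)
      then show ?thesis
        by (simp only: ennreal_mult powr_ge_zero)
          (simp add: ennreal_mult)
    qed
    also have "2 powr (- p * m) * (?v * 2 powr (?N * (real m + 1))) = ?v * 2 powr ?N * (2 powr (?N - p)) ^ m"
      by (simp add: powr_realpow[symmetric] powr_powr powr_add[symmetric] algebra_simps)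
    finally show "(\<integral>\<^sup>+x. ?b m x \<partial>lborel) = ennreal (?v * 2 powr ?N * (2 powr (?N - p)) ^ m)" .
  qed
  also have "\<dots> < \<infinity>"
    using summable by (subst suminf_ennreal2) (auto intro!: mult_nonneg_nonneg)
  finally show "(\<integral>\<^sup>+x. ennreal (norm (indicat_real {x. norm x \<ge> 1} x * norm x powr (- p))) \<partial>(lborel :: 'a measure)) < \<infinity>" .
qed

lemma powr_sq_div_sq:
  fixes t :: real
  assumes "t > 0"
  shows "(t powr (- s))\<^sup>2 / t\<^sup>2 = t powr (- (2 * s + 2))"
proof -
  have "(t powr (- s))\<^sup>2 = t powr (- (2 * s))"
    by (simp add: power2_eq_square powr_add[symmetric])
  moreover have "t\<^sup>2 = t powr 2"
    using assms by simp
  ultimately have "(t powr (- s))\<^sup>2 / t\<^sup>2 = t powr (- (2 * s) - 2)"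
    by (simp only: powr_diff)
  then show ?thesis
    by simp
qed

text \<open>Vanishes at the poles, because \<open>0 powr a = 0\<close>.\<close>
definition ground_state :: "(nat \<Rightarrow> real^'n) \<Rightarrow> nat \<Rightarrow> real \<Rightarrow> real^'n \<Rightarrow> real" where
  "ground_state a n \<beta> x = (\<Prod>i\<in>{1..n}. norm (x - a i) powr (- \<beta>))"

lemma ground_state_nonneg: "0 \<le> ground_state a n \<beta> x"
  unfolding ground_state_def by (intro prod_nonneg) auto

lemma measurable_ground_state [measurable]: "ground_state a n \<beta> \<in> borel_measurable borel"
  unfolding ground_state_def by measurable

lemma measurable_pole_sum [measurable]: "pole_sum a n \<in> borel_measurable borel"
  unfolding pole_sum_def by measurable

text \<open>The pole nearest to \<open>x\<close> contributes the singularity; all others are at distance at least \<open>r\<close>,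
  half the minimal distance between two poles.\<close>
lemma ground_state_energy_near_poles:
  assumes n: "n \<ge> 1" and inj: "inj_on a {1..n}" and \<beta>: "\<beta> \<ge> 0"
  shows "\<exists>A. \<forall>x. (ground_state a n \<beta> x)\<^sup>2 * pole_sum a n x
    \<le> A * (\<Sum>i\<in>{1..n}. 1 / norm (x - a i) powr (2 * \<beta> + 2))"
proof -
  define P where "P = {(i, j). i \<in> {1..n} \<and> j \<in> {1..n} \<and> i \<noteq> j}"
  have "finite P"
    by (rule finite_subset[of _ "{1..n} \<times> {1..n}"]) (auto simp: P_def)
  obtain r where r: "r > 0" "\<And>i j. i \<in> {1..n} \<Longrightarrow> j \<in> {1..n} \<Longrightarrow> i \<noteq> j \<Longrightarrow> 2 * r \<le> norm (a i - a j)"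
  proof (cases "P = {}")
    case True
    then show ?thesis by (intro that[of 1]) (auto simp: P_def)
  next
    case False
    define m where "m = Min ((\<lambda>(i, j). norm (a i - a j)) ` P)"
    have "m \<in> (\<lambda>(i, j). norm (a i - a j)) ` P"
      unfolding m_def using \<open>finite P\<close> False by (intro Min_in) auto
    then obtain i j where ij: "(i, j) \<in> P" "m = norm (a i - a j)"
      by auto
    then have "a i \<noteq> a j"
      using inj by (auto simp: P_def inj_on_eq_iff)
    then have "m > 0"
      using ij(2) by simp
    moreover have "m \<le> norm (a i - a j)" if "i \<in> {1..n}" "j \<in> {1..n}" "i \<noteq> j" for i j
      unfolding m_def using \<open>finite P\<close> that by (intro Min_le) (force simp: P_def)+
    ultimately show ?thesis by (intro that[of "m / 2"]) auto
  qed
  \<comment> \<open>Each of the n - 1 distant factors is at most r^(-\<beta>) before squaring; the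
    factor n bounds the pole sum by n times its largest term.\<close>
  define A where "A = (r powr (- \<beta>)) ^ (2 * (n - 1)) * real n"
  have "(ground_state a n \<beta> x)\<^sup>2 * pole_sum a n x
      \<le> A * (\<Sum>i\<in>{1..n}. 1 / norm (x - a i) powr (2 * \<beta> + 2))" for x
  proof (cases "x \<in> a ` {1..n}")
    case True
    then have "ground_state a n \<beta> x = 0"
      unfolding ground_state_def by (intro prod_zero) (auto intro!: bexI)
    then show ?thesis
      by (simp add: A_def sum_nonneg)
  next
    case False
    let ?d = "\<lambda>i. norm (x - a i)"
    have d: "?d i > 0" if "i \<in> {1..n}" for i
      using False that by auto
    obtain m where m: "m \<in> {1..n}" "\<And>j. j \<in> {1..n} \<Longrightarrow> ?d m \<le> ?d j"
      using ex_min_if_finite[of "?d ` {1..n}"] n by (fastforce simp: not_less)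
    \<comment> \<open>If \<open>m\<close> is a nearest pole, then 2 r \<le> |a_m - a_j| \<le> |x -
      a_m| + |x - a_j| \<le> 2 |x - a_j|.\<close>
    have dr: "r \<le> ?d j" if "j \<in> {1..n} - {m}" for j
    proof -
      have "2 * r \<le> norm (a m - a j)"
        using r(2)[OF m(1)] that by auto
      also have "\<dots> \<le> ?d m + ?d j"
        using norm_triangle_ineq4[of "x - a j" "x - a m"] by simp
      finally show ?thesis
        using m(2)[of j] that by auto
    qed
    have "ground_state a n \<beta> x = ?d m powr (- \<beta>) * (\<Prod>j\<in>{1..n} - {m}. ?d j powr (- \<beta>))"
      unfolding ground_state_def using m(1) by (simp add: prod.remove)
    also have "\<dots> \<le> ?d m powr (- \<beta>) * (\<Prod>j\<in>{1..n} - {m}. r powr (- \<beta>))"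
    proof (intro mult_left_mono prod_mono conjI)
      show "?d j powr (- \<beta>) \<le> r powr (- \<beta>)" if "j \<in> {1..n} - {m}" for j
        using dr[OF that] r(1) \<beta> by (intro powr_mono2') auto
    qed auto
    also have "\<dots> = ?d m powr (- \<beta>) * (r powr (- \<beta>)) ^ (n - 1)"
      using m(1) by (simp add: card_Diff_singleton)
    finally have "(ground_state a n \<beta> x)\<^sup>2 \<le> (?d m powr (- \<beta>) * (r powr (- \<beta>)) ^ (n - 1))\<^sup>2"
      by (intro power_mono ground_state_nonneg)
    moreover have "pole_sum a n x \<le> (\<Sum>i\<in>{1..n}. 1 / (?d m)\<^sup>2)"
      unfolding pole_sum_def
    proof (rule sum_mono)
      fix i assume i: "i \<in> {1..n}"
      show "1 / (?d i)\<^sup>2 \<le> 1 / (?d m)\<^sup>2"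
        using d[OF m(1)] d[OF i] m(2)[OF i]
        by (intro divide_left_mono power_mono mult_pos_pos zero_less_power) linarith+
    qed
    ultimately have "(ground_state a n \<beta> x)\<^sup>2 * pole_sum a n x
        \<le> (?d m powr (- \<beta>) * (r powr (- \<beta>)) ^ (n - 1))\<^sup>2 * (real n / (?d m)\<^sup>2)"
      by (intro mult_mono pole_sum_nonneg) auto
    also have "\<dots> = A * (1 / ?d m powr (2 * \<beta> + 2))"
    proof -
      have "(?d m powr (- \<beta>))\<^sup>2 / (?d m)\<^sup>2 = 1 / ?d m powr (2 * \<beta> + 2)"
        using powr_sq_div_sq[OF d[OF m(1)]] by (simp only: powr_minus_divide)
      moreover have "(?d m powr (- \<beta>) * (r powr (- \<beta>)) ^ (n - 1))\<^sup>2 * (real n / (?d m)\<^sup>2)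
          = A * ((?d m powr (- \<beta>))\<^sup>2 / (?d m)\<^sup>2)"
        by (simp add: A_def power_mult_distrib power_mult[symmetric] mult.commute[of 2])
      ultimately show ?thesis by simp
    qed
    also have "\<dots> \<le> A * (\<Sum>i\<in>{1..n}. 1 / ?d i powr (2 * \<beta> + 2))"
      using m(1) by (intro mult_left_mono member_le_sum) (auto simp: A_def)
    finally show ?thesis .
  qed
  then show ?thesis by blast
qed

text \<open>If |x| > 2 M, every pole is at distance at least |x|/2, so each factor may be estimated
  by a power of |x|/2.\<close>

lemma ground_state_energy_at_infinity:
  assumes \<beta>: "\<beta> \<ge> 0" and M: "\<And>i. i \<in> {1..n} \<Longrightarrow> norm (a i) \<le> M" and x: "norm x > 2 * M" "norm x \<ge> 1"
  shows "(ground_state a n \<beta> x)\<^sup>2 * pole_sum a n x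
    \<le> 2 powr (2 * real n * \<beta> + 2) * real n * norm x powr (- (2 * real n * \<beta> + 2))"
proof -
  let ?d = "\<lambda>i. norm (x - a i)" and ?h = "norm x / 2"
  have h: "?h > 0"
    using x(2) by linarith
  have d: "?h \<le> ?d i" if "i \<in> {1..n}" for i
    using norm_triangle_ineq2[of x "a i"] M[OF that] x by linarith
  have "ground_state a n \<beta> x \<le> (\<Prod>i\<in>{1..n}. ?h powr (- \<beta>))"
    unfolding ground_state_def using d h \<beta> by (intro prod_mono conjI powr_mono2') auto
  also have "\<dots> = ?h powr (- (real n * \<beta>))"
    using h by (simp add: powr_power mult.commute)
  finally have "(ground_state a n \<beta> x)\<^sup>2 \<le> (?h powr (- (real n * \<beta>)))\<^sup>2"
    by (intro power_mono ground_state_nonneg)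
  moreover have "pole_sum a n x \<le> (\<Sum>i\<in>{1..n}. 1 / ?h\<^sup>2)"
    unfolding pole_sum_def
  proof (intro sum_mono)
    fix i assume "i \<in> {1..n}"
    then show "1 / (?d i)\<^sup>2 \<le> 1 / ?h\<^sup>2"
      using d[of i] h by (intro divide_left_mono power_mono mult_pos_pos zero_less_power) linarith+
  qed
  ultimately have "(ground_state a n \<beta> x)\<^sup>2 * pole_sum a n x
      \<le> (?h powr (- (real n * \<beta>)))\<^sup>2 * (real n * (1 / ?h\<^sup>2))"
    by (intro mult_mono pole_sum_nonneg) auto
  also have "\<dots> = real n * ?h powr (- (2 * real n * \<beta> + 2))"
  proof -
    have "u * (v * (1 / w)) = v * (u / w)" for u v w :: real
      by simp
    then show ?thesis
      by (simp only: powr_sq_div_sq[OF h] mult.assoc)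
  qed
  also have "?h powr (- (2 * real n * \<beta> + 2)) = 2 powr (2 * real n * \<beta> + 2) * norm x powr (- (2 * real n * \<beta> + 2))"
  proof -
    have "(t / 2) powr (- s) = 2 powr s * t powr (- s)" if "t \<ge> 0" for t s :: real
    proof -
      have "(t / 2) powr (- s) = t powr (- s) / 2 powr (- s)"
        using that by (intro powr_divide)
      also have "\<dots> = 2 powr s * t powr (- s)"
        by (simp only: powr_minus[of 2] divide_inverse inverse_inverse_eq mult.commute)
      finally show ?thesis .
    qed
    from this[OF norm_ge_zero] show ?thesis .
  qed
  finally show ?thesis by (simp add: mult_ac)
qed

text \<open>On a ball the bound near the poles reduces the claim to \<open>poles\<close>. Outside
  it, the decay of \<mu> and that of the ground state combine to the exponent \<gamma> + 2 n \<beta>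
  + 2, which exceeds the dimension.\<close>

lemma integrable_ground_state_energy:
  fixes a :: "nat \<Rightarrow> real^'n"
  assumes n: "n \<ge> 1" and inj: "inj_on a {1..n}" and \<beta>: "\<beta> \<ge> 0"
    and \<mu>: "\<mu> \<in> borel_measurable lebesgue" "\<And>x. \<mu> x \<ge> 0"
    and poles: "\<And>i. i \<in> {1..n} \<Longrightarrow> locally_integrable (\<lambda>x. \<mu> x / norm (x - a i) powr (2 * \<beta> + 2))"
    and decay: "\<And>x. norm x > M \<Longrightarrow> \<mu> x \<le> C / norm x powr \<gamma>"
    and M: "\<And>i. i \<in> {1..n} \<Longrightarrow> norm (a i) \<le> M"
    and \<gamma>: "\<gamma> + 2 * real n * \<beta> + 2 > real CARD('n)"
  shows "integrable lebesgue (\<lambda>x. \<mu> x * ((ground_state a n \<beta> x)\<^sup>2 * pole_sum a n x))"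
proof -
  obtain A where A: "\<And>x. (ground_state a n \<beta> x)\<^sup>2 * pole_sum a n x
      \<le> A * (\<Sum>i\<in>{1..n}. 1 / norm (x - a i) powr (2 * \<beta> + 2))"
    using ground_state_energy_near_poles[OF n inj \<beta>] by blast
  define p where "p = \<gamma> + 2 * real n * \<beta> + 2"
  define B where "B = 2 powr (2 * real n * \<beta> + 2) * real n"
  have M0: "M \<ge> 0"
    using order_trans[OF norm_ge_zero M[of 1]] n by simp
  \<comment> \<open>Outside this ball |x| exceeds 2 M and 1, so the estimate at infinity, the decay
    of \<mu> and the tail integral all apply.\<close>
  define L where "L = 2 * M + 1"
  let ?near = "\<lambda>x. A * (\<Sum>i\<in>{1..n}. indicat_real (cball 0 L) x *\<^sub>R (\<mu> x / norm (x - a i) powr (2 * \<beta> + 2)))"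
  let ?far = "\<lambda>x::real^'n. \<bar>C\<bar> * B * (indicat_real {x. norm x \<ge> 1} x * norm x powr (- p))"
  show ?thesis
  proof (rule Bochner_Integration.integrable_bound)
    have "integrable lebesgue ?near"
      by (intro integrable_mult_right Bochner_Integration.integrable_sum
          integrable_cball_of_locally_integrable poles)
    moreover have "integrable lebesgue ?far"
      using integrable_norm_powr_tail[where 'a = "real^'n", of p] \<gamma>
      by (simp add: p_def integrable_completion)
    ultimately show "integrable lebesgue (\<lambda>x. norm (?near x) + ?far x)"
      by (intro Bochner_Integration.integrable_add integrable_norm)
    have "(\<lambda>x. (ground_state a n \<beta> x)\<^sup>2 * pole_sum a n x) \<in> borel_measurable lborel"
      by measurable
    then show "(\<lambda>x. \<mu> x * ((ground_state a n \<beta> x)\<^sup>2 * pole_sum a n x)) \<in> borel_measurable lebesgue"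
      by (intro borel_measurable_times[OF \<mu>(1)] measurable_completion)
    show "AE x in lebesgue. norm (\<mu> x * ((ground_state a n \<beta> x)\<^sup>2 * pole_sum a n x))
        \<le> norm (norm (?near x) + ?far x)"
    proof (intro always_eventually allI)
      fix x
      let ?e = "(ground_state a n \<beta> x)\<^sup>2 * pole_sum a n x"
      have e: "0 \<le> ?e"
        by (intro mult_nonneg_nonneg pole_sum_nonneg) auto
      have B0: "B \<ge> 0"
        by (simp add: B_def)
      have far0: "?far x \<ge> 0"
        using B0 by simp
      have "\<mu> x * ?e \<le> norm (?near x) + ?far x"
      proof (cases "x \<in> cball 0 L")
        case True
        have "\<mu> x * ?e \<le> \<mu> x * (A * (\<Sum>i\<in>{1..n}. 1 / norm (x - a i) powr (2 * \<beta> + 2)))"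
          by (intro mult_left_mono A \<mu>(2))
        also have "\<dots> = ?near x"
          using True by (simp add: sum_distrib_left mult_ac)
        also have "\<dots> \<le> norm (?near x) + ?far x"
          using far0 by simp
        finally show ?thesis .
      next
        case False
        then have x: "norm x > 2 * M" "norm x \<ge> 1" "norm x > M"
          using M0 by (auto simp: L_def)
        have "\<mu> x * ?e \<le> (\<bar>C\<bar> / norm x powr \<gamma>) * (B * norm x powr (- (2 * real n * \<beta> + 2)))"
        proof (rule mult_mono)
          have "C / norm x powr \<gamma> \<le> \<bar>C\<bar> / norm x powr \<gamma>"
            by (intro divide_right_mono) auto
          then show "\<mu> x \<le> \<bar>C\<bar> / norm x powr \<gamma>"
            using decay[OF x(3)] by linarith
          show "?e \<le> B * norm x powr (- (2 * real n * \<beta> + 2))"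
            unfolding B_def by (rule ground_state_energy_at_infinity[OF \<beta> M x(1,2)])
        qed (use e in auto)
        also have "\<dots> = ?far x"
        proof -
          have "- p = - \<gamma> + - (2 * real n * \<beta> + 2)"
            by (simp add: p_def)
          then have "norm x powr (- p) = norm x powr (- \<gamma>) * norm x powr (- (2 * real n * \<beta> + 2))"
            by (simp only: powr_add)
          then show ?thesis
            using x(2) by (simp add: powr_minus[of _ \<gamma>] divide_inverse)
        qed
        finally show ?thesis by simp
      qed
      moreover have "0 \<le> \<mu> x * ?e"
        by (intro mult_nonneg_nonneg \<mu>(2) e)
      moreover have "norm u \<le> norm w" if "u \<le> w" "0 \<le> u" for u w :: real
        using that by simp
      ultimately show "norm (\<mu> x * ?e) \<le> norm (norm (?near x) + ?far x)"
        by blast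
    qed
  qed
qed

section \<open>Uniform bounds and limits of the cutoffs\<close>

lemma measurable_potV [measurable]: "potV a n \<in> borel_measurable borel"
  unfolding potV_def[abs_def] by measurable

lemma approx_ground_state_nonneg: "0 \<le> approx_ground_state a n \<beta> \<epsilon> R x"
  unfolding approx_ground_state_def by (intro mult_nonneg_nonneg prod_nonneg) auto

lemma approx_ground_state_eq:
  assumes "x \<notin> a ` {1..n}" "norm x < R"
  shows "approx_ground_state a n \<beta> \<epsilon> R x = ground_state a n \<beta> x
    * ((\<Prod>i\<in>{1..n}. exp (- \<epsilon> / (norm (x - a i))\<^sup>2)) * exp (- R\<^sup>2 / (R\<^sup>2 - (norm x)\<^sup>2)))"
proof -
  have "flat (\<beta> / 2) \<epsilon> ((norm (x - a i))\<^sup>2) = norm (x - a i) powr (- \<beta>) * exp (- \<epsilon> / (norm (x - a i))\<^sup>2)"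
    if "i \<in> {1..n}" for i
  proof -
    have d: "norm (x - a i) > 0"
      using assms(1) that by auto
    have "(t\<^sup>2) powr (- (\<beta> / 2)) = t powr (- \<beta>)" if "t > 0" for t :: real
    proof -
      have "t\<^sup>2 = t powr 2"
        using that by simp
      then show ?thesis
        by (simp only: powr_powr) simp
    qed
    from this[OF d] show ?thesis
      using d by (simp add: flat_def)
  qed
  then have "(\<Prod>i\<in>{1..n}. flat (\<beta> / 2) \<epsilon> ((norm (x - a i))\<^sup>2))
      = ground_state a n \<beta> x * (\<Prod>i\<in>{1..n}. exp (- \<epsilon> / (norm (x - a i))\<^sup>2))"
    by (simp add: ground_state_def prod.distrib)
  moreover have "(norm x)\<^sup>2 < R\<^sup>2"
    using assms(2) by (intro power_strict_mono) auto
  then have "flat 0 (R\<^sup>2) (R\<^sup>2 - (norm x)\<^sup>2) = exp (- R\<^sup>2 / (R\<^sup>2 - (norm x)\<^sup>2))"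
    by (simp add: flat_def)
  ultimately show ?thesis
    by (simp only: approx_ground_state_def mult.assoc)
qed

lemma approx_ground_state_outside:
  assumes "R > 0" "norm x \<ge> R"
  shows "approx_ground_state a n \<beta> \<epsilon> R x = 0"
proof -
  have "R\<^sup>2 \<le> (norm x)\<^sup>2"
    using assms by (intro power_mono) auto
  then show ?thesis
    by (simp add: approx_ground_state_def flat_eq_0_iff)
qed

lemma prod_exp_le_1:
  assumes "\<epsilon> > 0"
  shows "(\<Prod>i\<in>A. exp (- \<epsilon> / (norm (x - a i))\<^sup>2)) \<le> 1"
  using assms by (intro prod_le_1) auto

lemma approx_ground_state_le:
  assumes "\<epsilon> > 0" "R > 0" "x \<notin> a ` {1..n}"
  shows "approx_ground_state a n \<beta> \<epsilon> R x \<le> ground_state a n \<beta> x"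
proof (cases "norm x < R")
  case True
  then have "(norm x)\<^sup>2 < R\<^sup>2"
    by (intro power_strict_mono) auto
  then have "exp (- R\<^sup>2 / (R\<^sup>2 - (norm x)\<^sup>2)) \<le> 1"
    by simp
  then have "(\<Prod>i\<in>{1..n}. exp (- \<epsilon> / (norm (x - a i))\<^sup>2)) * exp (- R\<^sup>2 / (R\<^sup>2 - (norm x)\<^sup>2)) \<le> 1"
    using prod_exp_le_1[OF assms(1)] by (intro mult_le_one) auto
  then show ?thesis
    unfolding approx_ground_state_eq[OF assms(3) True]
    by (intro mult_right_le_one_le ground_state_nonneg mult_nonneg_nonneg prod_nonneg) auto
next
  case False
  then have "approx_ground_state a n \<beta> \<epsilon> R x = 0"
    by (intro approx_ground_state_outside assms) simp
  then show ?thesis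
    using ground_state_nonneg[of a n \<beta> x] by simp
qed

lemma t_exp_le: "t * exp (- t) \<le> (1::real)"
proof -
  have "t \<le> exp t"
    using exp_ge_add_one_self[of t] by linarith
  then show ?thesis
    by (simp add: exp_minus field_simps)
qed

lemma t_sq_exp_le: "t \<ge> 0 \<Longrightarrow> t\<^sup>2 * exp (- t) \<le> (2::real)"
  using exp_lower_Taylor_quadratic[of t] by (simp add: exp_minus field_simps)

text \<open>The constant is independent of \<epsilon> and R, as dominated convergence requires. With
  t = \<epsilon>/|x - a_i|^2, the bound t exp(-t) \<le> 1 turns each pole term into 2/|x - a_i|. The
  outer cutoff costs 4 (1 + |a_1|)/|x - a_1|, and 2 + 4 (1 + |a_1|) = 6 + 4 |a_1|.\<close>

lemma approx_cutoff_field_le: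
  fixes a :: "nat \<Rightarrow> real^'n"
  assumes n: "n \<ge> 1" and \<epsilon>: "\<epsilon> > 0" and R: "R \<ge> 1" and x: "x \<notin> a ` {1..n}"
  shows "(approx_ground_state a n \<beta> \<epsilon> R x)\<^sup>2 * (norm (cutoff_field a n \<epsilon> R x))\<^sup>2
    \<le> (6 + 4 * norm (a 1))\<^sup>2 * real n * ((ground_state a n \<beta> x)\<^sup>2 * pole_sum a n x)"
proof (cases "norm x < R")
  case False
  then have "approx_ground_state a n \<beta> \<epsilon> R x = 0"
    using R by (intro approx_ground_state_outside) auto
  then show ?thesis
    by (simp add: pole_sum_nonneg)
next
  case True
  let ?d = "\<lambda>i. norm (x - a i)" and ?h = "ground_state a n \<beta> x"
  define E where "E = (\<Prod>i\<in>{1..n}. exp (- \<epsilon> / (?d i)\<^sup>2))"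
  \<comment> \<open>The outer cutoff is exp(-s) and its logarithmic gradient has length 2 |x| s^2 /
    R^2, so the bound s^2 exp(-s) \<le> 2 applies.\<close>
  define s where "s = R\<^sup>2 / (R\<^sup>2 - (norm x)\<^sup>2)"
  have E0: "0 \<le> E" "E \<le> 1"
    unfolding E_def by (simp add: prod_nonneg, rule prod_exp_le_1[OF \<epsilon>])
  have xR: "(norm x)\<^sup>2 < R\<^sup>2"
    using True by (intro power_strict_mono) auto
  have s: "s > 0"
    unfolding s_def using xR R by (intro divide_pos_pos) auto
  have d: "?d i > 0" if "i \<in> {1..n}" for i
    using x that by auto
  have \<phi>: "approx_ground_state a n \<beta> \<epsilon> R x = ?h * (E * exp (- s))"
    using approx_ground_state_eq[OF x True] by (simp add: E_def s_def)
  have term1: "E * exp (- s) * norm ((2 * \<epsilon> / ((?d i)\<^sup>2)\<^sup>2) *\<^sub>R (x - a i)) \<le> 2 * (1 / ?d i)" if i: "i \<in> {1..n}" for i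
  proof -
    have "E = exp (- \<epsilon> / (?d i)\<^sup>2) * (\<Prod>j\<in>{1..n} - {i}. exp (- \<epsilon> / (?d j)\<^sup>2))"
      unfolding E_def using i by (simp add: prod.remove)
    also have "\<dots> \<le> exp (- \<epsilon> / (?d i)\<^sup>2)"
      using prod_exp_le_1[OF \<epsilon>] by (intro mult_right_le_one_le prod_nonneg) auto
    finally have "E * exp (- s) \<le> exp (- (\<epsilon> / (?d i)\<^sup>2)) * 1"
      using s E0 by (intro mult_mono) auto
    moreover have "norm ((2 * \<epsilon> / ((?d i)\<^sup>2)\<^sup>2) *\<^sub>R (x - a i)) = 2 * (\<epsilon> / (?d i)\<^sup>2) * (1 / ?d i)"
      using d[OF i] \<epsilon> unfolding norm_scaleR by (simp add: power2_eq_square divide_inverse)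
    ultimately have "E * exp (- s) * norm ((2 * \<epsilon> / ((?d i)\<^sup>2)\<^sup>2) *\<^sub>R (x - a i))
        \<le> exp (- (\<epsilon> / (?d i)\<^sup>2)) * (2 * (\<epsilon> / (?d i)\<^sup>2) * (1 / ?d i))"
      using d[OF i] \<epsilon> by (simp only: mult_1_right) (intro mult_right_mono, auto)
    also have "\<dots> = 2 * (1 / ?d i) * ((\<epsilon> / (?d i)\<^sup>2) * exp (- (\<epsilon> / (?d i)\<^sup>2)))"
      by (simp only: mult_ac)
    also have "\<dots> \<le> 2 * (1 / ?d i) * 1"
      using d[OF i] by (intro mult_left_mono t_exp_le) auto
    finally show ?thesis by simp
  qed
  have term2: "E * exp (- s) * norm ((2 * R\<^sup>2 / (R\<^sup>2 - (norm x)\<^sup>2)\<^sup>2) *\<^sub>R x) \<le> 4 * (1 + norm (a 1)) * (1 / ?d 1)"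
  proof -
    have "norm ((2 * R\<^sup>2 / (R\<^sup>2 - (norm x)\<^sup>2)\<^sup>2) *\<^sub>R x) = 2 * (norm x / R\<^sup>2) * s\<^sup>2"
    proof -
      have e: "s\<^sup>2 / R\<^sup>2 = R\<^sup>2 / (R\<^sup>2 - (norm x)\<^sup>2)\<^sup>2"
      proof -
        have "(u / w)\<^sup>2 / u = u / w\<^sup>2" if "u \<noteq> 0" for u w :: real
          using that by (simp add: power2_eq_square)
        moreover have "R\<^sup>2 \<noteq> 0"
          using R by simp
        ultimately show ?thesis
          unfolding s_def by blast
      qed
      have "norm ((2 * R\<^sup>2 / (R\<^sup>2 - (norm x)\<^sup>2)\<^sup>2) *\<^sub>R x)
          = 2 * (R\<^sup>2 / (R\<^sup>2 - (norm x)\<^sup>2)\<^sup>2) * norm x"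
        by simp
      then show ?thesis
        unfolding e[symmetric] by simp
    qed
    then have "E * exp (- s) * norm ((2 * R\<^sup>2 / (R\<^sup>2 - (norm x)\<^sup>2)\<^sup>2) *\<^sub>R x)
        = E * (2 * (norm x / R\<^sup>2) * (s\<^sup>2 * exp (- s)))"
      by (simp only: mult_ac)
    also have "\<dots> \<le> 1 * (2 * (norm x / R\<^sup>2) * 2)"
      using s E0 by (intro mult_mono mult_left_mono t_sq_exp_le) auto
    also have "\<dots> \<le> 4 * (1 / R)"
      using R True by (simp add: power2_eq_square field_simps)
    \<comment> \<open>Any single pole would do to express 1/R by the pole sum; the first is taken.
      Here R \<ge> 1 gives |x - a_1| \<le> R (1 + |a_1|).\<close>
    also have "1 / R \<le> (1 + norm (a 1)) * (1 / ?d 1)"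
    proof -
      have "?d 1 \<le> norm x + norm (a 1)"
        by (rule norm_triangle_ineq4)
      also have "\<dots> \<le> R + R * norm (a 1)"
        using True R by (intro add_mono) (auto simp: mult_le_cancel_right1)
      finally have "?d 1 \<le> R * (1 + norm (a 1))"
        by (simp add: algebra_simps)
      then show ?thesis
        using d[of 1] n R by (simp add: field_simps)
    qed
    finally show ?thesis by simp
  qed
  have "E * exp (- s) * norm (cutoff_field a n \<epsilon> R x)
      \<le> E * exp (- s) * ((\<Sum>i\<in>{1..n}. norm ((2 * \<epsilon> / ((?d i)\<^sup>2)\<^sup>2) *\<^sub>R (x - a i)))
        + norm ((2 * R\<^sup>2 / (R\<^sup>2 - (norm x)\<^sup>2)\<^sup>2) *\<^sub>R x))"
    unfolding cutoff_field_def using E0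
    by (intro mult_left_mono order_trans[OF norm_triangle_ineq4] add_mono norm_sum) auto
  also have "\<dots> = (\<Sum>i\<in>{1..n}. E * exp (- s) * norm ((2 * \<epsilon> / ((?d i)\<^sup>2)\<^sup>2) *\<^sub>R (x - a i)))
        + E * exp (- s) * norm ((2 * R\<^sup>2 / (R\<^sup>2 - (norm x)\<^sup>2)\<^sup>2) *\<^sub>R x)"
    by (simp only: distrib_left sum_distrib_left)
  also have "\<dots> \<le> (\<Sum>i\<in>{1..n}. 2 * (1 / ?d i)) + 4 * (1 + norm (a 1)) * (\<Sum>i\<in>{1..n}. 1 / ?d i)"
  proof (intro add_mono sum_mono term1)
    have "1 / ?d 1 \<le> (\<Sum>i\<in>{1..n}. 1 / ?d i)"
      using n by (intro member_le_sum[of 1]) auto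
    then show "E * exp (- s) * norm ((2 * R\<^sup>2 / (R\<^sup>2 - (norm x)\<^sup>2)\<^sup>2) *\<^sub>R x)
        \<le> 4 * (1 + norm (a 1)) * (\<Sum>i\<in>{1..n}. 1 / ?d i)"
      by (intro order_trans[OF term2] mult_left_mono) auto
  qed
  also have "\<dots> = (6 + 4 * norm (a 1)) * (\<Sum>i\<in>{1..n}. 1 / ?d i)"
    by (simp only: sum_distrib_left[symmetric]) (simp add: algebra_simps)
  finally have "(E * exp (- s) * norm (cutoff_field a n \<epsilon> R x))\<^sup>2 \<le> ((6 + 4 * norm (a 1)) * (\<Sum>i\<in>{1..n}. 1 / ?d i))\<^sup>2"
    using E0 by (intro power_mono) auto
  also have "\<dots> = (6 + 4 * norm (a 1))\<^sup>2 * (\<Sum>i\<in>{1..n}. 1 / ?d i)\<^sup>2"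
    by (rule power_mult_distrib)
  \<comment> \<open>By Cauchy-Schwarz, the square of the sum of reciprocal distances is at most n
    times the pole sum.\<close>
  also have "\<dots> \<le> (6 + 4 * norm (a 1))\<^sup>2 * (pole_sum a n x * real n)"
    using sum_squared_le_sum_of_squares[of "\<lambda>i. 1 / ?d i" "{1..n}"]
    by (intro mult_left_mono) (simp_all add: pole_sum_def power_divide)
  finally have "?h\<^sup>2 * (E * exp (- s) * norm (cutoff_field a n \<epsilon> R x))\<^sup>2
      \<le> ?h\<^sup>2 * ((6 + 4 * norm (a 1))\<^sup>2 * (pole_sum a n x * real n))"
    by (intro mult_left_mono) auto
  then show ?thesis
    unfolding \<phi> by (simp only: power_mult_distrib mult_ac)
qed

lemma approx_ground_state_tendsto:
  assumes x: "x \<notin> a ` {1..n}"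
  shows "(\<lambda>k. approx_ground_state a n \<beta> (1 / real (Suc k)) (real (Suc k)) x)
    \<longlonglongrightarrow> ground_state a n \<beta> x * exp (- 1)"
proof -
  have lim: "(\<lambda>k. - (1 / real (Suc k)) / c) \<longlonglongrightarrow> - 0 / c" if "c \<noteq> 0" for c
    using that by (intro tendsto_intros LIMSEQ_inverse_real_of_nat[unfolded inverse_eq_divide])
  have "(\<lambda>k. \<Prod>i\<in>{1..n}. exp (- (1 / real (Suc k)) / (norm (x - a i))\<^sup>2))
      \<longlonglongrightarrow> (\<Prod>i\<in>{1..n}. exp (- 0 / (norm (x - a i))\<^sup>2))"
    by (intro tendsto_prod tendsto_exp lim) (use x in auto)
  then have 1: "(\<lambda>k. \<Prod>i\<in>{1..n}. exp (- (1 / real (Suc k)) / (norm (x - a i))\<^sup>2)) \<longlonglongrightarrow> 1"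
    by simp
  \<comment> \<open>The outer cutoff tends to exp(-1), not to 1: its exponent is scaled by R^2,
    which makes its gradient of order 1/R.\<close>
  have "(\<lambda>k. - (real (Suc k))\<^sup>2 / ((real (Suc k))\<^sup>2 - c)) \<longlonglongrightarrow> - 1" for c
    by real_asymp
  then have 2: "(\<lambda>k. exp (- (real (Suc k))\<^sup>2 / ((real (Suc k))\<^sup>2 - (norm x)\<^sup>2))) \<longlonglongrightarrow> exp (- 1)"
    by (rule tendsto_exp)
  obtain N where N: "norm x < real N"
    using reals_Archimedean2 by blast
  have "eventually (\<lambda>k. ground_state a n \<beta> x * ((\<Prod>i\<in>{1..n}. exp (- (1 / real (Suc k)) / (norm (x - a i))\<^sup>2))
      * exp (- (real (Suc k))\<^sup>2 / ((real (Suc k))\<^sup>2 - (norm x)\<^sup>2)))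
      = approx_ground_state a n \<beta> (1 / real (Suc k)) (real (Suc k)) x) sequentially"
    using eventually_ge_at_top[of N]
  proof eventually_elim
    case (elim k)
    then have "norm x < real (Suc k)"
      using N by linarith
    then show ?case
      by (rule approx_ground_state_eq[OF x, symmetric])
  qed
  moreover have "(\<lambda>k. ground_state a n \<beta> x * ((\<Prod>i\<in>{1..n}. exp (- (1 / real (Suc k)) / (norm (x - a i))\<^sup>2))
      * exp (- (real (Suc k))\<^sup>2 / ((real (Suc k))\<^sup>2 - (norm x)\<^sup>2)))) \<longlonglongrightarrow> ground_state a n \<beta> x * (1 * exp (- 1))"
    by (intro tendsto_intros 1 2)
  ultimately show ?thesis
    using Lim_transform_eventually by fastforce
qed

lemma cutoff_field_tendsto:
  "(\<lambda>k. cutoff_field a n (1 / real (Suc k)) (real (Suc k)) x) \<longlonglongrightarrow> 0"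
proof -
  have "(\<lambda>k. 2 * (1 / real (Suc k)) / c) \<longlonglongrightarrow> 0" for c
    by (cases "c = 0") (simp, real_asymp)
  moreover have "(\<lambda>k. 2 * (real (Suc k))\<^sup>2 / ((real (Suc k))\<^sup>2 - c)\<^sup>2) \<longlonglongrightarrow> 0" for c
    by real_asymp
  ultimately have "(\<lambda>k. cutoff_field a n (1 / real (Suc k)) (real (Suc k)) x)
      \<longlonglongrightarrow> (\<Sum>i\<in>{1..n}. 0 *\<^sub>R (x - a i)) - 0 *\<^sub>R x"
    unfolding cutoff_field_def
    by (intro tendsto_diff tendsto_sum tendsto_scaleR tendsto_const)
  then show ?thesis by simp
qed

section \<open>Optimality of the constant\<close>

lemma ext_integral_integrable:
  assumes "integrable M f"
  shows "ext_integral M f = ereal (\<integral>x. f x \<partial>M)"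
proof -
  have e: "enn2ereal u = ereal (enn2real u)" if "u \<noteq> \<infinity>" for u
    using that by (cases u) auto
  have "(\<integral>\<^sup>+x. ennreal (f x) \<partial>M) \<noteq> \<infinity>" "(\<integral>\<^sup>+x. ennreal (- f x) \<partial>M) \<noteq> \<infinity>"
    using assms by (auto simp: real_integrable_def)
  then show ?thesis
    unfolding ext_integral_def real_lebesgue_integral_def[OF assms] by (simp add: e)
qed

lemma ext_integral_weighted:
  fixes \<mu> f :: "'a::euclidean_space \<Rightarrow> real"
  assumes \<mu>: "\<mu> \<in> borel_measurable lebesgue" "\<And>x. \<mu> x \<ge> 0"
    and f: "f \<in> borel_measurable lebesgue" "integrable lebesgue (\<lambda>x. \<mu> x * f x)"
  shows "integrable (weighted \<mu>) f"
    and "ext_integral (weighted \<mu>) f = ereal (\<integral>x. \<mu> x * f x \<partial>lebesgue)"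
proof -
  show i: "integrable (weighted \<mu>) f"
    unfolding weighted_def using assms by (subst integrable_real_density) auto
  have "(\<integral>x. f x \<partial>weighted \<mu>) = (\<integral>x. \<mu> x * f x \<partial>lebesgue)"
    unfolding weighted_def using assms by (subst integral_real_density) auto
  then show "ext_integral (weighted \<mu>) f = ereal (\<integral>x. \<mu> x * f x \<partial>lebesgue)"
    using ext_integral_integrable[OF i] by simp
qed

text \<open>Applies the rule for squares to sqrt \<mu>; the existence of one weak gradient makes the
  choice in \<open>weak_grad \<mu>\<close> meaningful.\<close>

lemma has_weak_gradient_of_sqrt_H1_loc:
  assumes "\<And>x. \<mu> x \<ge> 0" and "(\<lambda>x. sqrt (\<mu> x)) \<in> H1_loc"
  shows "has_weak_gradient \<mu> (weak_grad \<mu>)"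
proof -
  obtain G where G: "has_weak_gradient (\<lambda>x. sqrt (\<mu> x)) G" "locally_integrable (\<lambda>x. (norm (G x))\<^sup>2)"
    "locally_integrable (\<lambda>x. (sqrt (\<mu> x))\<^sup>2)"
    using assms(2) by (auto simp: H1_loc_def)
  from has_weak_gradient_square[OF G(1,3,2)]
  have "has_weak_gradient \<mu> (\<lambda>x. (2 * sqrt (\<mu> x)) *\<^sub>R G x)"
    using assms(1) by simp
  then show ?thesis
    by (rule has_weak_gradient_weak_grad)
qed

text \<open>In \<open>ennreal\<close> the reciprocal is infinite where \<mu> vanishes, whereas a
  finite integral over each ball makes it finite almost everywhere.\<close>

lemma AE_pos_of_locally_integrable_inverse:
  fixes \<mu> :: "'a::euclidean_space \<Rightarrow> real"
  assumes nn: "\<And>x. \<mu> x \<ge> 0" and inv: "locally_integrable_ennreal (\<lambda>x. inverse (ennreal (\<mu> x)))"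
  shows "AE x in lebesgue. \<mu> x > 0"
proof -
  have m: "(\<lambda>x. inverse (ennreal (\<mu> x))) \<in> borel_measurable lebesgue"
    using inv by (simp add: locally_integrable_ennreal_def)
  have "AE x in lebesgue. inverse (ennreal (\<mu> x)) * indicator (cball 0 (real k)) x \<noteq> \<infinity>" for k
  proof (rule nn_integral_PInf_AE)
    show "(\<lambda>x. inverse (ennreal (\<mu> x)) * indicator (cball 0 (real k)) x) \<in> borel_measurable lebesgue"
      by (intro borel_measurable_times_ennreal m borel_measurable_indicator) simp
    have "compact (cball (0::'a) (real k))"
      by simp
    then show "(\<integral>\<^sup>+x. inverse (ennreal (\<mu> x)) * indicator (cball 0 (real k)) x \<partial>lebesgue) \<noteq> \<infinity>"
      using inv unfolding locally_integrable_ennreal_def by (auto simp: less_top[symmetric])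
  qed
  then have "AE x in lebesgue. \<forall>k. inverse (ennreal (\<mu> x)) * indicator (cball 0 (real k)) x \<noteq> \<infinity>"
    by (simp add: AE_all_countable)
  then show ?thesis
  proof eventually_elim
    case (elim x)
    obtain k where "norm x \<le> real k"
      using real_arch_simple by blast
    then have "inverse (ennreal (\<mu> x)) \<noteq> \<infinity>"
      using elim[rule_format, of k] by simp
    then have "\<mu> x \<noteq> 0"
      by auto
    then show ?case
      using nn[of x] by simp
  qed
qed

lemma potV_pos:
  assumes n: "n \<ge> 2" and inj: "inj_on a {1..n}" and x: "x \<notin> a ` {1..n}"
  shows "potV a n x > 0"
proof -
  let ?f = "\<lambda>i j. (norm (a i - a j))\<^sup>2 / ((norm (x - a i))\<^sup>2 * (norm (x - a j))\<^sup>2)"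
  have "a 1 \<noteq> a 2"
    using inj_onD[OF inj, of 1 2] n by auto
  moreover have "x \<noteq> a 1" "x \<noteq> a 2"
    using x n by auto
  ultimately have "0 < ?f 1 2"
    by simp
  also have "\<dots> \<le> (\<Sum>j\<in>{1..n} - {1}. ?f 1 j)"
    using n by (intro member_le_sum[of 2]) auto
  also have "\<dots> \<le> (\<Sum>i\<in>{1..n}. \<Sum>j\<in>{1..n} - {i}. ?f i j)"
    using n by (intro member_le_sum[of 1 _ "\<lambda>i. \<Sum>j\<in>{1..n} - {i}. ?f i j"] sum_nonneg) auto
  finally show ?thesis
    by (simp add: potV_def)
qed

lemma AE_lebesgue_False: "\<not> (AE x in (lebesgue :: 'a::euclidean_space measure). False)"
proof
  assume "AE x in (lebesgue :: 'a measure). False"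
  then have "AE x in (lebesgue :: 'a measure). x \<notin> UNIV"
    by simp
  then have "negligible (UNIV :: 'a set)"
    unfolding negligible_iff_null_sets by (subst AE_iff_null_sets) auto
  then show False
    using open_not_negligible[OF open_UNIV] by simp
qed

text \<open>If the inequality held for all k, the differences \<open>Q k\<close> would have
  nonpositive integrals. They converge dominatedly to (c - \<beta>^2) \<mu> V \<phi>_0^2 exp(-2),
  which is positive almost everywhere.\<close>

lemma approx_ground_state_Hardy_limit:
  fixes a :: "nat \<Rightarrow> real^'n" and n :: nat and \<beta> c :: real and T :: "nat \<Rightarrow> real^'n \<Rightarrow> real"
  defines "\<phi> \<equiv> \<lambda>k. approx_ground_state a n \<beta> (1 / real (Suc k)) (real (Suc k))"
    and "Y \<equiv> \<lambda>k. cutoff_field a n (1 / real (Suc k)) (real (Suc k))"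
  assumes n: "n \<ge> 2" and inj: "inj_on a {1..n}" and c: "c > \<beta>\<^sup>2"
    and \<mu>: "\<mu> \<in> borel_measurable lebesgue" "\<And>x. \<mu> x \<ge> 0" "AE x in lebesgue. \<mu> x > 0"
    and energy: "integrable lebesgue (\<lambda>x. \<mu> x * ((ground_state a n \<beta> x)\<^sup>2 * pole_sum a n x))"
    and V: "\<And>k. integrable lebesgue (\<lambda>x. \<mu> x * (potV a n x * (\<phi> k x)\<^sup>2))"
    and T: "\<And>k. integrable lebesgue (T k)"
      "\<And>k. AE x in lebesgue. T k x = \<mu> x * ((\<phi> k x)\<^sup>2 * (\<beta>\<^sup>2 * potV a n x + (norm (Y k x))\<^sup>2))"
  shows "\<exists>k. c * (\<integral>x. \<mu> x * (potV a n x * (\<phi> k x)\<^sup>2) \<partial>lebesgue) > (\<integral>x. T k x \<partial>lebesgue)"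
proof (rule ccontr)
  assume "\<not> ?thesis"
  then have le: "c * (\<integral>x. \<mu> x * (potV a n x * (\<phi> k x)\<^sup>2) \<partial>lebesgue) \<le> (\<integral>x. T k x \<partial>lebesgue)" for k
    by (auto simp: not_less)
  let ?g = "ground_state a n \<beta>" and ?S = "pole_sum a n"
  define Q where "Q = (\<lambda>k x. c * (\<mu> x * (potV a n x * (\<phi> k x)\<^sup>2)) - T k x)"
  define L where "L = (\<lambda>x. \<mu> x * ((c - \<beta>\<^sup>2) * potV a n x * (?g x * exp (- 1))\<^sup>2))"
  \<comment> \<open>The first summand comes from V \<le> n times the pole sum, the second from the
    uniform bound on the cutoff gradient.\<close>
  define D where "D = (c - \<beta>\<^sup>2) * real n + (6 + 4 * norm (a 1))\<^sup>2 * real n"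
  have Qi: "integrable lebesgue (Q k)" for k
    unfolding Q_def using V T(1) by simp
  have Q_le: "(\<integral>x. Q k x \<partial>lebesgue) \<le> 0" for k
    using le[of k] V[of k] T(1)[of k] by (simp add: Q_def)
  have Q_eq: "AE x in lebesgue. \<forall>k. Q k x
      = \<mu> x * ((c - \<beta>\<^sup>2) * potV a n x * (\<phi> k x)\<^sup>2 - (\<phi> k x)\<^sup>2 * (norm (Y k x))\<^sup>2)"
  proof -
    have "AE x in lebesgue. \<forall>k. T k x = \<mu> x * ((\<phi> k x)\<^sup>2 * (\<beta>\<^sup>2 * potV a n x + (norm (Y k x))\<^sup>2))"
      using T(2) by (simp add: AE_all_countable)
    then show ?thesis
      by eventually_elim (simp add: Q_def algebra_simps)
  qed
  have np: "AE x in lebesgue. x \<notin> a ` {1..n}"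
    by (rule AE_not_pole)
  have Lm: "L \<in> borel_measurable lebesgue"
  proof -
    have "(\<lambda>x. (c - \<beta>\<^sup>2) * potV a n x * (?g x * exp (- 1))\<^sup>2) \<in> borel_measurable lborel"
      by measurable
    then show ?thesis
      unfolding L_def by (intro borel_measurable_times[OF \<mu>(1)] measurable_completion)
  qed
  have lim: "AE x in lebesgue. (\<lambda>k. Q k x) \<longlonglongrightarrow> L x"
    using Q_eq np
  proof eventually_elim
    case (elim x)
    have "(\<lambda>k. \<mu> x * ((c - \<beta>\<^sup>2) * potV a n x * (\<phi> k x)\<^sup>2 - (\<phi> k x)\<^sup>2 * (norm (Y k x))\<^sup>2))
        \<longlonglongrightarrow> \<mu> x * ((c - \<beta>\<^sup>2) * potV a n x * (?g x * exp (- 1))\<^sup>2 - (?g x * exp (- 1))\<^sup>2 * (norm (0 :: real^'n))\<^sup>2)"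
      unfolding \<phi>_def Y_def
      by (intro tendsto_intros approx_ground_state_tendsto[OF elim(2)] cutoff_field_tendsto)
    then show ?case
      using elim(1) by (simp add: L_def)
  qed
  have bound: "AE x in lebesgue. norm (Q k x) \<le> D * (\<mu> x * ((?g x)\<^sup>2 * ?S x))" for k
    using Q_eq np
  proof eventually_elim
    case (elim x)
    have abs_diff_le: "\<bar>u - v\<bar> \<le> p + q" if "u \<le> p" "v \<le> q" "0 \<le> u" "0 \<le> v" for u v p q :: real
      using that by linarith
    have "(\<phi> k x)\<^sup>2 \<le> (?g x)\<^sup>2"
      unfolding \<phi>_def
      by (intro power_mono approx_ground_state_le approx_ground_state_nonneg elim(2)) auto
    then have "potV a n x * (\<phi> k x)\<^sup>2 \<le> (real n * ?S x) * (?g x)\<^sup>2"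
      by (intro mult_mono potV_le[OF elim(2)] mult_nonneg_nonneg pole_sum_nonneg) auto
    then have "(c - \<beta>\<^sup>2) * (potV a n x * (\<phi> k x)\<^sup>2) \<le> (c - \<beta>\<^sup>2) * ((real n * ?S x) * (?g x)\<^sup>2)"
      using c by (intro mult_left_mono) auto
    moreover have "(\<phi> k x)\<^sup>2 * (norm (Y k x))\<^sup>2 \<le> (6 + 4 * norm (a 1))\<^sup>2 * real n * ((?g x)\<^sup>2 * ?S x)"
      unfolding \<phi>_def Y_def using n by (intro approx_cutoff_field_le elim(2)) auto
    moreover have "0 \<le> (c - \<beta>\<^sup>2) * (potV a n x * (\<phi> k x)\<^sup>2)" "0 \<le> (\<phi> k x)\<^sup>2 * (norm (Y k x))\<^sup>2"
      using c by (auto intro!: mult_nonneg_nonneg potV_nonneg)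
    ultimately have "\<bar>(c - \<beta>\<^sup>2) * (potV a n x * (\<phi> k x)\<^sup>2) - (\<phi> k x)\<^sup>2 * (norm (Y k x))\<^sup>2\<bar>
        \<le> (c - \<beta>\<^sup>2) * ((real n * ?S x) * (?g x)\<^sup>2)
          + (6 + 4 * norm (a 1))\<^sup>2 * real n * ((?g x)\<^sup>2 * ?S x)"
      by (rule abs_diff_le)
    also have "\<dots> = D * ((?g x)\<^sup>2 * ?S x)"
      by (simp add: D_def algebra_simps)
    finally have "\<bar>(c - \<beta>\<^sup>2) * (potV a n x * (\<phi> k x)\<^sup>2) - (\<phi> k x)\<^sup>2 * (norm (Y k x))\<^sup>2\<bar>
        \<le> D * ((?g x)\<^sup>2 * ?S x)" .
    then have "\<mu> x * \<bar>(c - \<beta>\<^sup>2) * (potV a n x * (\<phi> k x)\<^sup>2) - (\<phi> k x)\<^sup>2 * (norm (Y k x))\<^sup>2\<bar>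
        \<le> \<mu> x * (D * ((?g x)\<^sup>2 * ?S x))"
      by (intro mult_left_mono \<mu>(2))
    then show ?case
      using elim(1) \<mu>(2)[of x] by (simp add: abs_mult mult_ac)
  qed
  have conv: "(\<lambda>k. \<integral>x. Q k x \<partial>lebesgue) \<longlonglongrightarrow> (\<integral>x. L x \<partial>lebesgue)" and Li: "integrable lebesgue L"
  proof -
    have m: "Q k \<in> borel_measurable lebesgue" for k
      using Qi by auto
    note dc = Lm m integrable_mult_right[OF energy] lim bound
    show "(\<lambda>k. \<integral>x. Q k x \<partial>lebesgue) \<longlonglongrightarrow> (\<integral>x. L x \<partial>lebesgue)"
      by (rule integral_dominated_convergence[OF dc])
    show "integrable lebesgue L"
      by (rule integrable_dominated_convergence[OF dc])
  qed
  have "(\<integral>x. L x \<partial>lebesgue) \<le> 0"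
    using LIMSEQ_le_const2[OF conv] Q_le by blast
  moreover have nonneg: "AE x in lebesgue. 0 \<le> L x"
    using c by (auto simp: L_def intro!: always_eventually mult_nonneg_nonneg \<mu>(2) potV_nonneg)
  ultimately have "(\<integral>x. L x \<partial>lebesgue) = 0"
    using integral_nonneg_AE[OF nonneg] by linarith
  then have "AE x in lebesgue. L x = 0"
    using integral_nonneg_eq_0_iff_AE[OF Li nonneg] by simp
  \<comment> \<open>Off the poles and where \<mu> > 0 the limit is positive, so its vanishing almost
    everywhere would make the whole space negligible.\<close>
  then have "AE x in (lebesgue :: (real^'n) measure). False"
    using np \<mu>(3)
  proof eventually_elim
    case (elim x)
    have "?g x > 0"
      unfolding ground_state_def using elim(2) by (intro prod_pos) auto
    then have "L x > 0"
      unfolding L_def using c potV_pos[OF n inj elim(2)] elim(3)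
      by (intro mult_pos_pos zero_less_power) auto
    then show ?case using elim(1) by simp
  qed
  then show False
    using AE_lebesgue_False by blast
qed

theorem theorem3p1:
  fixes a :: "nat \<Rightarrow> real^'n"
    and \<mu> :: "real^'n \<Rightarrow> real"
    and n :: nat
    and C\<^sub>\<mu> K\<^sub>\<mu> C \<gamma> c :: real
  assumes "CARD('n) \<ge> 3"
    and "n \<ge> 2"
    and "inj_on a {1..n}"
    and "\<And>x. \<mu> x \<ge> 0"
    and "(\<lambda>x. sqrt (\<mu> x)) \<in> H1_loc"
    and "locally_integrable_ennreal (\<lambda>x. inverse (ennreal (\<mu> x)))"
    and "K\<^sub>\<mu> > 2 - real CARD('n)"
    and "AE x in lebesgue. potW \<mu> a n K\<^sub>\<mu> x \<le> C\<^sub>\<mu>"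
    and "\<And>i. i \<in> {1..n} \<Longrightarrow> locally_integrable
           (\<lambda>x. \<mu> x / norm (x - a i) powr (2 / real n * (real CARD('n) + K\<^sub>\<mu> - 2) + 2))"
    and "\<gamma> > - (real CARD('n) + 2 * K\<^sub>\<mu> - 2)"
    and "\<And>x. norm x > Max ((\<lambda>i. norm (a i)) ` {1..n}) \<Longrightarrow> \<mu> x \<le> C / norm x powr \<gamma>"
    and "c > (real CARD('n) + K\<^sub>\<mu> - 2)\<^sup>2 / (real n)\<^sup>2"
  shows "\<exists>\<phi> \<in> H1 \<mu>.
    \<not> (ereal c * ext_integral (weighted \<mu>) (\<lambda>x. potV a n x * (\<phi> x)\<^sup>2)
        \<le> ext_integral (weighted \<mu>) (\<lambda>x. (norm (weak_grad \<phi> x))\<^sup>2)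
          + ext_integral (weighted \<mu>) (\<lambda>x. potW \<mu> a n K\<^sub>\<mu> x * (\<phi> x)\<^sup>2))"
proof -
  define \<beta> where "\<beta> = (real CARD('n) + K\<^sub>\<mu> - 2) / real n"
  have n\<beta>: "real n * \<beta> = real CARD('n) + K\<^sub>\<mu> - 2"
    using assms(2) by (simp add: \<beta>_def)
  have \<beta>: "\<beta> \<ge> 0"
    using assms(7) by (simp add: \<beta>_def)
  have c: "c > \<beta>\<^sup>2"
    using assms(12) by (simp add: \<beta>_def power_divide)
  have \<mu>1: "has_weak_gradient \<mu> (weak_grad \<mu>)"
    by (rule has_weak_gradient_of_sqrt_H1_loc[OF assms(4,5)])
  have \<mu>3: "AE x in lebesgue. \<mu> x > 0"
    by (rule AE_pos_of_locally_integrable_inverse[OF assms(4,6)])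
  have m\<mu>: "\<mu> \<in> borel_measurable lebesgue"
    using \<mu>1 locally_integrable_measurable by (auto simp: has_weak_gradient_def)
  have n0: "n > 0"
    using assms(2) by simp
  define \<phi> where "\<phi> = (\<lambda>k. approx_ground_state a n \<beta> (1 / real (Suc k)) (real (Suc k)))"
  define G where "G = (\<lambda>k. grad_approx a n \<beta> (1 / real (Suc k)) (real (Suc k)))"
  define Y where "Y = (\<lambda>k. cutoff_field a n (1 / real (Suc k)) (real (Suc k)))"
  have pos: "0 < 1 / real (Suc k)" "0 < real (Suc k)" for k
    by simp_all
  have en: "integrable lebesgue (\<lambda>x. \<mu> x * (\<phi> k x)\<^sup>2)"
    "integrable lebesgue (\<lambda>x. \<mu> x * (norm (G k x))\<^sup>2)"
    "integrable lebesgue (\<lambda>x. \<mu> x * (potV a n x * (\<phi> k x)\<^sup>2))"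
    "integrable lebesgue (\<lambda>x. \<mu> x * (potW \<mu> a n K\<^sub>\<mu> x * (\<phi> k x)\<^sup>2))" for k
    unfolding \<phi>_def G_def by (rule approx_energy[OF pos \<mu>1 assms(4) \<mu>3 n\<beta> n0])+
  \<comment> \<open>The energy identity only asserts existence of an integrand for each k; a
    sequence of them is chosen for the limit argument.\<close>
  have "\<exists>T. \<forall>k. integrable lebesgue (T k)
      \<and> (AE x in lebesgue. T k x = \<mu> x * ((\<phi> k x)\<^sup>2 * (\<beta>\<^sup>2 * potV a n x + (norm (Y k x))\<^sup>2)))
      \<and> (\<integral>x. \<mu> x * (norm (G k x))\<^sup>2 \<partial>lebesgue)
          + (\<integral>x. \<mu> x * (potW \<mu> a n K\<^sub>\<mu> x * (\<phi> k x)\<^sup>2) \<partial>lebesgue) = (\<integral>x. T k x \<partial>lebesgue)"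
    unfolding \<phi>_def G_def Y_def
    by (intro choice allI approx_energy(5)[OF pos \<mu>1 assms(4) \<mu>3 n\<beta> n0])
  then obtain T where T: "\<And>k. integrable lebesgue (T k)"
      "\<And>k. AE x in lebesgue. T k x = \<mu> x * ((\<phi> k x)\<^sup>2 * (\<beta>\<^sup>2 * potV a n x + (norm (Y k x))\<^sup>2))"
      "\<And>k. (\<integral>x. \<mu> x * (norm (G k x))\<^sup>2 \<partial>lebesgue)
          + (\<integral>x. \<mu> x * (potW \<mu> a n K\<^sub>\<mu> x * (\<phi> k x)\<^sup>2) \<partial>lebesgue) = (\<integral>x. T k x \<partial>lebesgue)"
    by blast
  have energy: "integrable lebesgue (\<lambda>x. \<mu> x * ((ground_state a n \<beta> x)\<^sup>2 * pole_sum a n x))"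
  proof (rule integrable_ground_state_energy[OF _ assms(3) \<beta> m\<mu> assms(4) _ assms(11)])
    have "2 / real n * (real CARD('n) + K\<^sub>\<mu> - 2) + 2 = 2 * \<beta> + 2"
      by (simp add: \<beta>_def)
    then show "locally_integrable (\<lambda>x. \<mu> x / norm (x - a i) powr (2 * \<beta> + 2))" if "i \<in> {1..n}" for i
      using assms(9)[OF that] by simp
    show "norm (a i) \<le> Max ((\<lambda>i. norm (a i)) ` {1..n})" if "i \<in> {1..n}" for i
      using that by (intro Max_ge) auto
    \<comment> \<open>Since n \<beta> = N + K - 2, the left side is \<gamma> + 2 N + 2 K - 2, and
      the claim is the lower bound on \<gamma>.\<close>
    show "\<gamma> + 2 * real n * \<beta> + 2 > real CARD('n)"
      using assms(10) n\<beta> by (simp add: mult.assoc)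
  qed (use n0 in auto)
  obtain k where k: "c * (\<integral>x. \<mu> x * (potV a n x * (\<phi> k x)\<^sup>2) \<partial>lebesgue) > (\<integral>x. T k x \<partial>lebesgue)"
    using approx_ground_state_Hardy_limit[OF assms(2,3) c m\<mu> assms(4) \<mu>3 energy en(3)[unfolded \<phi>_def] T(1)
        T(2)[unfolded \<phi>_def Y_def]]
    unfolding \<phi>_def by blast
  have c\<phi>: "continuous_on UNIV (\<phi> k)"
    unfolding \<phi>_def using Ck_imp_continuous[OF Ck_approx[OF pos]] .
  have m\<phi>: "\<phi> k \<in> borel_measurable lebesgue"
    using c\<phi> by (simp add: borel_measurable_continuous_onI measurable_completion)
  have "continuous_on UNIV (G k)"
    unfolding G_def by (rule continuous_grad_approx[OF pos])
  then have mG: "G k \<in> borel_measurable lebesgue"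
    by (simp add: borel_measurable_continuous_onI measurable_completion)
  have w\<phi>: "has_weak_gradient (\<phi> k) (G k)"
    unfolding \<phi>_def G_def by (rule has_weak_gradient_approx[OF pos])
  have w\<phi>': "has_weak_gradient (\<phi> k) (weak_grad (\<phi> k))"
    by (rule has_weak_gradient_weak_grad[OF w\<phi>])
  have mw: "weak_grad (\<phi> k) \<in> borel_measurable lebesgue"
    using w\<phi>' locally_integrable_measurable by (auto simp: has_weak_gradient_def)
  \<comment> \<open>The claim concerns the chosen \<open>weak_grad (\<phi> k)\<close>, the energy
    identity the classical gradient \<open>G k\<close>.\<close>
  have ae: "AE x in lebesgue. \<mu> x * (norm (G k x))\<^sup>2 = \<mu> x * (norm (weak_grad (\<phi> k) x))\<^sup>2"
    using has_weak_gradient_unique[OF w\<phi> w\<phi>'] by eventually_elim simp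
  have mmG: "(\<lambda>x. (norm (G k x))\<^sup>2) \<in> borel_measurable lebesgue"
    and mmw: "(\<lambda>x. (norm (weak_grad (\<phi> k) x))\<^sup>2) \<in> borel_measurable lebesgue"
    by (intro borel_measurable_power measurable_compose[OF _ borel_measurable_norm] mG mw)+
  have wi: "integrable lebesgue (\<lambda>x. \<mu> x * (norm (weak_grad (\<phi> k) x))\<^sup>2)"
    by (rule integrable_cong_AE_imp[OF en(2) borel_measurable_times[OF m\<mu> mmw]])
       (use ae in eventually_elim, simp)
  have weq: "(\<integral>x. \<mu> x * (norm (weak_grad (\<phi> k) x))\<^sup>2 \<partial>lebesgue) = (\<integral>x. \<mu> x * (norm (G k x))\<^sup>2 \<partial>lebesgue)"
    using integral_cong_AE[OF borel_measurable_integrable[OF en(2)] borel_measurable_integrable[OF wi] ae] by simp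
  have mV: "(\<lambda>x. potV a n x * (\<phi> k x)\<^sup>2) \<in> borel_measurable lebesgue"
    by (intro borel_measurable_times borel_measurable_power m\<phi> measurable_completion) simp
  have mW: "(\<lambda>x. potW \<mu> a n K\<^sub>\<mu> x * (\<phi> k x)\<^sup>2) \<in> borel_measurable lebesgue"
    by (intro borel_measurable_times borel_measurable_power m\<phi> measurable_potW[OF \<mu>1])
  note ext = ext_integral_weighted(2)[OF m\<mu> assms(4)]
  \<comment> \<open>All three extended integrals are finite for this function, so the comparison in
    \<open>ereal\<close> is one of real numbers.\<close>
  have "\<not> (ereal c * ext_integral (weighted \<mu>) (\<lambda>x. potV a n x * (\<phi> k x)\<^sup>2)
        \<le> ext_integral (weighted \<mu>) (\<lambda>x. (norm (weak_grad (\<phi> k) x))\<^sup>2)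
          + ext_integral (weighted \<mu>) (\<lambda>x. potW \<mu> a n K\<^sub>\<mu> x * (\<phi> k x)\<^sup>2))"
    unfolding ext[OF mV en(3)] ext[OF mmw wi] ext[OF mW en(4)] weq using k T(3)[of k] by simp
  moreover have "\<phi> k \<in> H1 \<mu>"
  proof -
    have "\<phi> k \<in> L2 (weighted \<mu>)"
      using ext_integral_weighted(1)[OF m\<mu> assms(4), of "\<lambda>x. (\<phi> k x)\<^sup>2"] en(1)[of k] m\<phi>
      by (simp add: L2_def weighted_def \<phi>_def borel_measurable_power)
    moreover have "G k \<in> L2 (weighted \<mu>)"
      using ext_integral_weighted(1)[OF m\<mu> assms(4) mmG en(2)] mG by (simp add: L2_def weighted_def)
    ultimately show ?thesis
      using w\<phi> by (auto simp: H1_def)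
  qed
  ultimately show ?thesis
    by blast
qed

end
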